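(* Let $\ell_1,\ell_2$ and $n$ be positive integers. Let $\lambda,\mu,\nu$ be partitions of $n$ such that $\mu$ has length at most $\ell_1$ and $\nu$ has length at most $\ell_2$. If $\lambda$ has length at most $\ell_1\ell_2$ then \[ g_{\mu\nu}^{\lambda}=\sum_{i=1}^{\ell_1\ell_2}(-1)^{i+1}\,\overline{g}_{\overline{\mu},\overline{\nu}}^{\lambda^{\dagger i}}, \] where $\lambda^{\dagger i}$ is the partition obtained from $\lambda$ by incrementing the $i-1$ first parts and removing the $i$-th part, that is, \[ \lambda^{\dagger i}=(1+\lambda_1,1+\lambda_2,\ldots,1+\lambda_{i-1},\lambda_{i+1},\lambda_{i+2},\ldots). \]
   Context: For partitions $\lambda,\mu,\nu$ of $n$, the Kronecker coefficient $g_{\mu\nu}^{\lambda}$ is the multiplicity of the irreducible complex representation $V_\lambda$ of the symmetric group $S_n$ in $V_\mu\otimes V_\nu$. Partitions are extended by zeros: $\lambda_i=0$ for $i$ greater than the length of $\lambda$. For a partition $\mu=(\mu_1,\mu_2,\mu_3,\ldots)$, $\overline{\mu}=(\mu_2,\mu_3,\ldots)$ is the partition obtained by removing the first part. $|\alpha|$ is the sum of the parts of $\alpha$, and $(n-|\alpha|,\alpha)$ denotes the sequence $(n-|\alpha|,\alpha_1,\alpha_2,\ldots)$. Reduced Kronecker coefficients: for partitions $\alpha,\beta,\gamma$ (of arbitrary weights), the sequence of Kronecker coefficients $g_{(n-|\alpha|,\alpha),(n-|\beta|,\beta)}^{(n-|\gamma|,\gamma)}$ (defined for all $n$ large enough that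 the three indices are partitions) is eventually constant (Murnaghan), and $\overline{g}_{\alpha,\beta}^{\gamma}$ denotes its limit. Equivalently (Murnaghan's theorem), the $\overline{g}_{\alpha,\beta}^{\gamma}$ are the nonnegative integers, finitely many nonzero for fixed $\alpha,\beta$, such that for all $n\ge 0$ \[ s_{(n-|\alpha|,\alpha)}\ast s_{(n-|\beta|,\beta)}=\sum_\gamma\overline{g}_{\alpha,\beta}^{\gamma}\,s_{(n-|\gamma|,\gamma)}, \] where $\ast$ is the Kronecker (internal) product of symmetric functions and $s_\lambda=\det(h_{j-i+\lambda_i})_{i,j}$ is defined by the Jacobi–Trudi determinant for arbitrary integer sequences ($h_k$ complete sums, $h_0=1$, $h_k=0$ for $k<0$). *)

theory Defs
  imports Complex_Main "HOL-Library.FuncSet" "HOL-Library.Function_Algebras"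
    "HOL-Combinatorics.Permutations"
begin

subsection \<open>Partitions\<close>

text \<open>
  A partition is a weakly decreasing sequence of naturals with finitely many nonzero terms, so
  the extension by zeros is built in. Parts are indexed from 0: \<open>lam 0\<close> is the first part.
\<close>

definition is_partition :: "(nat \<Rightarrow> nat) \<Rightarrow> bool" where
  "is_partition lam \<longleftrightarrow> antimono lam \<and> finite {j. lam j \<noteq> 0}"

definition weight :: "(nat \<Rightarrow> nat) \<Rightarrow> nat" where
  "weight lam = (\<Sum>j | lam j \<noteq> 0. lam j)"

definition part_length :: "(nat \<Rightarrow> nat) \<Rightarrow> nat" where
  "part_length lam = card {j. lam j \<noteq> 0}"

definition partition_of :: "nat \<Rightarrow> (nat \<Rightarrow> nat) \<Rightarrow> bool" where
  "partition_of n lam \<longleftrightarrow> is_partition lam \<and> weight lam = n"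

definition remove_first :: "(nat \<Rightarrow> nat) \<Rightarrow> nat \<Rightarrow> nat" where
  "remove_first mu = (\<lambda>j. mu (Suc j))"

text \<open>
  The sequence \<open>(n - |alpha|, alpha)\<close>. The truncated subtraction matters only for
  \<open>n < |alpha|\<close>, which is irrelevant to the limit in \<open>reduced_kronecker\<close>.
\<close>

definition pad :: "nat \<Rightarrow> (nat \<Rightarrow> nat) \<Rightarrow> nat \<Rightarrow> nat" where
  "pad n alpha = (\<lambda>j. case j of 0 \<Rightarrow> n - weight alpha | Suc k \<Rightarrow> alpha k)"

text \<open>
  Here \<open>i \<ge> 1\<close> counts parts from 1, whereas the sequence index \<open>j\<close> starts at 0: the first
  \<open>i - 1\<close> parts are those with \<open>j + 1 < i\<close>.
\<close>

definition dagger :: "nat \<Rightarrow> (nat \<Rightarrow> nat) \<Rightarrow> nat \<Rightarrow> nat" where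
  "dagger i lam = (\<lambda>j. if j + 1 < i then 1 + lam j else lam (j + 1))"


subsection \<open>Complex representations of the symmetric group\<close>

definition cscale :: "complex \<Rightarrow> ('a \<Rightarrow> complex) \<Rightarrow> 'a \<Rightarrow> complex" where
  "cscale c f = (\<lambda>x. c * f x)"

interpretation cfun: vector_space "cscale :: complex \<Rightarrow> ('a \<Rightarrow> complex) \<Rightarrow> 'a \<Rightarrow> complex"
  by standard (simp_all add: cscale_def fun_eq_iff algebra_simps)

text \<open>
  The symmetric group \<open>S_n\<close> consists of the permutations of \<open>{..<n}\<close>. A representation is given
  by operators \<open>rho g\<close> on a space of functions together with a subspace stable under them; the
  operators occurring below are linear and multiplicative in \<open>g\<close>.
\<close>

type_synonym 'a operators = "(nat \<Rightarrow> nat) \<Rightarrow> ('a \<Rightarrow> complex) \<Rightarrow> 'a \<Rightarrow> complex"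

definition is_subrep :: "nat \<Rightarrow> 'a operators \<Rightarrow> ('a \<Rightarrow> complex) set \<Rightarrow> bool" where
  "is_subrep n rho V \<longleftrightarrow>
     cfun.subspace V \<and> (\<forall>g v. g permutes {..<n} \<longrightarrow> v \<in> V \<longrightarrow> rho g v \<in> V)"

definition irreducible_subrep :: "nat \<Rightarrow> 'a operators \<Rightarrow> ('a \<Rightarrow> complex) set \<Rightarrow> bool" where
  "irreducible_subrep n rho V \<longleftrightarrow>
     is_subrep n rho V \<and> V \<noteq> {0} \<and>
     (\<forall>W. W \<subseteq> V \<longrightarrow> is_subrep n rho W \<longrightarrow> W = {0} \<or> W = V)"

text \<open>
  Requiring the isomorphism to be the restriction of a linear map on the whole function space
  is no restriction, as linear maps extend from subspaces.
\<close>

definition isomorphic_reps ::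
  "nat \<Rightarrow> 'a operators \<Rightarrow> ('a \<Rightarrow> complex) set \<Rightarrow> 'b operators \<Rightarrow> ('b \<Rightarrow> complex) set \<Rightarrow> bool" where
  "isomorphic_reps n rho V sigma W \<longleftrightarrow>
     (\<exists>phi. Vector_Spaces.linear cscale cscale phi \<and> bij_betw phi V W \<and>
        (\<forall>g v. g permutes {..<n} \<longrightarrow> v \<in> V \<longrightarrow> phi (rho g v) = sigma g (phi v)))"

text \<open>\<open>W\<close> is the internal direct sum of the irreducible subrepresentations \<open>U 0, ..., U (k - 1)\<close>.\<close>

definition irreducible_decomposition ::
  "nat \<Rightarrow> 'a operators \<Rightarrow> ('a \<Rightarrow> complex) set \<Rightarrow> nat \<Rightarrow> (nat \<Rightarrow> ('a \<Rightarrow> complex) set) \<Rightarrow> bool" where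
  "irreducible_decomposition n rho W k U \<longleftrightarrow>
     (\<forall>i<k. irreducible_subrep n rho (U i)) \<and>
     bij_betw (\<lambda>u. \<Sum>i<k. u i) (\<Pi>\<^sub>E i\<in>{..<k}. U i) W"

text \<open>
  The multiplicity of an irreducible \<open>V\<close> in \<open>W\<close>. The number does not depend on the
  decomposition, so the definite description is meaningful.
\<close>

definition multiplicity_in ::
  "nat \<Rightarrow> 'a operators \<Rightarrow> ('a \<Rightarrow> complex) set \<Rightarrow> 'b operators \<Rightarrow> ('b \<Rightarrow> complex) set \<Rightarrow> nat" where
  "multiplicity_in n rho V sigma W =
     (THE m. \<exists>k U. irreducible_decomposition n sigma W k U \<and>
        m = card {i. i < k \<and> isomorphic_reps n rho V sigma (U i)})"


subsection \<open>The irreducible representations of the symmetric group\<close>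

text \<open>
  The group algebra of \<open>S_n\<close> is modelled by complex functions on permutations, a function \<open>f\<close>
  standing for the formal sum of the \<open>f x \<cdot> x\<close>; left multiplication by \<open>g\<close> is then \<open>left_mult g\<close>.
\<close>

definition left_mult :: "(nat \<Rightarrow> nat) operators" where
  "left_mult g f = (\<lambda>x. f (inv g \<circ> x))"

text \<open>
  Row and column of the entry \<open>m\<close> in the tableau of shape \<open>lam\<close> filled with \<open>0, 1, 2, ...\<close>
  along successive rows.
\<close>

definition tab_row :: "(nat \<Rightarrow> nat) \<Rightarrow> nat \<Rightarrow> nat" where
  "tab_row lam m = (LEAST r. m < (\<Sum>j\<le>r. lam j))"

definition tab_col :: "(nat \<Rightarrow> nat) \<Rightarrow> nat \<Rightarrow> nat" where
  "tab_col lam m = m - (\<Sum>j<tab_row lam m. lam j)"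

definition row_group :: "nat \<Rightarrow> (nat \<Rightarrow> nat) \<Rightarrow> (nat \<Rightarrow> nat) set" where
  "row_group n lam = {p. p permutes {..<n} \<and> (\<forall>m<n. tab_row lam (p m) = tab_row lam m)}"

definition col_group :: "nat \<Rightarrow> (nat \<Rightarrow> nat) \<Rightarrow> (nat \<Rightarrow> nat) set" where
  "col_group n lam = {q. q permutes {..<n} \<and> (\<forall>m<n. tab_col lam (q m) = tab_col lam m)}"

text \<open>
  The Young symmetrizer \<open>\<Sum>p. \<Sum>q. sign q \<cdot> (p \<circ> q)\<close>, with \<open>p\<close> in the row group and \<open>q\<close> in the
  column group.
\<close>

definition young_symmetrizer :: "nat \<Rightarrow> (nat \<Rightarrow> nat) \<Rightarrow> (nat \<Rightarrow> nat) \<Rightarrow> complex" where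
  "young_symmetrizer n lam =
     (\<lambda>x. \<Sum>p\<in>row_group n lam. \<Sum>q\<in>col_group n lam.
        if x = p \<circ> q then of_int (sign q) else 0)"

text \<open>
  For a partition \<open>lam\<close> of \<open>n\<close>, the irreducible representation \<open>V_lam\<close>: the left ideal of the
  group algebra generated by the Young symmetrizer. In this labelling \<open>V_(n)\<close> is the trivial
  representation and \<open>V_(1, ..., 1)\<close> the sign representation.
\<close>

definition irrep :: "nat \<Rightarrow> (nat \<Rightarrow> nat) \<Rightarrow> ((nat \<Rightarrow> nat) \<Rightarrow> complex) set" where
  "irrep n lam = cfun.span {left_mult g (young_symmetrizer n lam) | g. g permutes {..<n}}"


subsection \<open>Kronecker coefficients\<close>

text \<open>
  The tensor product of spaces of functions on \<open>X\<close> and on \<open>Y\<close> is realised as a space of functions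
  on the product of \<open>X\<close> and \<open>Y\<close>, the pure tensor of \<open>u\<close> and \<open>v\<close> being \<open>(x, y) \<mapsto> u x * v y\<close>.
\<close>

definition tensor_space ::
  "('a \<Rightarrow> complex) set \<Rightarrow> ('b \<Rightarrow> complex) set \<Rightarrow> ('a \<times> 'b \<Rightarrow> complex) set" where
  "tensor_space V W = cfun.span {\<lambda>(x, y). v x * w y | v w. v \<in> V \<and> w \<in> W}"

text \<open>On pure tensors this sends \<open>u \<otimes> v\<close> to \<open>left_mult g u \<otimes> left_mult g v\<close>.\<close>

definition diag_left_mult :: "((nat \<Rightarrow> nat) \<times> (nat \<Rightarrow> nat)) operators" where
  "diag_left_mult g f = (\<lambda>(x, y). f (inv g \<circ> x, inv g \<circ> y))"

text \<open>For partitions of \<open>n\<close>, the multiplicity of \<open>V_lam\<close> in \<open>V_mu \<otimes> V_nu\<close>.\<close>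

definition kronecker :: "nat \<Rightarrow> (nat \<Rightarrow> nat) \<Rightarrow> (nat \<Rightarrow> nat) \<Rightarrow> (nat \<Rightarrow> nat) \<Rightarrow> nat" where
  "kronecker n mu nu lam =
     multiplicity_in n left_mult (irrep n lam)
       diag_left_mult (tensor_space (irrep n mu) (irrep n nu))"

text \<open>
  The limit is taken in the discrete space of naturals, hence is the eventual value of the
  sequence. The finitely many \<open>n\<close> for which some index is not a partition of \<open>n\<close> play no role.
\<close>

definition reduced_kronecker :: "(nat \<Rightarrow> nat) \<Rightarrow> (nat \<Rightarrow> nat) \<Rightarrow> (nat \<Rightarrow> nat) \<Rightarrow> nat" where
  "reduced_kronecker alpha beta gamma =
     lim (\<lambda>n. kronecker n (pad n alpha) (pad n beta) (pad n gamma))"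

end

theory Submission imports Defs "HOL-Library.Multiset" begin

text \<open>
  Every irreducible character is determinantal: for \<open>b\<^sub>i = \<lambda>\<^sub>i - i\<close> it equals \<open>\<psi>\<^sub>b = \<Sum>\<^sub>w sgn w \<cdot> \<phi>\<^bsub>b+w\<^esub>\<close>, where
  \<open>\<phi>\<^sub>a\<close> is the permutation character on the labelings of the points with content \<open>a\<close>. Indeed
  \<open>\<langle>\<psi>, \<psi>\<rangle> = 1\<close> by iterating Pieri's rule, \<open>\<langle>\<chi>, \<chi>\<rangle> = 1\<close> because the Young symmetrizer is a multiple of a
  primitive idempotent, and \<open>\<langle>\<chi>, \<psi>\<rangle> = 1\<close> because the Young symmetrizer kills labelings with two equal
  labels in a column; so \<open>\<chi> - \<psi>\<close> has norm \<open>0\<close>.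

  The Kronecker coefficient thus extends to integer vectors \<open>g(\<lambda>, \<mu>, \<nu>)\<close>, alternating in \<open>b\<close>, and up to sign
  the \<open>i\<close>-th reduced coefficient of the theorem is the limit of \<open>g(\<lambda> + m e\<^sub>i, \<mu> + m e\<^sub>1, \<nu> + m e\<^sub>1)\<close>. Expanding
  \<open>\<mu>\<close> and \<open>\<nu>\<close> into tables and splitting off the corner entry of each table writes \<open>g\<close> as one alternating
  functional, independent of \<open>m\<close>, applied to the indicator of \<open>v \<le> b\<close>; adding \<open>m e\<^sub>i\<close> for large \<open>m\<close> removes the
  \<open>i\<close>-th bound. With \<open>L > n\<close> variables the indicator of \<open>v > b\<close> vanishes on the support for degree reasons.
  Expanding it as \<open>\<Prod>\<^sub>i (1 - [v\<^sub>i \<le> b\<^sub>i])\<close>, only the terms lacking at most one factor survive the alternation, and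
  \<open>g(\<lambda>, \<mu>, \<nu>)\<close> is the sum of the limits over all \<open>i \<le> L\<close>. Those with \<open>i > l\<^sub>1 l\<^sub>2\<close> are zero, since a labeling
  with fewer labels than the length of \<open>\<lambda>\<close> repeats a label in the first column.
\<close>

text \<open>\<open>multiplicity_in\<close> is a definite description over all decompositions, so it
  has a value only if a decomposition exists and all of them give the same count. Maschke averaging
  yields existence. The count is computed from an arbitrary decomposition as the trace of the
  idempotent \<open>e\<close> on the tensor product, an expression in which the decomposition no
  longer occurs; this also makes it a character sum.

  The corner is split off because raising the first parts of mu and nu by m changes only the margins
  of row 0 and column 0, and the corner entry absorbs the change. By \<open>alt_sum_insert\<close>
  the factor attached to the corner turns the extraction of one coefficient into the condition v <=
  b, so m survives in b alone. The bound L > n comes from the remaining entries: their total is at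
  most 2 n, whereas v > b in all L places requires degree at least n + L. As the coefficient is
  computed for every large m, the eventual constancy behind \<open>lim\<close> comes out along the
  way.\<close>

interpretation cpair: vector_space_pair
  "cscale :: complex \<Rightarrow> ('a \<Rightarrow> complex) \<Rightarrow> 'a \<Rightarrow> complex"
  "cscale :: complex \<Rightarrow> ('b \<Rightarrow> complex) \<Rightarrow> 'b \<Rightarrow> complex"
  by unfold_locales

section \<open>Pointwise evaluation and sums over permutations\<close>

lemma sum_fun_apply: "(\<Sum>i\<in>A. f i) x = (\<Sum>i\<in>A. f i x)"
  by (induction A rule: infinite_finite_induct) auto

lemma cscale_apply: "cscale c f x = c * f x"
  by (simp add: cscale_def)

lemma sum_perm_compose_left:
  assumes "p permutes S"
  shows "(\<Sum>x | x permutes S. f (p \<circ> x)) = (\<Sum>x | x permutes S. f x)"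
  using setum_permutations_compose_left[OF assms, of f] by simp

lemma sum_perm_compose_right:
  assumes "p permutes S"
  shows "(\<Sum>x | x permutes S. f (x \<circ> p)) = (\<Sum>x | x permutes S. f x)"
  using sum_permutations_compose_right[OF assms, of f] by simp

lemma sum_perm_inverse: "(\<Sum>x | x permutes S. f (inv x)) = (\<Sum>x | x permutes S. f x)"
  using sum_permutations_inverse[of f S] by simp

lemma permutes_inv_comp:
  assumes "x permutes S" "y permutes S"
  shows "inv (x \<circ> y) = inv y \<circ> inv x"
  using assms permutes_bij o_inv_distrib by blast

lemma permutes_cancel:
  assumes "x permutes S"
  shows "inv x \<circ> x = id" "x \<circ> inv x = id" "inv x \<circ> (x \<circ> y) = y" "x \<circ> (inv x \<circ> z) = z"
    "u \<circ> x \<circ> inv x = u" "v \<circ> inv x \<circ> x = v"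
  by (auto simp: fun_eq_iff permutes_inverses[OF assms])

lemma permutes_comp_iff:
  assumes x: "x permutes S"
  shows "(x \<circ> y) permutes S \<longleftrightarrow> y permutes S" "(y \<circ> x) permutes S \<longleftrightarrow> y permutes S"
proof -
  show "(x \<circ> y) permutes S \<longleftrightarrow> y permutes S"
    using permutes_compose[OF _ x] permutes_compose[OF _ permutes_inv[OF x]] permutes_cancel(3)[OF x] by metis
  show "(y \<circ> x) permutes S \<longleftrightarrow> y permutes S"
    using permutes_compose[OF x] permutes_compose[OF permutes_inv[OF x]] permutes_cancel(5)[OF x] by metis
qed


subsection \<open>The group algebra\<close>

definition conv :: "nat \<Rightarrow> ((nat \<Rightarrow> nat) \<Rightarrow> complex) \<Rightarrow> ((nat \<Rightarrow> nat) \<Rightarrow> complex) \<Rightarrow> (nat \<Rightarrow> nat) \<Rightarrow> complex"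
  where "conv n f h = (\<lambda>x. \<Sum>y | y permutes {..<n}. f y * h (inv y \<circ> x))"

text \<open>Functions are defined on all maps of the naturals. This condition singles out the
  genuine elements of the group algebra, for which agreement on permutations is equality.\<close>

definition supp :: "nat \<Rightarrow> ((nat \<Rightarrow> nat) \<Rightarrow> complex) \<Rightarrow> bool"
  where "supp n f \<longleftrightarrow> (\<forall>x. \<not> x permutes {..<n} \<longrightarrow> f x = 0)"

text \<open>The adjoint for the standard Hermitian form: \<open>conv n (star n f) f\<close> takes at
  \<open>id\<close> the squared norm of \<open>f\<close>. This positivity replaces all
  semisimplicity arguments below.\<close>

definition star :: "nat \<Rightarrow> ((nat \<Rightarrow> nat) \<Rightarrow> complex) \<Rightarrow> (nat \<Rightarrow> nat) \<Rightarrow> complex"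
  where "star n f = (\<lambda>x. if x permutes {..<n} then cnj (f (inv x)) else 0)"

lemma finite_perms [simp]: "finite {x. x permutes {..<n::nat}}"
  by (simp add: finite_permutations)

lemma supp_conv:
  assumes "supp n h" shows "supp n (conv n f h)"
  unfolding supp_def conv_def
proof (intro allI impI sum.neutral ballI)
  fix x y :: "nat \<Rightarrow> nat"
  assume x: "\<not> x permutes {..<n}" and "y \<in> {y. y permutes {..<n}}"
  then have "inv y permutes {..<n}"
    by (simp add: permutes_inv)
  then have "\<not> (inv y \<circ> x) permutes {..<n}"
    using x permutes_comp_iff(1) by blast
  then show "f y * h (inv y \<circ> x) = 0"
    using assms by (simp add: supp_def)
qed

lemma conv_assoc: "conv n (conv n f g) h = conv n f (conv n g h)"
proof
  fix x
  let ?S = "{x. x permutes {..<n}}"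
  have "conv n (conv n f g) h x = (\<Sum>y\<in>?S. \<Sum>z\<in>?S. f y * g (inv y \<circ> z) * h (inv z \<circ> x))"
    unfolding conv_def sum_distrib_right by (rule sum.swap)
  also have "\<dots> = (\<Sum>y\<in>?S. \<Sum>z\<in>?S. f y * (g z * h (inv z \<circ> (inv y \<circ> x))))"
  proof (rule sum.cong[OF refl])
    fix y :: "nat \<Rightarrow> nat" assume "y \<in> ?S"
    then have y: "y permutes {..<n}" by simp
    have "(\<Sum>z\<in>?S. f y * g (inv y \<circ> z) * h (inv z \<circ> x)) =
        (\<Sum>z\<in>?S. f y * g (inv y \<circ> (y \<circ> z)) * h (inv (y \<circ> z) \<circ> x))"
      by (rule sum_perm_compose_left[OF y, symmetric])
    also have "\<dots> = (\<Sum>z\<in>?S. f y * (g z * h (inv z \<circ> (inv y \<circ> x))))"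
      by (rule sum.cong) (auto simp: permutes_cancel[OF y] permutes_inv_comp[OF y] o_assoc mult.assoc)
    finally show "(\<Sum>z\<in>?S. f y * g (inv y \<circ> z) * h (inv z \<circ> x)) = \<dots>" .
  qed
  also have "\<dots> = conv n f (conv n g h) x"
    unfolding conv_def by (simp add: sum_distrib_left)
  finally show "conv n (conv n f g) h x = conv n f (conv n g h) x" .
qed

lemma conv_scale_left: "conv n (cscale k f) h = cscale k (conv n f h)"
  by (simp add: conv_def cscale_def sum_distrib_left mult.assoc)

lemma conv_scale_right: "conv n f (cscale k h) = cscale k (conv n f h)"
  by (simp add: conv_def cscale_def sum_distrib_left mult_ac)

lemma conv_zero [simp]: "conv n 0 h = 0" "conv n f 0 = 0"
  by (simp_all add: conv_def fun_eq_iff)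

lemma conv_add_left: "conv n (f + g) h = conv n f h + conv n g h"
  by (simp add: conv_def fun_eq_iff sum.distrib algebra_simps)

lemma conv_at_id: "conv n f h id = (\<Sum>y | y permutes {..<n}. f y * h (inv y))"
  by (simp add: conv_def)

lemma conv_at_id_commute: "conv n f h id = conv n h f id"
proof -
  have "conv n f h id = (\<Sum>y | y permutes {..<n}. f (inv y) * h (inv (inv y)))"
    unfolding conv_at_id by (rule sum_perm_inverse[symmetric])
  also have "\<dots> = conv n h f id"
    unfolding conv_at_id by (rule sum.cong) (auto simp: permutes_inv_inv)
  finally show ?thesis .
qed

lemma conv_eq_sum: "conv n f h = (\<Sum>y | y permutes {..<n}. cscale (f y) (left_mult y h))"
  by (simp add: fun_eq_iff conv_def sum_fun_apply cscale_def left_mult_def)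

definition basis_elt :: "'a \<Rightarrow> 'a \<Rightarrow> complex" where
  "basis_elt a = (\<lambda>x. if x = a then 1 else 0)"

lemma conv_basis_left:
  assumes "g permutes {..<n}" shows "conv n (basis_elt g) h = left_mult g h"
  using assms by (simp add: conv_def basis_elt_def left_mult_def if_distrib[of "\<lambda>t. t * _"] cong: if_cong)

lemma conv_basis_right:
  assumes "g permutes {..<n}" "x permutes {..<n}"
  shows "conv n h (basis_elt g) x = h (x \<circ> inv g)"
proof -
  have *: "inv y \<circ> x = g \<longleftrightarrow> y = x \<circ> inv g" if "y permutes {..<n}" for y
    using that assms permutes_cancel by metis
  have "x \<circ> inv g permutes {..<n}"
    using assms by (simp add: permutes_compose permutes_inv)
  then show ?thesis
    unfolding conv_def basis_elt_def by (subst sum.cong[OF refl, where h="\<lambda>y. if y = x \<circ> inv g then h y else 0"]) (auto simp: *)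
qed

lemma conv_id_left [simp]: "conv n (basis_elt id) h = h"
  by (simp add: conv_basis_left permutes_id) (simp add: left_mult_def)

lemma star_conv:
  assumes "x permutes {..<n}"
  shows "star n (conv n f h) x = conv n (star n h) (star n f) x"
proof -
  have "star n (conv n f h) x = (\<Sum>y | y permutes {..<n}. cnj (h (inv y \<circ> inv x)) * cnj (f y))"
    using assms by (simp add: star_def conv_def mult.commute)
  also have "\<dots> = (\<Sum>y | y permutes {..<n}. cnj (h (inv (inv x \<circ> y) \<circ> inv x)) * cnj (f (inv x \<circ> y)))"
    by (rule sum_perm_compose_left[OF permutes_inv[OF assms], symmetric])
  also have "\<dots> = conv n (star n h) (star n f) x"
    unfolding conv_def
  proof (rule sum.cong, goal_cases)
    case (2 y)
    then have y: "y permutes {..<n}" by simp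
    have yx: "inv y \<circ> x permutes {..<n}"
      using y assms by (simp add: permutes_compose permutes_inv)
    show ?case using y yx
      by (simp add: star_def permutes_inv_comp[OF permutes_inv[OF assms] y] permutes_inv_comp[OF permutes_inv[OF y] assms]
         permutes_inv_inv[OF assms] permutes_inv_inv[OF y] permutes_cancel[OF assms])
  qed simp
  finally show ?thesis .
qed

lemma supp_ext: "supp n f \<Longrightarrow> supp n h \<Longrightarrow> (\<And>x. x permutes {..<n} \<Longrightarrow> f x = h x) \<Longrightarrow> f = h"
  unfolding supp_def by (rule ext) metis

lemma supp_star: "supp n (star n f)"
  by (simp add: supp_def star_def)

lemma star_conv_self_eq_0:
  assumes "supp n f" "conv n (star n f) f id = 0"
  shows "f = 0"
proof -
  have "conv n (star n f) f id = (\<Sum>y | y permutes {..<n}. complex_of_real ((cmod (f (inv y)))\<^sup>2))"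
    unfolding conv_at_id star_def by (rule sum.cong) (simp_all add: complex_norm_square[symmetric] mult.commute)
  also have "\<dots> = complex_of_real (\<Sum>y | y permutes {..<n}. (cmod (f y))\<^sup>2)"
    unfolding sum_perm_inverse[of "\<lambda>y. complex_of_real ((cmod (f y))\<^sup>2)"] by simp
  finally have "(\<Sum>y | y permutes {..<n}. (cmod (f y))\<^sup>2) = 0"
    using assms(2) by (metis of_real_eq_0_iff)
  then have "f y = 0" if "y permutes {..<n}" for y
    using that by (subst (asm) sum_nonneg_eq_0_iff) auto
  then show ?thesis
    using assms(1) unfolding supp_def by (auto simp: fun_eq_iff)
qed

text \<open>For self-adjoint \<open>h\<close> the square is \<open>conv n (star n h) h\<close>,
  whose value at \<open>id\<close> is the squared norm.\<close>

lemma square_eq_0_imp_eq_0: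
  assumes "supp n h" "\<And>x. x permutes {..<n} \<Longrightarrow> star n h x = h x" "conv n h h = 0"
  shows "h = 0"
proof -
  have "star n h = h"
    using supp_ext[OF supp_star assms(1)] assms(2) by blast
  then show ?thesis
    using star_conv_self_eq_0[OF assms(1)] assms(3) by simp
qed

lemma star_star:
  assumes "x permutes {..<n}" shows "star n (star n f) x = f x"
  using assms by (simp add: star_def permutes_inv_inv permutes_inv)

lemma conv_cong:
  assumes "\<And>x. x permutes {..<n} \<Longrightarrow> f x = f' x"  "\<And>x. x permutes {..<n} \<Longrightarrow> h x = h' x" "x permutes {..<n}"
  shows "conv n f h x = conv n f' h' x"
  unfolding conv_def by (rule sum.cong) (use assms in \<open>auto simp: permutes_compose permutes_inv\<close>)


subsection \<open>Multiplicities of the ideal of a primitive idempotent\<close>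

text \<open>The linear extension of the representation to the group algebra.\<close>

definition act :: "nat \<Rightarrow> 'a operators \<Rightarrow> ((nat \<Rightarrow> nat) \<Rightarrow> complex) \<Rightarrow> ('a \<Rightarrow> complex) \<Rightarrow> 'a \<Rightarrow> complex"
  where "act n rho f w = (\<Sum>y | y permutes {..<n}. cscale (f y) (rho y w))"

locale perm_rep =
  fixes n :: nat and rho :: "'a operators"
  assumes rho_linear: "g permutes {..<n} \<Longrightarrow> Vector_Spaces.linear cscale cscale (rho g)"
    and rho_comp: "g permutes {..<n} \<Longrightarrow> h permutes {..<n} \<Longrightarrow> rho (g \<circ> h) w = rho g (rho h w)"
    and rho_id: "rho id w = w"
begin

lemma rho_add: "g permutes {..<n} \<Longrightarrow> rho g (u + v) = rho g u + rho g v"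
  and rho_scale: "g permutes {..<n} \<Longrightarrow> rho g (cscale c u) = cscale c (rho g u)"
  and rho_sum: "g permutes {..<n} \<Longrightarrow> rho g (\<Sum>i\<in>A. q i) = (\<Sum>i\<in>A. rho g (q i))"
  and rho_zero: "g permutes {..<n} \<Longrightarrow> rho g 0 = 0"
  using rho_linear cpair.linear_add cpair.linear_scale cpair.linear_sum cpair.linear_0 by blast+

lemma act_conv: "act n rho (conv n f h) w = act n rho f (act n rho h w)"
proof -
  let ?S = "{x. x permutes {..<n}}"
  have "act n rho (conv n f h) w = (\<Sum>x\<in>?S. \<Sum>y\<in>?S. cscale (f y * h (inv y \<circ> x)) (rho x w))"
    unfolding act_def conv_def by (simp add: cfun.scale_sum_left)
  also have "\<dots> = (\<Sum>y\<in>?S. \<Sum>x\<in>?S. cscale (f y * h (inv y \<circ> x)) (rho x w))"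
    by (rule sum.swap)
  also have "\<dots> = (\<Sum>y\<in>?S. \<Sum>z\<in>?S. cscale (f y) (cscale (h z) (rho y (rho z w))))"
  proof (rule sum.cong[OF refl])
    fix y assume "y \<in> ?S"
    then have y: "y permutes {..<n}" by simp
    have "(\<Sum>x\<in>?S. cscale (f y * h (inv y \<circ> x)) (rho x w)) =
        (\<Sum>z\<in>?S. cscale (f y * h (inv y \<circ> (y \<circ> z))) (rho (y \<circ> z) w))"
      by (rule sum_perm_compose_left[OF y, symmetric])
    also have "\<dots> = (\<Sum>z\<in>?S. cscale (f y) (cscale (h z) (rho y (rho z w))))"
      by (rule sum.cong) (auto simp: permutes_cancel[OF y] rho_comp[OF y])
    finally show "(\<Sum>x\<in>?S. cscale (f y * h (inv y \<circ> x)) (rho x w)) = \<dots>" .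
  qed
  also have "\<dots> = act n rho f (act n rho h w)"
    unfolding act_def
    by (rule sum.cong) (simp_all add: cfun.scale_sum_right rho_sum rho_scale)
  finally show ?thesis .
qed

lemma act_scale_left: "act n rho (cscale c f) w = cscale c (act n rho f w)"
  unfolding act_def cfun.scale_sum_right by (simp add: cscale_apply)

lemma act_scale_right: "act n rho f (cscale c w) = cscale c (act n rho f w)"
  unfolding act_def cfun.scale_sum_right
  by (rule sum.cong) (simp_all add: rho_scale mult.commute)

lemma act_add_left: "act n rho (f + h) w = act n rho f w + act n rho h w"
  unfolding act_def by (simp add: cfun.scale_left_distrib sum.distrib)

lemma act_sum_right: "act n rho f (\<Sum>i\<in>A. q i) = (\<Sum>i\<in>A. act n rho f (q i))"
  unfolding act_def by (subst sum.swap) (simp add: rho_sum cfun.scale_sum_right)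

lemma act_basis: "g permutes {..<n} \<Longrightarrow> act n rho (basis_elt g) w = rho g w"
  unfolding act_def basis_elt_def
  by (subst sum.cong[OF refl, where h = "\<lambda>y. if y = g then rho y w else 0"]) auto

lemma act_in_subrep: "is_subrep n rho U \<Longrightarrow> u \<in> U \<Longrightarrow> act n rho f u \<in> U"
  unfolding act_def is_subrep_def
  by (intro cfun.subspace_sum cfun.subspace_scale) auto

lemma act_linear_left: "Vector_Spaces.linear cscale cscale (\<lambda>f. act n rho f w)"
  by unfold_locales (simp_all add: act_add_left act_scale_left)

lemma act_commutes_hom:
  fixes phi :: "('b \<Rightarrow> complex) \<Rightarrow> ('a \<Rightarrow> complex)"
  assumes "Vector_Spaces.linear cscale cscale phi"
    and "\<And>g v. g permutes {..<n} \<Longrightarrow> v \<in> V \<Longrightarrow> phi (sigma g v) = rho g (phi v)" and "v \<in> V"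
  shows "phi (act n sigma f v) = act n rho f (phi v)"
  unfolding act_def
  by (simp add: cpair.linear_sum[OF assms(1)] cpair.linear_scale[OF assms(1)] assms(2,3))

end

lemma act_left_mult: "act n left_mult f h = conv n f h"
  by (simp add: act_def conv_eq_sum)

definition left_ideal :: "nat \<Rightarrow> ((nat \<Rightarrow> nat) \<Rightarrow> complex) \<Rightarrow> ((nat \<Rightarrow> nat) \<Rightarrow> complex) set"
  where "left_ideal n e = range (\<lambda>f. conv n f e)"

text \<open>Primitivity takes the form e A e = C e, with A the group algebra. It makes e U at most a
  line for each irreducible U, so that counting copies of A e becomes computing the rank of
  e.\<close>

locale primitive_idempotent =
  fixes n :: nat and e :: "(nat \<Rightarrow> nat) \<Rightarrow> complex"
  assumes supp_e: "supp n e" and idem: "conv n e e = e" and nonzero: "e \<noteq> 0"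
    and primitive: "\<exists>k. conv n e (conv n y e) = cscale k e"
begin

lemma left_ideal_iff: "v \<in> left_ideal n e \<longleftrightarrow> conv n v e = v"
proof
  assume "v \<in> left_ideal n e"
  then obtain f where "v = conv n f e" by (auto simp: left_ideal_def)
  then show "conv n v e = v" by (simp add: conv_assoc idem)
next
  assume "conv n v e = v"
  then show "v \<in> left_ideal n e" unfolding left_ideal_def by (metis rangeI)
qed

lemma e_mem: "e \<in> left_ideal n e"
  by (simp add: left_ideal_iff idem)

lemma conv_mem: "v \<in> left_ideal n e \<Longrightarrow> conv n f v \<in> left_ideal n e"
  by (simp add: left_ideal_iff conv_assoc)

lemma supp_left_ideal: "v \<in> left_ideal n e \<Longrightarrow> supp n v"
  using supp_conv[OF supp_e, of v] by (simp add: left_ideal_iff)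

lemma is_subrep_left_ideal: "is_subrep n left_mult (left_ideal n e)"
  unfolding is_subrep_def
proof (intro conjI allI impI)
  show "cfun.subspace (left_ideal n e)"
    unfolding cfun.subspace_def by (simp add: left_ideal_iff conv_add_left conv_scale_left)
  show "left_mult g v \<in> left_ideal n e" if "g permutes {..<n}" "v \<in> left_ideal n e" for g v
    using conv_mem[OF that(2)] conv_basis_left[OF that(1)] by metis
qed

text \<open>Semiprimeness of the group algebra, by positivity of \<open>star\<close>.\<close>

lemma left_subideal_trivial:
  assumes K: "is_subrep n left_mult K" "K \<subseteq> left_ideal n e" "e \<notin> K" and v: "v \<in> K"
  shows "v = 0"
proof -
  have sub: "cfun.subspace K" using K by (simp add: is_subrep_def)
  have closed: "conv n f u \<in> K" if "u \<in> K" for f u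
    unfolding conv_eq_sum using K(1) that
    by (intro cfun.subspace_sum cfun.subspace_scale) (auto simp: is_subrep_def)
  \<comment> \<open>For u in K one has e u = e u e, a multiple of e; a nonzero multiple would put e
    into K.\<close>
  have kill: "conv n e u = 0" if "u \<in> K" for u
  proof (rule ccontr)
    assume ne: "conv n e u \<noteq> 0"
    have u: "conv n u e = u"
      using K(2) that left_ideal_iff by blast
    obtain k where k: "conv n e (conv n u e) = cscale k e"
      using primitive by blast
    then have "cscale k e \<in> K" "k \<noteq> 0"
      using closed[OF that, of e] u ne by auto
    then have "cscale (inverse k) (cscale k e) \<in> K"
      using sub cfun.subspace_scale by blast
    with \<open>k \<noteq> 0\<close> K(3) show False by simp
  qed
  have sv: "supp n v"
    using supp_left_ideal v K(2) by blast
  \<comment> \<open>h lies in K and satisfies h = h e, so h h = h (e h) = 0 by \<open>kill\<close>;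
    being self-adjoint, h vanishes, and h has the squared norm of v at \<open>id\<close>.\<close>
  define h where "h = conv n (star n v) v"
  have h: "h \<in> K" using closed[OF v] by (simp add: h_def)
  have "conv n h h = conv n (conv n h e) h"
    using h K(2) left_ideal_iff by force
  also have "\<dots> = 0" by (simp add: conv_assoc kill[OF h])
  finally have hh: "conv n h h = 0" .
  have "star n h x = h x" if "x permutes {..<n}" for x
    unfolding h_def star_conv[OF that]
    by (rule conv_cong) (use that star_star in auto)
  then have "h = 0"
    using square_eq_0_imp_eq_0[OF _ _ hh] supp_conv[OF sv] by (auto simp: h_def)
  then have "conv n (star n v) v id = 0"
    by (simp add: h_def)
  then show "v = 0"
    using star_conv_self_eq_0[OF sv] by blast
qed

end

locale ideal_in_rep = primitive_idempotent n e + perm_rep n rho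
  for n e and rho :: "'a operators"
begin

text \<open>Under an isomorphism e U corresponds to e A e = C e, so the image of e itself spans
  it.\<close>

lemma isomorphic_imp_line:
  assumes "isomorphic_reps n left_mult (left_ideal n e) rho U"
  obtains b where "b \<in> U" "b \<noteq> 0" "act n rho e b = b" "\<And>u. u \<in> U \<Longrightarrow> \<exists>k. act n rho e u = cscale k b"
proof -
  obtain phi where phi: "Vector_Spaces.linear cscale cscale phi" "bij_betw phi (left_ideal n e) U"
    "\<And>g v. g permutes {..<n} \<Longrightarrow> v \<in> left_ideal n e \<Longrightarrow> phi (left_mult g v) = rho g (phi v)"
    using assms unfolding isomorphic_reps_def by blast
  have comm: "phi (conv n f v) = act n rho f (phi v)" if "v \<in> left_ideal n e" for f v
    using act_commutes_hom[OF phi(1), of "left_ideal n e" left_mult] phi(3) that by (simp add: act_left_mult)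
  have "0 \<in> left_ideal n e" by (simp add: left_ideal_iff)
  then have "phi e \<noteq> 0"
    using phi(2) e_mem nonzero cpair.linear_0[OF phi(1)] unfolding bij_betw_def inj_on_def by metis
  moreover have "phi e \<in> U"
    using phi(2) e_mem by (auto simp: bij_betw_def)
  moreover have "act n rho e (phi e) = phi e"
    using comm[OF e_mem, of e] idem by simp
  moreover have "\<exists>k. act n rho e u = cscale k (phi e)" if uU: "u \<in> U" for u
  proof -
    obtain v where v: "v \<in> left_ideal n e" "u = phi v"
      using phi(2) uU by (auto simp: bij_betw_def)
    obtain k where "conv n e (conv n v e) = cscale k e"
      using primitive by blast
    then have "conv n e v = cscale k e"
      using v(1) left_ideal_iff by simp
    then show ?thesis
      using comm[OF v(1), of e] v(2) cpair.linear_scale[OF phi(1)] by metis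
  qed
  ultimately show thesis using that by blast
qed

text \<open>The isomorphism is v \<mapsto> v u0 with u0 = e u. It is onto because its image is a
  nonzero subrepresentation of the irreducible U, and injective because its kernel is a subideal
  that misses e and hence is zero by \<open>left_subideal_trivial\<close>.\<close>

lemma isomorphic_if_act_nonzero:
  assumes U: "irreducible_subrep n rho U" and u: "u \<in> U" "act n rho e u \<noteq> 0"
  shows "isomorphic_reps n left_mult (left_ideal n e) rho U"
proof -
  define u0 where "u0 = act n rho e u"
  define phi where "phi v = act n rho v u0" for v
  have subU: "is_subrep n rho U" using U by (simp add: irreducible_subrep_def)
  have u0: "u0 \<in> U" "u0 \<noteq> 0"
    using act_in_subrep[OF subU u(1)] u(2) by (auto simp: u0_def)
  have lin: "Vector_Spaces.linear cscale cscale phi"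
    unfolding phi_def by (rule act_linear_left)
  have phie: "phi e = u0"
    unfolding phi_def u0_def act_conv[symmetric] idem ..
  have comm: "phi (left_mult g v) = rho g (phi v)" if "g permutes {..<n}" for g v
    using that unfolding phi_def by (metis act_basis act_conv conv_basis_left)
  let ?V = "left_ideal n e"
  have subV: "is_subrep n left_mult ?V" by (rule is_subrep_left_ideal)
  have img: "is_subrep n rho (phi ` ?V)"
    unfolding is_subrep_def
  proof (intro conjI allI impI)
    show "cfun.subspace (phi ` ?V)"
      using cpair.linear_subspace_image[OF lin] subV by (simp add: is_subrep_def)
    fix g v assume g: "g permutes {..<n}" and "v \<in> phi ` ?V"
    then obtain w where w: "w \<in> ?V" "v = phi w" by blast
    have "left_mult g w \<in> ?V"
      using subV w g by (simp add: is_subrep_def)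
    then show "rho g v \<in> phi ` ?V"
      using comm[OF g, of w] w by (metis imageI)
  qed
  moreover have "phi ` ?V \<subseteq> U"
    unfolding phi_def using act_in_subrep[OF subU u0(1)] by blast
  moreover have "phi ` ?V \<noteq> {0}"
    using phie u0(2) e_mem by blast
  ultimately have surj: "phi ` ?V = U"
    using U unfolding irreducible_subrep_def by blast
  define K where "K = {v \<in> ?V. phi v = 0}"
  have subK: "is_subrep n left_mult K"
    using subV unfolding is_subrep_def K_def cfun.subspace_def
    by (auto simp: cpair.linear_0[OF lin] cpair.linear_add[OF lin] cpair.linear_scale[OF lin] comm rho_zero)
  have K0: "v = 0" if "v \<in> K" for v
    by (rule left_subideal_trivial[OF subK _ _ that]) (use phie u0 in \<open>auto simp: K_def\<close>)
  have "inj_on phi ?V"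
  proof (rule inj_onI)
    fix v w assume vw: "v \<in> ?V" "w \<in> ?V" "phi v = phi w"
    have "v - w \<in> K"
      using cfun.subspace_diff[of ?V v w] subV vw cpair.linear_diff[OF lin]
      by (simp add: K_def is_subrep_def)
    then show "v = w" using K0 by fastforce
  qed
  then show ?thesis
    unfolding isomorphic_reps_def using lin surj comm by (auto simp: bij_betw_def)
qed

text \<open>The lines \<open>e U\<^sub>i\<close>, for the summands \<open>U\<^sub>i\<close> isomorphic to the ideal, form a basis of \<open>e W\<close>.\<close>

lemma basis_of_image:
  assumes dec: "irreducible_decomposition n rho W k U"
  obtains B where "finite B" "cfun.independent B"
    "card B = card {i. i < k \<and> isomorphic_reps n left_mult (left_ideal n e) rho (U i)}"
    "\<And>w. w \<in> W \<Longrightarrow> act n rho e w \<in> cfun.span B"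
    "\<And>b. b \<in> B \<Longrightarrow> b \<in> W \<and> act n rho e b = b"
proof -
  let ?I = "{i. i < k \<and> isomorphic_reps n left_mult (left_ideal n e) rho (U i)}"
  have irr: "irreducible_subrep n rho (U i)" if "i < k" for i
    using dec that by (simp add: irreducible_decomposition_def)
  then have sub: "cfun.subspace (U i)" if "i < k" for i
    using that by (simp add: irreducible_subrep_def is_subrep_def)
  have bij: "bij_betw (\<lambda>u. \<Sum>i<k. u i) (\<Pi>\<^sub>E i\<in>{..<k}. U i) W"
    using dec by (simp add: irreducible_decomposition_def)
  have "\<forall>i\<in>?I. \<exists>b. b \<in> U i \<and> b \<noteq> 0 \<and> act n rho e b = b \<and> (\<forall>u\<in>U i. \<exists>k. act n rho e u = cscale k b)"
  proof
    fix i assume "i \<in> ?I"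
    then have "isomorphic_reps n left_mult (left_ideal n e) rho (U i)" by simp
    then show "\<exists>b. b \<in> U i \<and> b \<noteq> 0 \<and> act n rho e b = b \<and> (\<forall>u\<in>U i. \<exists>k. act n rho e u = cscale k b)"
      by (rule isomorphic_imp_line) blast
  qed
  from bchoice[OF this] obtain b where b: "\<forall>i\<in>?I. b i \<in> U i \<and> b i \<noteq> 0 \<and> act n rho e (b i) = b i \<and>
      (\<forall>u\<in>U i. \<exists>k. act n rho e u = cscale k (b i))" ..
  have ind: "c i = 0" if c: "(\<Sum>i\<in>?I. cscale (c i) (b i)) = 0" and i: "i \<in> ?I" for c i
  proof -
    define u where "u = (\<lambda>i\<in>{..<k}. if i \<in> ?I then cscale (c i) (b i) else 0)"
    define z :: "nat \<Rightarrow> 'a \<Rightarrow> complex" where "z = (\<lambda>i\<in>{..<k}. 0)"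
    have "u \<in> (\<Pi>\<^sub>E i\<in>{..<k}. U i)" "z \<in> (\<Pi>\<^sub>E i\<in>{..<k}. U i)"
      using sub b by (auto simp: u_def z_def cfun.subspace_scale cfun.subspace_0)
    moreover have "(\<Sum>i<k. u i) = (\<Sum>i\<in>?I. cscale (c i) (b i))"
      by (rule sum.mono_neutral_cong_right) (auto simp: u_def)
    moreover have "(\<Sum>i<k. z i) = 0" by (simp add: z_def)
    ultimately have "u = z"
      using bij_betw_imp_inj_on[OF bij, THEN inj_onD, of u z] c by simp
    then have "u i = z i" by simp
    then show "c i = 0"
      using i b by (simp add: u_def z_def)
  qed
  have inj: "inj_on b ?I"
  proof (rule inj_onI, rule ccontr)
    fix i j assume ij: "i \<in> ?I" "j \<in> ?I" "b i = b j" "i \<noteq> j"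
    define c :: "nat \<Rightarrow> complex" where "c l = (if l = i then 1 else if l = j then -1 else 0)" for l
    have "(\<Sum>l\<in>?I. cscale (c l) (b l)) = (\<Sum>l\<in>{i,j}. cscale (c l) (b l))"
      by (rule sum.mono_neutral_right) (use ij in \<open>auto simp: c_def\<close>)
    also have "\<dots> = 0" using ij by (simp add: c_def)
    finally show False using ind[of c i] ij by (simp add: c_def)
  qed
  show thesis
  proof
    show "finite (b ` ?I)" by simp
    show "card (b ` ?I) = card ?I" using inj by (rule card_image)
    show "cfun.independent (b ` ?I)"
    proof (rule cfun.independent_if_scalars_zero)
      fix f x assume f: "(\<Sum>x\<in>b ` ?I. cscale (f x) x) = 0" and "x \<in> b ` ?I"
      then obtain i where i: "i \<in> ?I" "x = b i" by blast
      from f have "(\<Sum>i\<in>?I. cscale (f (b i)) (b i)) = 0"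
        by (simp add: sum.reindex[OF inj])
      then show "f x = 0" using ind[of "\<lambda>i. f (b i)" i] i by simp
    qed simp
    show "v \<in> W \<and> act n rho e v = v" if vb: "v \<in> b ` ?I" for v
    proof -
      obtain i where i: "i \<in> ?I" "v = b i" using vb by blast
      define u where "u = (\<lambda>j\<in>{..<k}. if j = i then b i else 0)"
      have "u \<in> (\<Pi>\<^sub>E i\<in>{..<k}. U i)"
        using sub b i by (auto simp: u_def cfun.subspace_0)
      then have "(\<Sum>j<k. u j) \<in> W"
        using bij_betwE[OF bij] by blast
      moreover have "(\<Sum>j<k. u j) = b i"
        using i by (simp add: u_def sum.delta)
      ultimately have "b i \<in> W" by simp
      then show ?thesis using b i by auto
    qed
    show "act n rho e w \<in> cfun.span (b ` ?I)" if wW: "w \<in> W" for w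
    proof -
      obtain u where u: "u \<in> (\<Pi>\<^sub>E i\<in>{..<k}. U i)" "w = (\<Sum>i<k. u i)"
        using bij wW unfolding bij_betw_def by blast
      have "act n rho e (u i) \<in> cfun.span (b ` ?I)" if ik: "i < k" for i
      proof (cases "i \<in> ?I")
        case True
        moreover have "u i \<in> U i" using u(1) ik by (simp add: PiE_mem)
        ultimately obtain c where "act n rho e (u i) = cscale c (b i)"
          using b by blast
        then show ?thesis
          using True by (auto intro: cfun.span_scale cfun.span_base)
      next
        case False
        then have "act n rho e (u i) = 0"
          using isomorphic_if_act_nonzero[OF irr[OF ik], of "u i"] u(1) ik by (auto simp: PiE_mem)
        then show ?thesis by (simp add: cfun.span_zero)
      qed
      then show ?thesis
        unfolding u(2) act_sum_right by (intro cfun.span_sum) auto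
    qed
  qed
qed

end

text \<open>\<open>K z\<close> is the column \<open>z\<close> of an idempotent matrix whose image has the basis \<open>B\<close>.\<close>

lemma card_basis_eq_trace:
  fixes K :: "'a \<Rightarrow> 'a \<Rightarrow> complex"
  assumes X: "finite X" and B: "finite B" "cfun.independent B"
    and K: "\<And>z. z \<in> X \<Longrightarrow> K z \<in> cfun.span B"
    and fix_B: "\<And>b. b \<in> B \<Longrightarrow> (\<Sum>z\<in>X. cscale (b z) (K z)) = b"
  shows "of_nat (card B) = (\<Sum>z\<in>X. K z z)"
proof -
  define r where "r z = cfun.representation B (K z)" for z
  have Kz: "K z = (\<Sum>b\<in>B. cscale (r z b) b)" if "z \<in> X" for z
    unfolding r_def using cfun.sum_representation_eq[OF B(2) K[OF that] B(1)] by simp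
  \<comment> \<open>Expand b through the columns \<open>K z\<close>, express these in the basis, and
    compare the coefficients of b.\<close>
  have one: "(\<Sum>z\<in>X. b z * r z b) = 1" if b: "b \<in> B" for b
  proof -
    have "(\<Sum>c\<in>B. cscale ((\<Sum>z\<in>X. b z * r z c) - (if c = b then 1 else 0)) c) = 0"
    proof -
      have "b = (\<Sum>z\<in>X. \<Sum>c\<in>B. cscale (b z * r z c) c)"
        using fix_B[OF b] by (simp add: Kz cfun.scale_sum_right)
      also have "\<dots> = (\<Sum>c\<in>B. cscale (\<Sum>z\<in>X. b z * r z c) c)"
        by (subst sum.swap) (simp add: cfun.scale_sum_left)
      moreover have "(\<Sum>c\<in>B. cscale (if c = b then 1 else 0) c) = b"
        by (subst sum.cong[OF refl, where h = "\<lambda>c. if c = b then c else 0"]) (use b B in auto)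
      ultimately show ?thesis
        by (simp add: cfun.scale_left_diff_distrib sum_subtractf)
    qed
    then show ?thesis
      using cfun.independentD[OF B(2) B(1) order_refl, of "\<lambda>c. (\<Sum>z\<in>X. b z * r z c) - (if c = b then 1 else 0)" b] b by simp
  qed
  have "(\<Sum>z\<in>X. K z z) = (\<Sum>z\<in>X. \<Sum>b\<in>B. r z b * b z)"
    by (rule sum.cong) (simp_all add: Kz sum_fun_apply cscale_apply)
  also have "\<dots> = (\<Sum>b\<in>B. \<Sum>z\<in>X. b z * r z b)"
    by (subst sum.swap) (simp add: mult.commute)
  also have "\<dots> = of_nat (card B)" by (simp add: one)
  finally show ?thesis by simp
qed


subsection \<open>Complete reducibility\<close>

text \<open>The ambient function space may have infinite dimension; the finite spanning set F is
  what makes \<open>cfun.dim\<close> meaningful and comparable here.\<close>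

lemma dim_less_if_psubset:
  fixes W V :: "('a \<Rightarrow> complex) set"
  assumes fin: "finite F" "W \<subseteq> cfun.span F" and V: "cfun.subspace V" "V \<subset> W"
  shows "cfun.dim V < cfun.dim W"
proof -
  obtain B where B: "B \<subseteq> V" "cfun.independent B" "V \<subseteq> cfun.span B" "card B = cfun.dim V"
    using cfun.basis_exists by blast
  obtain C where C: "C \<subseteq> W" "cfun.independent C" "W \<subseteq> cfun.span C" "card C = cfun.dim W"
    using cfun.basis_exists by blast
  have finC: "finite C"
    using cfun.independent_span_bound[OF fin(1) C(2)] C(1) fin(2) by blast
  obtain u where u: "u \<in> W" "u \<notin> V" using V by blast
  have "cfun.span B \<subseteq> V" using B(1) V(1) by (rule cfun.span_minimal)
  then have indep: "cfun.independent (insert u B)" and "u \<notin> B"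
    using u(2) B(1,2) by (auto simp: cfun.independent_insert)
  have "insert u B \<subseteq> cfun.span C" using u B(1) V(2) C(3) by blast
  then have "finite (insert u B)" "card (insert u B) \<le> card C"
    using cfun.independent_span_bound[OF finC indep] by simp_all
  with \<open>u \<notin> B\<close> B(4) C(4) show ?thesis by simp
qed

context perm_rep
begin

text \<open>Maschke's argument: average a linear projection p onto U over the group and take the
  kernel. The sum q is left undivided, so it acts on U as multiplication by n!, and the component of
  w in U is q w / n!.\<close>

lemma invariant_complement:
  assumes W: "is_subrep n rho W" and U: "is_subrep n rho U" "U \<subseteq> W"
  obtains V where "is_subrep n rho V" "V \<subseteq> W" "U \<inter> V \<subseteq> {0}"
    "\<And>w. w \<in> W \<Longrightarrow> \<exists>u\<in>U. \<exists>v\<in>V. w = u + v"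
proof -
  have subU: "cfun.subspace U" and subW: "cfun.subspace W"
    using U W by (auto simp: is_subrep_def)
  have "Vector_Spaces.linear cscale cscale (id :: ('a \<Rightarrow> complex) \<Rightarrow> _)"
    by (simp add: cfun.linear_id)
  then obtain p where p: "p ` UNIV \<subseteq> U" "Vector_Spaces.linear cscale cscale p" "\<And>u. u \<in> U \<Longrightarrow> p u = u"
    using cpair.linear_exists_left_inverse_on[OF _ subU, of id] by auto
  let ?S = "{g. g permutes {..<n}}"
  define q where "q w = (\<Sum>g\<in>?S. rho g (p (rho (inv g) w)))" for w
  have lin: "q (u + v) = q u + q v" "q (cscale c u) = cscale c (q u)" for u v c
    unfolding q_def by (simp_all add: permutes_inv rho_add rho_scale cpair.linear_add[OF p(2)]
        cpair.linear_scale[OF p(2)] sum.distrib cfun.scale_sum_right)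
  have q0: "q 0 = 0" using lin(2)[of 0 0] by simp
  have q_mem: "q w \<in> U" for w
    unfolding q_def
  proof (rule cfun.subspace_sum[OF subU])
    fix g assume "g \<in> ?S"
    moreover have "p (rho (inv g) w) \<in> U" using p(1) by blast
    ultimately show "rho g (p (rho (inv g) w)) \<in> U" using U(1) by (simp add: is_subrep_def)
  qed
  have q_U: "q u = cscale (fact n) u" if "u \<in> U" for u
  proof -
    have "rho g (p (rho (inv g) u)) = u" if g: "g permutes {..<n}" for g
    proof -
      have "rho (inv g) u \<in> U"
        using U(1) \<open>u \<in> U\<close> permutes_inv[OF g] by (simp add: is_subrep_def)
      then show ?thesis
        using rho_comp[OF g permutes_inv[OF g], of u] by (simp add: p(3) permutes_cancel[OF g] rho_id)
    qed
    then have "q u = (\<Sum>g\<in>?S. u)" unfolding q_def by simp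
    also have "\<dots> = cscale (of_nat (card ?S)) u"
      by (simp add: fun_eq_iff sum_fun_apply cscale_apply)
    finally show ?thesis using card_permutations[of "{..<n}" n] by simp
  qed
  have q_rho: "q (rho h w) = rho h (q w)" if h: "h permutes {..<n}" for h w
  proof -
    have "q (rho h w) = (\<Sum>g\<in>?S. rho (h \<circ> g) (p (rho (inv (h \<circ> g)) (rho h w))))"
      unfolding q_def by (rule sum_perm_compose_left[OF h, symmetric])
    also have "\<dots> = (\<Sum>g\<in>?S. rho h (rho g (p (rho (inv g) w))))"
    proof (rule sum.cong[OF refl])
      fix g assume "g \<in> ?S"
      then have g: "g permutes {..<n}" by simp
      have "rho (inv (h \<circ> g)) (rho h w) = rho (inv g) w"
        using rho_comp[OF permutes_inv[OF permutes_compose[OF g h]] h, of w]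
        by (simp add: permutes_inv_comp[OF h g] permutes_cancel[OF h])
      then show "rho (h \<circ> g) (p (rho (inv (h \<circ> g)) (rho h w))) = rho h (rho g (p (rho (inv g) w)))"
        by (simp add: rho_comp[OF h g])
    qed
    also have "\<dots> = rho h (q w)" unfolding q_def by (simp add: rho_sum[OF h])
    finally show ?thesis .
  qed
  show thesis
  proof
    show "is_subrep n rho {w \<in> W. q w = 0}"
      unfolding is_subrep_def cfun.subspace_def
      using W subW by (auto simp: is_subrep_def lin q_rho rho_zero q0 cfun.subspace_0 cfun.subspace_add cfun.subspace_scale)
    show "{w \<in> W. q w = 0} \<subseteq> W" by blast
    show "U \<inter> {w \<in> W. q w = 0} \<subseteq> {0}"
      using q_U by auto
    fix w assume w: "w \<in> W"
    define u where "u = cscale (1 / fact n) (q w)"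
    have u: "u \<in> U" using q_mem subU by (simp add: u_def cfun.subspace_scale)
    moreover have "q (w + cscale (-1) u) = 0"
      by (simp only: lin q_U[OF u]) (simp add: u_def)
    moreover have "w + cscale (-1) u \<in> W"
      using u U(2) w subW by (intro cfun.subspace_add cfun.subspace_scale) auto
    moreover have "w = u + (w + cscale (-1) u)" by simp
    ultimately show "\<exists>u\<in>U. \<exists>v\<in>{w \<in> W. q w = 0}. w = u + v" by blast
  qed
qed

lemma irreducible_decomposition_extend:
  assumes dec: "irreducible_decomposition n rho V k U" and irr: "irreducible_subrep n rho Y"
    and W: "cfun.subspace W" "Y \<subseteq> W" "V \<subseteq> W" and V: "cfun.subspace V" and disj: "Y \<inter> V \<subseteq> {0}"
    and sum: "\<And>w. w \<in> W \<Longrightarrow> \<exists>u\<in>Y. \<exists>v\<in>V. w = u + v"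
  shows "irreducible_decomposition n rho W (Suc k) (U(k := Y))"
  unfolding irreducible_decomposition_def
proof (intro conjI allI impI)
  show "irreducible_subrep n rho ((U(k := Y)) i)" if "i < Suc k" for i
    using that dec irr by (auto simp: irreducible_decomposition_def less_Suc_eq)
  have bij: "bij_betw (\<lambda>u. \<Sum>i<k. u i) (\<Pi>\<^sub>E i\<in>{..<k}. U i) V"
    using dec by (simp add: irreducible_decomposition_def)
  have subY: "cfun.subspace Y" using irr by (simp add: irreducible_subrep_def is_subrep_def)
  have restr: "restrict u {..<k} \<in> (\<Pi>\<^sub>E i\<in>{..<k}. U i)" "u k \<in> Y"
    if "u \<in> (\<Pi>\<^sub>E i\<in>{..<Suc k}. (U(k := Y)) i)" for u
    using that by (auto simp: PiE_iff split: if_splits)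
  have Vsum: "(\<Sum>i<k. u i) \<in> V" if "u \<in> (\<Pi>\<^sub>E i\<in>{..<Suc k}. (U(k := Y)) i)" for u
  proof -
    have "(\<Sum>i<k. restrict u {..<k} i) \<in> V"
      using bij restr(1)[OF that] unfolding bij_betw_def by blast
    then show ?thesis by simp
  qed
  show "bij_betw (\<lambda>u. \<Sum>i<Suc k. u i) (\<Pi>\<^sub>E i\<in>{..<Suc k}. (U(k := Y)) i) W"
    unfolding bij_betw_def
  proof (intro conjI inj_onI)
    fix u v
    assume u: "u \<in> (\<Pi>\<^sub>E i\<in>{..<Suc k}. (U(k := Y)) i)" and v: "v \<in> (\<Pi>\<^sub>E i\<in>{..<Suc k}. (U(k := Y)) i)"
      and "(\<Sum>i<Suc k. u i) = (\<Sum>i<Suc k. v i)"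
    then have eq: "(\<Sum>i<k. u i) + u k = (\<Sum>i<k. v i) + v k" by simp
    have "v k - u k = (\<Sum>i<k. u i) - (\<Sum>i<k. v i)"
      using eq by (simp add: algebra_simps)
    then have "v k - u k \<in> Y \<inter> V"
      using cfun.subspace_diff[OF subY restr(2)[OF v] restr(2)[OF u]]
        cfun.subspace_diff[OF V Vsum[OF u] Vsum[OF v]] by simp
    then have *: "v k = u k" using disj by auto
    then have "(\<Sum>i<k. restrict u {..<k} i) = (\<Sum>i<k. restrict v {..<k} i)" using eq by simp
    then have "restrict u {..<k} = restrict v {..<k}"
      using bij restr(1)[OF u] restr(1)[OF v] unfolding bij_betw_def inj_on_def by blast
    then have "u i = v i" if "i < k" for i
      using that by (metis lessThan_iff restrict_apply')
    then show "u = v"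
      by (intro PiE_ext[OF u v]) (use * in \<open>auto simp: less_Suc_eq\<close>)
  next
    show "(\<lambda>u. \<Sum>i<Suc k. u i) ` (\<Pi>\<^sub>E i\<in>{..<Suc k}. (U(k := Y)) i) = W"
    proof (intro subset_antisym subsetI)
      fix w assume "w \<in> (\<lambda>u. \<Sum>i<Suc k. u i) ` (\<Pi>\<^sub>E i\<in>{..<Suc k}. (U(k := Y)) i)"
      then obtain u where u: "u \<in> (\<Pi>\<^sub>E i\<in>{..<Suc k}. (U(k := Y)) i)" "w = (\<Sum>i<k. u i) + u k" by auto
      then show "w \<in> W"
        using Vsum[OF u(1)] restr(2)[OF u(1)] W by (auto intro: cfun.subspace_add)
    next
      fix w assume "w \<in> W"
      then obtain y v where yv: "y \<in> Y" "v \<in> V" "w = y + v" using sum by blast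
      obtain u where u: "u \<in> (\<Pi>\<^sub>E i\<in>{..<k}. U i)" "v = (\<Sum>i<k. u i)"
        using bij yv(2) unfolding bij_betw_def by blast
      have "u(k := y) \<in> (\<Pi>\<^sub>E i\<in>{..<Suc k}. (U(k := Y)) i)"
        using u(1) yv(1) by (auto simp: PiE_iff extensional_def)
      moreover have "(\<Sum>i<Suc k. (u(k := y)) i) = w"
        using u(2) yv(3) by (simp add: add.commute)
      ultimately show "w \<in> (\<lambda>u. \<Sum>i<Suc k. u i) ` (\<Pi>\<^sub>E i\<in>{..<Suc k}. (U(k := Y)) i)" by blast
    qed
  qed
qed

lemma irreducible_decomposition_exists:
  assumes X: "finite F" and "is_subrep n rho W" "W \<subseteq> cfun.span F"
  shows "\<exists>k U. irreducible_decomposition n rho W k U"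
  using assms(2,3)
proof (induction "cfun.dim W" arbitrary: W rule: less_induct)
  case less
  have subW: "cfun.subspace W" using less.prems by (simp add: is_subrep_def)
  show ?case
  proof (cases "W = {0}")
    case True
    have "irreducible_decomposition n rho W 0 (\<lambda>_. {})"
      by (simp add: irreducible_decomposition_def True bij_betw_def)
    then show ?thesis by blast
  next
    case False
    define P where "P Y \<longleftrightarrow> is_subrep n rho Y \<and> Y \<subseteq> W \<and> Y \<noteq> {0}" for Y
    \<comment> \<open>A nonzero subrepresentation of least dimension is irreducible.\<close>
    define Y where "Y = arg_min cfun.dim P"
    have "P W" using less.prems False by (simp add: P_def)
    then have PY: "P Y" and minY: "\<And>Z. P Z \<Longrightarrow> cfun.dim Y \<le> cfun.dim Z"
      unfolding Y_def using arg_min_nat_lemma[of P W cfun.dim] by auto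
    have Y: "is_subrep n rho Y" "Y \<subseteq> W" "Y \<noteq> {0}" using PY by (auto simp: P_def)
    have irr: "irreducible_subrep n rho Y"
      unfolding irreducible_subrep_def
    proof (intro conjI Y allI impI)
      fix Z assume Z: "Z \<subseteq> Y" "is_subrep n rho Z"
      show "Z = {0} \<or> Z = Y"
      proof (rule ccontr)
        assume "\<not> (Z = {0} \<or> Z = Y)"
        then have "P Z" "Z \<subset> Y" using Z Y by (auto simp: P_def)
        then have "cfun.dim Z < cfun.dim Y"
          using dim_less_if_psubset[OF X, of Y Z] Z Y less.prems(2) by (auto simp: is_subrep_def)
        with minY[OF \<open>P Z\<close>] show False by simp
      qed
    qed
    obtain V where V: "is_subrep n rho V" "V \<subseteq> W" "Y \<inter> V \<subseteq> {0}"
      "\<And>w. w \<in> W \<Longrightarrow> \<exists>u\<in>Y. \<exists>v\<in>V. w = u + v"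
      using invariant_complement[OF less.prems(1) Y(1,2)] by blast
    have subV: "cfun.subspace V" using V(1) by (simp add: is_subrep_def)
    have "0 \<in> Y" using Y(1) cfun.subspace_0 by (auto simp: is_subrep_def)
    then obtain y where "y \<in> Y" "y \<noteq> 0" using Y(3) by blast
    then have "V \<subset> W" using V(2,3) Y(2) by blast
    then have "cfun.dim V < cfun.dim W"
      using dim_less_if_psubset[OF X less.prems(2) subV] by blast
    then obtain k U where "irreducible_decomposition n rho V k U"
      using less.hyps[OF _ V(1)] V(2) less.prems(2) by blast
    then have "irreducible_decomposition n rho W (Suc k) (U(k := Y))"
      by (rule irreducible_decomposition_extend[OF _ irr subW Y(2) V(2) subV V(3,4)])
    then show ?thesis by blast
  qed
qed

end


subsection \<open>Kronecker coefficients as character sums\<close>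

text \<open>For an idempotent e this is the trace of \<open>inv g\<close> on the left ideal of e:
  the coefficient at x of the product of \<open>inv g\<close>, x and e is
  \<open>e (inv x \<circ> g \<circ> x)\<close>. The passage to the inverse is harmless for the
  characters of the symmetric group by \<open>irr_char_inv\<close>.\<close>

definition character :: "nat \<Rightarrow> ((nat \<Rightarrow> nat) \<Rightarrow> complex) \<Rightarrow> (nat \<Rightarrow> nat) \<Rightarrow> complex" where
  "character n e g = (\<Sum>x | x permutes {..<n}. e (inv x \<circ> g \<circ> x))"

lemma character_conj:
  assumes y: "y permutes {..<n}"
  shows "character n e (inv y \<circ> g \<circ> y) = character n e g"
proof -
  have "character n e (inv y \<circ> g \<circ> y) = (\<Sum>x | x permutes {..<n}. e (inv (y \<circ> x) \<circ> g \<circ> (y \<circ> x)))"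
    unfolding character_def
    by (rule sum.cong) (auto simp: permutes_inv_comp[OF y] o_assoc)
  also have "\<dots> = character n e g"
    unfolding character_def by (rule sum_perm_compose_left[OF y])
  finally show ?thesis .
qed

lemma sum_perm_conj:
  assumes y: "y permutes {..<n}"
  shows "(\<Sum>g | g permutes {..<n}. F (inv y \<circ> g \<circ> y)) = (\<Sum>g | g permutes {..<n::nat}. F g)"
proof -
  have "(\<Sum>g | g permutes {..<n}. F (inv y \<circ> g \<circ> y)) = (\<Sum>g | g permutes {..<n}. F (inv y \<circ> g))"
    by (rule sum_perm_compose_right[OF y, of "\<lambda>g. F (inv y \<circ> g)", unfolded o_assoc])
  also have "\<dots> = (\<Sum>g | g permutes {..<n}. F g)"
    by (rule sum_perm_compose_left[OF permutes_inv[OF y]])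
  finally show ?thesis .
qed

text \<open>A class function does not see the averaging over conjugates. This is the bridge between
  sums over the idempotent and sums over its character.\<close>

lemma sum_character_class_function:
  assumes F: "\<And>y g. y permutes {..<n} \<Longrightarrow> g permutes {..<n} \<Longrightarrow> F (inv y \<circ> g \<circ> y) = F g"
  shows "(\<Sum>g | g permutes {..<n}. character n e g * F g) = fact n * (\<Sum>g | g permutes {..<n}. e g * F g)"
proof -
  let ?S = "{g. g permutes {..<n}}"
  have "(\<Sum>g\<in>?S. character n e g * F g) = (\<Sum>x\<in>?S. \<Sum>g\<in>?S. e (inv x \<circ> g \<circ> x) * F g)"
    unfolding character_def sum_distrib_right by (rule sum.swap)
  also have "\<dots> = (\<Sum>x\<in>?S. \<Sum>g\<in>?S. e (inv x \<circ> g \<circ> x) * F (inv x \<circ> g \<circ> x))"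
    by (intro sum.cong refl) (simp add: F)
  also have "\<dots> = (\<Sum>x\<in>?S. \<Sum>g\<in>?S. e g * F g)"
    by (rule sum.cong[OF refl]) (simp add: sum_perm_conj[of _ n "\<lambda>g. e g * F g"])
  also have "\<dots> = fact n * (\<Sum>g\<in>?S. e g * F g)"
    using card_permutations[of "{..<n}" n] by simp
  finally show ?thesis .
qed

definition tensor :: "('a \<Rightarrow> complex) \<Rightarrow> ('b \<Rightarrow> complex) \<Rightarrow> 'a \<times> 'b \<Rightarrow> complex"
  where "tensor u v = (\<lambda>(x, y). u x * v y)"

lemma tensor_space_eq: "tensor_space V W = cfun.span {tensor v w | v w. v \<in> V \<and> w \<in> W}"
  by (simp add: tensor_space_def tensor_def)

lemma perm_rep_diag: "perm_rep n diag_left_mult"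
proof
  fix g h :: "nat \<Rightarrow> nat" and w :: "(nat \<Rightarrow> nat) \<times> (nat \<Rightarrow> nat) \<Rightarrow> complex"
  assume gh: "g permutes {..<n}" "h permutes {..<n}"
  show "diag_left_mult (g \<circ> h) w = diag_left_mult g (diag_left_mult h w)"
    by (simp add: fun_eq_iff diag_left_mult_def permutes_inv_comp[OF gh] o_assoc)
next
  show "diag_left_mult id w = w" for w
    by (simp add: diag_left_mult_def)
qed (auto simp: diag_left_mult_def cscale_def fun_eq_iff)

lemma act_diag_tensor:
  "act n diag_left_mult f (tensor u v) z =
    (\<Sum>g | g permutes {..<n}. f g * u (inv g \<circ> fst z) * v (inv g \<circ> snd z))"
  by (simp add: act_def sum_fun_apply cscale_apply diag_left_mult_def tensor_def split_beta mult.assoc)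

context
  fixes n :: nat and e1 e2 :: "(nat \<Rightarrow> nat) \<Rightarrow> complex"
  assumes e1: "supp n e1" "conv n e1 e1 = e1" and e2: "supp n e2" "conv n e2 e2 = e2"
begin

text \<open>Right multiplication by \<open>e1\<close> and \<open>e2\<close> fixes the tensor
  product. The translates of the tensor of \<open>e1\<close> and \<open>e2\<close> thus act as
  columns of a projection onto it, which is the form that \<open>card_basis_eq_trace\<close> asks
  for.\<close>

lemma tensor_space_fixed:
  assumes w: "w \<in> tensor_space (left_ideal n e1) (left_ideal n e2)"
  shows "w = (\<Sum>x | x permutes {..<n}. \<Sum>y | y permutes {..<n}.
    cscale (w (x, y)) (tensor (left_mult x e1) (left_mult y e2)))"
  using w unfolding tensor_space_eq
proof (induction rule: cfun.span_induct_alt)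
  case base
  then show ?case by simp
next
  case (step c t w)
  let ?S = "{x. x permutes {..<n}}"
  obtain u v where t: "t = tensor u v" "u \<in> left_ideal n e1" "v \<in> left_ideal n e2"
    using step(1) by blast
  have u: "u = conv n u e1" and v: "v = conv n v e2"
    using t(2,3) e1(2) e2(2) by (auto simp: left_ideal_def conv_assoc)
  have "t = (\<Sum>x\<in>?S. \<Sum>y\<in>?S. cscale (t (x, y)) (tensor (left_mult x e1) (left_mult y e2)))"
  proof
    fix z :: "(nat \<Rightarrow> nat) \<times> (nat \<Rightarrow> nat)"
    have "t z = conv n u e1 (fst z) * conv n v e2 (snd z)"
      using u v by (simp add: t(1) tensor_def split_beta)
    also have "\<dots> = (\<Sum>x\<in>?S. \<Sum>y\<in>?S. cscale (t (x, y)) (tensor (left_mult x e1) (left_mult y e2))) z"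
      by (simp add: t(1) tensor_def split_beta conv_def sum_product sum_fun_apply cscale_apply left_mult_def mult_ac)
    finally show "t z = (\<Sum>x\<in>?S. \<Sum>y\<in>?S. cscale (t (x, y)) (tensor (left_mult x e1) (left_mult y e2))) z" .
  qed
  then have "cscale c t = cscale c (\<Sum>x\<in>?S. \<Sum>y\<in>?S. cscale (t (x, y)) (tensor (left_mult x e1) (left_mult y e2)))"
    by simp
  also have "\<dots> = (\<Sum>x\<in>?S. \<Sum>y\<in>?S. cscale (cscale c t (x, y)) (tensor (left_mult x e1) (left_mult y e2)))"
    by (simp add: cfun.scale_sum_right cscale_apply)
  finally have scaled: "cscale c t = (\<Sum>x\<in>?S. \<Sum>y\<in>?S. cscale (cscale c t (x, y)) (tensor (left_mult x e1) (left_mult y e2)))" .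
  have "cscale c t + w = (\<Sum>x\<in>?S. \<Sum>y\<in>?S. cscale (cscale c t (x, y)) (tensor (left_mult x e1) (left_mult y e2)))
     + (\<Sum>x\<in>?S. \<Sum>y\<in>?S. cscale (w (x, y)) (tensor (left_mult x e1) (left_mult y e2)))"
    by (rule arg_cong2[OF scaled step(2), where f = "(+)"])
  also have "\<dots> = (\<Sum>x\<in>?S. \<Sum>y\<in>?S. cscale ((cscale c t + w) (x, y)) (tensor (left_mult x e1) (left_mult y e2)))"
    by (simp add: sum.distrib[symmetric] cfun.scale_left_distrib)
  finally show ?case .
qed

lemma left_mult_in_ideal: "x permutes {..<n} \<Longrightarrow> left_mult x e \<in> left_ideal n e"
  unfolding left_ideal_def using conv_basis_left by (metis rangeI)

lemma tensor_in_space: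
  "u \<in> V \<Longrightarrow> v \<in> W \<Longrightarrow> tensor u v \<in> tensor_space V W"
  unfolding tensor_space_eq by (rule cfun.span_base) blast

lemma tensor_space_subspace: "cfun.subspace (tensor_space V W)"
  unfolding tensor_space_eq by (rule cfun.subspace_span)

lemma diag_tensor: "diag_left_mult g (tensor u v) = tensor (left_mult g u) (left_mult g v)"
  by (simp add: diag_left_mult_def tensor_def left_mult_def fun_eq_iff)

lemma is_subrep_tensor_space:
  "is_subrep n diag_left_mult (tensor_space (left_ideal n e1) (left_ideal n e2))"
  unfolding is_subrep_def
proof (intro conjI allI impI tensor_space_subspace)
  interpret perm_rep n diag_left_mult by (rule perm_rep_diag)
  fix g w assume g: "g permutes {..<n}" and w: "w \<in> tensor_space (left_ideal n e1) (left_ideal n e2)"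
  show "diag_left_mult g w \<in> tensor_space (left_ideal n e1) (left_ideal n e2)"
    using w[unfolded tensor_space_eq]
  proof (induction rule: cfun.span_induct_alt)
    case base
    show ?case by (subst rho_zero[OF g]) (rule cfun.subspace_0[OF tensor_space_subspace])
  next
    case (step c t w)
    obtain u v where t: "t = tensor u v" "u \<in> left_ideal n e1" "v \<in> left_ideal n e2"
      using step(1) by blast
    have "left_mult g u \<in> left_ideal n e1" "left_mult g v \<in> left_ideal n e2"
      using t(2,3) unfolding left_ideal_def
      by (auto simp: conv_basis_left[OF g, symmetric] conv_assoc[symmetric])
    then have "diag_left_mult g t \<in> tensor_space (left_ideal n e1) (left_ideal n e2)"
      unfolding t(1) diag_tensor by (rule tensor_in_space)
    then show ?case
      using step(2) unfolding rho_add[OF g] rho_scale[OF g]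
      by (intro cfun.subspace_add cfun.subspace_scale tensor_space_subspace)
  qed
qed

lemma tensor_space_in_span:
  "tensor_space (left_ideal n e1) (left_ideal n e2) \<subseteq>
    cfun.span ((\<lambda>(x, y). tensor (left_mult x e1) (left_mult y e2)) ` ({x. x permutes {..<n}} \<times> {x. x permutes {..<n}}))"
proof
  fix w assume "w \<in> tensor_space (left_ideal n e1) (left_ideal n e2)"
  from tensor_space_fixed[OF this] show "w \<in> cfun.span ((\<lambda>(x, y). tensor (left_mult x e1) (left_mult y e2)) `
      ({x. x permutes {..<n}} \<times> {x. x permutes {..<n}}))"
    by (rule ssubst) (intro cfun.span_sum cfun.span_scale, rule cfun.span_base, auto)
qed

text \<open>The number of summands isomorphic to the ideal of e is the dimension of e W, hence the
  trace of the composition of e with right multiplication by \<open>e1\<close> and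
  \<open>e2\<close>. The trace is the same for every decomposition, so the definite description is
  resolved at the same time.\<close>

lemma multiplicity_eq_character_sum:
  assumes "primitive_idempotent n e"
  shows "of_nat (multiplicity_in n left_mult (left_ideal n e)
      diag_left_mult (tensor_space (left_ideal n e1) (left_ideal n e2))) =
    (\<Sum>g | g permutes {..<n}. e g * (character n e1 (inv g) * character n e2 (inv g)))"
proof -
  interpret primitive_idempotent n e by fact
  interpret perm_rep n diag_left_mult by (rule perm_rep_diag)
  interpret ideal_in_rep n e diag_left_mult ..
  let ?W = "tensor_space (left_ideal n e1) (left_ideal n e2)"
  let ?S = "{x. x permutes {..<n}}"
  let ?c = "\<lambda>k U. card {i. i < k \<and> isomorphic_reps n left_mult (left_ideal n e) diag_left_mult (U i)}"
  have trace: "of_nat (?c k U) = (\<Sum>g\<in>?S. e g * (character n e1 (inv g) * character n e2 (inv g)))"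
    if dec: "irreducible_decomposition n diag_left_mult ?W k U" for k U
  proof -
    obtain B where B: "finite B" "cfun.independent B" "card B = ?c k U"
      and span_B: "\<And>w. w \<in> ?W \<Longrightarrow> act n diag_left_mult e w \<in> cfun.span B"
      and fix_B: "\<And>b. b \<in> B \<Longrightarrow> b \<in> ?W \<and> act n diag_left_mult e b = b"
      using basis_of_image[OF dec] by blast
    define K where "K z = act n diag_left_mult e (tensor (left_mult (fst z) e1) (left_mult (snd z) e2))" for z
    have "of_nat (?c k U) = (of_nat (card B) :: complex)" by (simp add: B(3))
    also have "\<dots> = (\<Sum>z\<in>?S \<times> ?S. K z z)"
    proof (rule card_basis_eq_trace[where K = K, OF _ B(1,2)])
      show "finite (?S \<times> ?S)" by simp
      show "K z \<in> cfun.span B" if "z \<in> ?S \<times> ?S" for z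
        unfolding K_def using that by (intro span_B tensor_in_space left_mult_in_ideal) auto
      show "(\<Sum>z\<in>?S \<times> ?S. cscale (b z) (K z)) = b" if "b \<in> B" for b
      proof -
        have b: "b \<in> ?W" "act n diag_left_mult e b = b" using fix_B[OF that] by auto
        have "(\<Sum>z\<in>?S \<times> ?S. cscale (b z) (K z)) = (\<Sum>x\<in>?S. \<Sum>y\<in>?S. cscale (b (x, y)) (K (x, y)))"
          by (simp add: sum.cartesian_product split_beta)
        also have "\<dots> = act n diag_left_mult e (\<Sum>x\<in>?S. \<Sum>y\<in>?S.
            cscale (b (x, y)) (tensor (left_mult x e1) (left_mult y e2)))"
          by (simp add: act_sum_right act_scale_right K_def)
        also have "\<dots> = b"
          by (simp only: tensor_space_fixed[OF b(1), symmetric] b(2))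
        finally show ?thesis .
      qed
    qed
    also have "\<dots> = (\<Sum>z\<in>?S \<times> ?S. \<Sum>g\<in>?S. e g * e1 (inv (fst z) \<circ> inv g \<circ> fst z) * e2 (inv (snd z) \<circ> inv g \<circ> snd z))"
      unfolding K_def by (simp add: act_diag_tensor left_mult_def o_assoc)
    also have "\<dots> = (\<Sum>g\<in>?S. \<Sum>z\<in>?S \<times> ?S. e g * e1 (inv (fst z) \<circ> inv g \<circ> fst z) * e2 (inv (snd z) \<circ> inv g \<circ> snd z))"
      by (rule sum.swap)
    also have "\<dots> = (\<Sum>g\<in>?S. e g * (character n e1 (inv g) * character n e2 (inv g)))"
      unfolding character_def sum_product
      by (simp add: sum_distrib_left sum.cartesian_product split_beta mult.assoc)
    finally show ?thesis .
  qed
  have "\<exists>k U. irreducible_decomposition n diag_left_mult ?W k U"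
    by (rule irreducible_decomposition_exists[OF _ is_subrep_tensor_space tensor_space_in_span]) simp
  then obtain k U where dec: "irreducible_decomposition n diag_left_mult ?W k U" by blast
  have "multiplicity_in n left_mult (left_ideal n e) diag_left_mult ?W = ?c k U"
    unfolding multiplicity_in_def
  proof (rule the_equality)
    show "\<exists>k' U'. irreducible_decomposition n diag_left_mult ?W k' U' \<and> ?c k U = ?c k' U'"
      using dec by blast
    fix m assume "\<exists>k' U'. irreducible_decomposition n diag_left_mult ?W k' U' \<and> m = ?c k' U'"
    then obtain k' U' where "irreducible_decomposition n diag_left_mult ?W k' U'" "m = ?c k' U'" by blast
    then have "(of_nat m :: complex) = of_nat (?c k U)"
      using trace dec by simp
    then show "m = ?c k U" using of_nat_eq_iff by blast
  qed
  with trace[OF dec] show ?thesis by simp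
qed

end


subsection \<open>Tableaux\<close>

lemma card_by_fibres:
  "card {m. m < n \<and> P m} = (\<Sum>i\<in>h ` {..<n::nat}. card {m. m < n \<and> P m \<and> h m = i})"
proof -
  have "(\<Sum>i\<in>h ` {..<n}. \<Sum>m\<in>{m \<in> {m. m < n \<and> P m}. h m = i}. 1 :: nat) = (\<Sum>m\<in>{m. m < n \<and> P m}. 1)"
    by (rule sum.group) auto
  then show ?thesis by (simp add: conj_assoc)
qed

locale tableau =
  fixes n :: nat and lam r c :: "nat \<Rightarrow> nat"
  assumes anti: "antimono lam"
    and col_less: "m < n \<Longrightarrow> c m < lam (r m)"
    and inj_cell: "m < n \<Longrightarrow> m' < n \<Longrightarrow> r m = r m' \<Longrightarrow> c m = c m' \<Longrightarrow> m = m'"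
    and cell_exists: "j < lam i \<Longrightarrow> \<exists>m<n. r m = i \<and> c m = j"
begin

lemma card_row_segment: "card {m. m < n \<and> r m = i \<and> c m < k} = min (lam i) k"
proof -
  have "inj_on c {m. m < n \<and> r m = i \<and> c m < k}"
    using inj_cell by (auto simp: inj_on_def)
  moreover have "c ` {m. m < n \<and> r m = i \<and> c m < k} = {..<min (lam i) k}"
  proof (intro subset_antisym subsetI)
    fix j assume "j \<in> {..<min (lam i) k}"
    then show "j \<in> c ` {m. m < n \<and> r m = i \<and> c m < k}"
      using cell_exists[of j i] by auto
  qed (auto simp: col_less)
  ultimately show ?thesis using card_image by fastforce
qed

lemma card_row: "card {m. m < n \<and> r m = i} = lam i"
proof -
  have "{m. m < n \<and> r m = i} = {m. m < n \<and> r m = i \<and> c m < lam i}"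
    using col_less by auto
  then show ?thesis using card_row_segment[of i "lam i"] by simp
qed

text \<open>Counting the entries of the first columns shows that \<open>c \<circ> inv x\<close> also takes values below the row lengths.\<close>

lemma row_column_factorization:
  assumes x: "x permutes {..<n}"
    and inj: "\<And>m m'. m < n \<Longrightarrow> m' < n \<Longrightarrow> r m = r m' \<Longrightarrow> c (inv x m) = c (inv x m') \<Longrightarrow> m = m'"
  obtains p q where "p permutes {..<n}" "\<And>m. m < n \<Longrightarrow> r (p m) = r m"
    "q permutes {..<n}" "\<And>m. m < n \<Longrightarrow> c (q m) = c m" "x = p \<circ> q"
proof -
  define d where "d m = c (inv x m)" for m
  have ix: "inv x permutes {..<n}" using x by (rule permutes_inv)
  have xn: "x m < n \<longleftrightarrow> m < n" "inv x m < n \<longleftrightarrow> m < n" for m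
    using permutes_in_image[OF x, of m] permutes_in_image[OF ix, of m] by auto
  have le: "card {m. m < n \<and> d m < k \<and> r m = i} \<le> card {m. m < n \<and> c m < k \<and> r m = i}" for i k
  proof -
    have "{m. m < n \<and> c m < k \<and> r m = i} = {m. m < n \<and> r m = i \<and> c m < k}" by auto
    then have *: "card {m. m < n \<and> c m < k \<and> r m = i} = min (lam i) k"
      by (simp only: card_row_segment)
    have "inj_on d {m. m < n \<and> d m < k \<and> r m = i}"
      using inj by (auto simp: inj_on_def d_def)
    then have "card {m. m < n \<and> d m < k \<and> r m = i} \<le> card {..<k}"
      by (rule card_inj_on_le) auto
    moreover have "card {m. m < n \<and> d m < k \<and> r m = i} \<le> card {m. m < n \<and> r m = i}"
      by (rule card_mono) auto
    ultimately show ?thesis unfolding * card_row by simp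
  qed
  have eq: "card {m. m < n \<and> d m < k} = card {m. m < n \<and> c m < k}" for k
  proof -
    have "bij_betw x {m. m < n \<and> c m < k} {m. m < n \<and> d m < k}"
      by (rule bij_betw_byWitness[where f' = "inv x"])
        (auto simp: d_def xn permutes_inverses[OF x])
    then show ?thesis by (simp add: bij_betw_same_card)
  qed
  \<comment> \<open>Row by row the counts satisfy an inequality, and their totals agree, so each of
    them is an equality.\<close>
  have row_eq: "card {m. m < n \<and> d m < k \<and> r m = i} = card {m. m < n \<and> c m < k \<and> r m = i}"
    if "i \<in> r ` {..<n}" for i k
  proof (rule sum_mono_inv[OF _ le that])
    show "(\<Sum>i\<in>r ` {..<n}. card {m. m < n \<and> d m < k \<and> r m = i}) =
        (\<Sum>i\<in>r ` {..<n}. card {m. m < n \<and> c m < k \<and> r m = i})"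
      unfolding card_by_fibres[of n "\<lambda>m. d m < k" r, symmetric] card_by_fibres[of n "\<lambda>m. c m < k" r, symmetric]
      by (rule eq)
  qed simp
  have d_less: "d m < lam (r m)" if m: "m < n" for m
  proof -
    let ?i = "r m"
    have "{m. m < n \<and> c m < lam ?i \<and> r m = ?i} = {m. m < n \<and> r m = ?i}"
      by (rule Collect_cong) (metis col_less)
    then have "card {m. m < n \<and> d m < lam ?i \<and> r m = ?i} = card {m. m < n \<and> r m = ?i}"
      using row_eq[of ?i "lam ?i"] m by simp
    then have "{m. m < n \<and> d m < lam ?i \<and> r m = ?i} = {m. m < n \<and> r m = ?i}"
      by (intro card_subset_eq) auto
    then show ?thesis using m by blast
  qed
  \<comment> \<open>u moves m within its row to the column \<open>d m\<close>. Hence u preserves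
    rows, and u after x preserves columns because \<open>d (x m) = c m\<close>.\<close>
  define u where "u m = (if m < n then (SOME m'. m' < n \<and> r m' = r m \<and> c m' = d m) else m)" for m
  have u: "u m < n" "r (u m) = r m" "c (u m) = d m" if "m < n" for m
    using someI_ex[OF cell_exists[OF d_less[OF that]]] that by (auto simp: u_def)
  have "inj_on u {..<n}"
    by (rule inj_onI) (metis d_def inj lessThan_iff u(2) u(3))
  then have "bij_betw u {..<n} {..<n}"
    using u(1) by (intro bij_betw_imageI endo_inj_surj) auto
  then have up: "u permutes {..<n}"
    by (rule bij_imp_permutes) (simp add: u_def)
  have iu: "inv u m < n" if "m < n" for m
    using permutes_in_image[OF permutes_inv[OF up], of m] that by simp
  show thesis
  proof
    show "inv u permutes {..<n}" using up by (rule permutes_inv)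
    show "r (inv u m) = r m" if "m < n" for m
      using u(2)[OF iu[OF that]] by (simp add: permutes_inverses[OF up])
    show "u \<circ> x permutes {..<n}" using x up by (rule permutes_compose)
    show "c ((u \<circ> x) m) = c m" if "m < n" for m
      using u(3)[of "x m"] that by (simp add: xn d_def permutes_inverses[OF x])
    show "x = inv u \<circ> (u \<circ> x)" by (simp add: permutes_cancel[OF up])
  qed
qed

text \<open>It suffices to compare within one column. If the column reaches row k, it has k + 1
  entries in rows up to k, while injectivity admits at most k + 1 labels up to k. A shorter column
  lies entirely in these rows.\<close>

lemma dominance_if_inj_on_columns:
  fixes f :: "nat \<Rightarrow> nat"
  assumes inj: "\<And>m m'. m < n \<Longrightarrow> m' < n \<Longrightarrow> c m = c m' \<Longrightarrow> f m = f m' \<Longrightarrow> m = m'"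
  shows "card {m. m < n \<and> f m \<le> k} \<le> card {m. m < n \<and> r m \<le> k}"
proof -
  have "card {m. m < n \<and> f m \<le> k \<and> c m = j} \<le> card {m. m < n \<and> r m \<le> k \<and> c m = j}" for j
  proof (cases "\<forall>i\<le>k. j < lam i")
    case True
    have "inj_on f {m. m < n \<and> f m \<le> k \<and> c m = j}"
      using inj by (auto simp: inj_on_def)
    then have "card {m. m < n \<and> f m \<le> k \<and> c m = j} \<le> card {..k}"
      by (rule card_inj_on_le) auto
    also have "\<dots> \<le> card (r ` {m. m < n \<and> r m \<le> k \<and> c m = j})"
    proof (rule card_mono)
      show "{..k} \<subseteq> r ` {m. m < n \<and> r m \<le> k \<and> c m = j}"
        using True cell_exists[of j] by fastforce
    qed simp
    also have "\<dots> \<le> card {m. m < n \<and> r m \<le> k \<and> c m = j}"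
      by (rule card_image_le) simp
    finally show ?thesis .
  next
    case False
    then obtain i where i: "i \<le> k" "lam i \<le> j" by force
    have "r m \<le> k" if "m < n" "c m = j" for m
    proof (rule ccontr)
      assume "\<not> r m \<le> k"
      then have "lam (r m) \<le> lam i" using i antimonoD[OF anti, of i "r m"] by simp
      with col_less[OF that(1)] that i show False by simp
    qed
    then show ?thesis by (intro card_mono) auto
  qed
  then show ?thesis
    unfolding card_by_fibres[of n "\<lambda>m. f m \<le> k" c] card_by_fibres[of n "\<lambda>m. r m \<le> k" c] by (rule sum_mono)
qed

lemma first_column_collision:
  assumes "finite Z" "f ` {..<n} \<subseteq> Z" "card Z < card {i. lam i \<noteq> 0}"
  obtains m m' where "m < n" "m' < n" "m \<noteq> m'" "c m = c m'" "f m = f m'"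
proof -
  have "{i. lam i \<noteq> 0} \<subseteq> r ` {m. m < n \<and> c m = 0}"
  proof
    fix i assume "i \<in> {i. lam i \<noteq> 0}"
    then obtain m where "m < n" "r m = i" "c m = 0" using cell_exists[of 0 i] by auto
    then show "i \<in> r ` {m. m < n \<and> c m = 0}" by auto
  qed
  then have "card {i. lam i \<noteq> 0} \<le> card {m. m < n \<and> c m = 0}"
    by (intro surj_card_le) auto
  then have "\<not> inj_on f {m. m < n \<and> c m = 0}"
    using card_inj_on_le[of f "{m. m < n \<and> c m = 0}" Z] assms by fastforce
  then show thesis using that by (auto simp: inj_on_def)
qed

end

section \<open>Partitions and their row-filled tableaux\<close>

lemma partition_vanishes:
  assumes "is_partition lam" "part_length lam \<le> j"
  shows "lam j = 0"
proof (rule ccontr)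
  assume "lam j \<noteq> 0"
  then have "{..j} \<subseteq> {i. lam i \<noteq> 0}"
    using antimonoD[of lam _ j] assms(1) by (fastforce simp: is_partition_def)
  moreover have "finite {i. lam i \<noteq> 0}" using assms(1) by (simp add: is_partition_def)
  ultimately have "card {..j} \<le> part_length lam"
    unfolding part_length_def by (rule card_mono[rotated])
  with assms(2) show False by simp
qed

lemma weight_eq_sum:
  assumes "is_partition lam" "part_length lam \<le> k"
  shows "weight lam = (\<Sum>j<k. lam j)"
  unfolding weight_def
proof (rule sum.mono_neutral_left)
  show "{j. lam j \<noteq> 0} \<subseteq> {..<k}"
  proof
    fix j assume "j \<in> {j. lam j \<noteq> 0}"
    then have "\<not> k \<le> j" using partition_vanishes[OF assms(1), of j] assms(2) by auto
    then show "j \<in> {..<k}" by simp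
  qed
qed auto

lemma tableau_tab:
  assumes "partition_of n lam"
  shows "tableau n lam (tab_row lam) (tab_col lam)"
proof -
  have part: "is_partition lam" "weight lam = n" using assms by (auto simp: partition_of_def)
  have mono: "(\<Sum>j<a. lam j) \<le> (\<Sum>j<b. lam j)" if "a \<le> b" for a b
    using that by (intro sum_mono2) auto
  have total: "(\<Sum>j<a. lam j) \<le> n" for a
    using weight_eq_sum[OF part(1), of "max a (part_length lam)"] mono[of a "max a (part_length lam)"] part(2)
    by simp
  have row: "(\<Sum>j<tab_row lam m. lam j) \<le> m" "m < (\<Sum>j<Suc (tab_row lam m). lam j)" if "m < n" for m
  proof -
    have ex: "m < (\<Sum>j\<le>part_length lam. lam j)"
      using that weight_eq_sum[OF part(1), of "Suc (part_length lam)"] part(2) by (simp add: lessThan_Suc_atMost)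
    show "m < (\<Sum>j<Suc (tab_row lam m). lam j)"
      unfolding tab_row_def lessThan_Suc_atMost by (rule LeastI[of "\<lambda>r. m < (\<Sum>j\<le>r. lam j)", OF ex])
    show "(\<Sum>j<tab_row lam m. lam j) \<le> m"
    proof (cases "tab_row lam m")
      case (Suc i)
      then have "\<not> m < (\<Sum>j\<le>i. lam j)"
        unfolding tab_row_def using not_less_Least[of i "\<lambda>r. m < (\<Sum>j\<le>r. lam j)"] by simp
      then show ?thesis by (simp add: Suc lessThan_Suc_atMost)
    qed simp
  qed
  have row_unique: "tab_row lam m = i" if "(\<Sum>j<i. lam j) \<le> m" "m < (\<Sum>j<Suc i. lam j)" "m < n" for m i
  proof (rule ccontr)
    assume "tab_row lam m \<noteq> i"
    then consider "Suc (tab_row lam m) \<le> i" | "Suc i \<le> tab_row lam m" by linarith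
    then show False
    proof cases
      case 1
      show False using mono[OF 1] row(2)[OF that(3)] that(1) by linarith
    next
      case 2
      show False using mono[OF 2] row(1)[OF that(3)] that(2) by linarith
    qed
  qed
  show ?thesis
  proof
    show "antimono lam" using part(1) by (simp add: is_partition_def)
    show "tab_col lam m < lam (tab_row lam m)" if "m < n" for m
      using row[OF that] by (simp add: tab_col_def)
    show "m = m'" if "m < n" "m' < n" "tab_row lam m = tab_row lam m'" "tab_col lam m = tab_col lam m'" for m m'
      using row(1)[OF that(1)] row(1)[OF that(2)] that(3,4) by (simp add: tab_col_def)
    show "\<exists>m<n. tab_row lam m = i \<and> tab_col lam m = j" if "j < lam i" for i j
    proof (intro exI conjI)
      let ?m = "(\<Sum>j<i. lam j) + j"
      have "?m < (\<Sum>j<Suc i. lam j)" using that by simp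
      then show "?m < n" using total[of "Suc i"] by linarith
      then show "tab_row lam ?m = i" using that by (intro row_unique) auto
      then show "tab_col lam ?m = j" by (simp add: tab_col_def)
    qed
  qed
qed


subsection \<open>Young symmetrizers\<close>

lemma convolution_at_id_shift:
  assumes x: "x permutes {..<n}"
  shows "conv n (conv n f (basis_elt x)) h id = conv n h f (inv x)"
proof -
  have "conv n (conv n f (basis_elt x)) h id = conv n (conv n h f) (basis_elt x) id"
    using conv_at_id_commute[of n "conv n f (basis_elt x)" h] by (simp only: conv_assoc)
  also have "\<dots> = conv n h f (inv x)"
    using conv_basis_right[OF x permutes_id] by simp
  finally show ?thesis .
qed

lemma conjugate_eq_conv:
  assumes x: "x permutes {..<n}" and y: "y permutes {..<n}"
  shows "conv n (basis_elt x) (conv n f (basis_elt (inv x))) y = f (inv x \<circ> y \<circ> x)"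
proof -
  have "inv x \<circ> y permutes {..<n}" using x y by (simp add: permutes_compose permutes_inv)
  then show ?thesis
    using x y by (simp add: conv_basis_left left_mult_def conv_basis_right permutes_inv permutes_inv_inv)
qed

lemma character_conv_commute:
  assumes g: "g permutes {..<n}"
  shows "character n (conv n f h) g = character n (conv n h f) g"
proof -
  let ?S = "{x. x permutes {..<n}}"
  have "character n (conv n f h) g = (\<Sum>y\<in>?S. \<Sum>x\<in>?S. f y * h (inv y \<circ> (inv x \<circ> g \<circ> x)))"
    unfolding character_def conv_def by (rule sum.swap)
  also have "\<dots> = (\<Sum>y\<in>?S. \<Sum>x\<in>?S. f y * h ((inv x \<circ> g \<circ> x) \<circ> inv y))"
  proof (rule sum.cong[OF refl])
    fix y assume "y \<in> ?S"
    then have y: "y permutes {..<n}" by simp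
    have "(\<Sum>x\<in>?S. f y * h (inv y \<circ> (inv x \<circ> g \<circ> x))) =
        (\<Sum>x\<in>?S. f y * h (inv y \<circ> (inv (x \<circ> inv y) \<circ> g \<circ> (x \<circ> inv y))))"
      by (rule sum_perm_compose_right[OF permutes_inv[OF y], symmetric])
    also have "\<dots> = (\<Sum>x\<in>?S. f y * h ((inv x \<circ> g \<circ> x) \<circ> inv y))"
      by (rule sum.cong)
        (auto simp: permutes_inv_comp[OF _ permutes_inv[OF y]] permutes_inv_inv[OF y] o_assoc permutes_cancel[OF y])
    finally show "(\<Sum>x\<in>?S. f y * h (inv y \<circ> (inv x \<circ> g \<circ> x))) = \<dots>" .
  qed
  also have "\<dots> = (\<Sum>x\<in>?S. \<Sum>y\<in>?S. f y * h ((inv x \<circ> g \<circ> x) \<circ> inv y))"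
    by (rule sum.swap)
  also have "\<dots> = character n (conv n h f) g"
    unfolding character_def
  proof (rule sum.cong[OF refl])
    fix x assume "x \<in> ?S"
    then have x: "x permutes {..<n}" by simp
    show "(\<Sum>y\<in>?S. f y * h ((inv x \<circ> g \<circ> x) \<circ> inv y)) = conv n h f (inv x \<circ> g \<circ> x)"
    proof -
      define u where "u = inv x \<circ> g \<circ> x"
      have u: "u permutes {..<n}" using g x unfolding u_def by (intro permutes_compose permutes_inv)
      have "conv n h f u = (\<Sum>z\<in>?S. h (u \<circ> inv z) * f (inv (u \<circ> inv z) \<circ> u))"
        unfolding conv_def
        by (subst sum_perm_compose_left[OF u, symmetric], subst sum_perm_inverse[symmetric]) (rule refl)
      also have "\<dots> = (\<Sum>y\<in>?S. f y * h (u \<circ> inv y))"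
        by (rule sum.cong)
         (auto simp: permutes_inv_comp[OF u] permutes_inv permutes_inv_inv o_assoc[symmetric] permutes_cancel[OF u] mult.commute)
      finally show ?thesis by (simp add: u_def)
    qed
  qed
  finally show ?thesis .
qed

definition row_sum :: "nat \<Rightarrow> (nat \<Rightarrow> nat) \<Rightarrow> (nat \<Rightarrow> nat) \<Rightarrow> complex" where
  "row_sum n lam x = (if x \<in> row_group n lam then 1 else 0)"

definition col_sum :: "nat \<Rightarrow> (nat \<Rightarrow> nat) \<Rightarrow> (nat \<Rightarrow> nat) \<Rightarrow> complex" where
  "col_sum n lam x = (if x \<in> col_group n lam then of_int (sign x) else 0)"

lemma stabilizer_group:
  fixes f :: "nat \<Rightarrow> 'a" and n :: nat
  defines "G \<equiv> {p. p permutes {..<n} \<and> (\<forall>m<n. f (p m) = f m)}"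
  assumes p: "p \<in> G"
  shows "inv p \<in> G" "q \<in> G \<Longrightarrow> p \<circ> q \<in> G" "p \<circ> q \<in> G \<longleftrightarrow> q \<in> G" "q \<circ> p \<in> G \<longleftrightarrow> q \<in> G"
proof -
  have img: "x m < n" if "x permutes {..<n}" "m < n" for x m
    using permutes_in_image[OF that(1), of m] that(2) by simp
  have inv: "inv p \<in> G" if "p \<in> G" for p
  proof -
    have p: "p permutes {..<n}" using that by (simp add: G_def)
    have "f (inv p m) = f m" if "m < n" for m
      using \<open>p \<in> G\<close> img[OF permutes_inv[OF p] that] permutes_inverses(1)[OF p, of m] by (auto simp: G_def)
    then show ?thesis using permutes_inv[OF p] by (simp add: G_def)
  qed
  have comp: "p \<circ> q \<in> G" if "p \<in> G" "q \<in> G" for p q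
    using that img by (auto simp: G_def permutes_compose)
  show "inv p \<in> G" using inv p .
  show "q \<in> G \<Longrightarrow> p \<circ> q \<in> G" using comp p by blast
  have pp: "p permutes {..<n}" using p by (simp add: G_def)
  show "p \<circ> q \<in> G \<longleftrightarrow> q \<in> G"
    using comp[OF p, of q] comp[OF inv[OF p], of "p \<circ> q"] permutes_cancel(3)[OF pp, of q] by auto
  show "q \<circ> p \<in> G \<longleftrightarrow> q \<in> G"
    using comp[OF _ p, of q] comp[OF _ inv[OF p], of "q \<circ> p"] permutes_cancel(5)[OF pp, of q] by auto
qed

lemma sign_compose_perms:
  "p permutes {..<n::nat} \<Longrightarrow> q permutes {..<n} \<Longrightarrow> sign (p \<circ> q) = sign p * sign q"
  by (meson finite_lessThan permutation_permutes sign_compose)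

lemma sign_inverse_perm: "p permutes {..<n::nat} \<Longrightarrow> sign (inv p) = sign p"
  by (meson finite_lessThan permutation_permutes sign_inverse)

context
  fixes n :: nat and lam :: "nat \<Rightarrow> nat"
begin

lemma row_group_perm: "p \<in> row_group n lam \<Longrightarrow> p permutes {..<n}"
  and col_group_perm: "q \<in> col_group n lam \<Longrightarrow> q permutes {..<n}"
  by (auto simp: row_group_def col_group_def)

lemmas row_group_closed = stabilizer_group[where f = "tab_row lam" and n = n, folded row_group_def]
lemmas col_group_closed = stabilizer_group[where f = "tab_col lam" and n = n, folded col_group_def]

lemma finite_row_group: "finite (row_group n lam)" and finite_col_group: "finite (col_group n lam)"
  by (auto intro: finite_subset[OF _ finite_perms[of n]] simp: row_group_def col_group_def)

lemma id_row_group: "id \<in> row_group n lam" and id_col_group: "id \<in> col_group n lam"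
  by (auto simp: row_group_def col_group_def permutes_id)

lemma supp_row_sum: "supp n (row_sum n lam)" and supp_col_sum: "supp n (col_sum n lam)"
  using row_group_perm col_group_perm by (auto simp: supp_def row_sum_def col_sum_def)

lemma row_sum_left: "p \<in> row_group n lam \<Longrightarrow> row_sum n lam (p \<circ> x) = row_sum n lam x"
  by (simp add: row_sum_def row_group_closed)

lemma col_sum_right: "q \<in> col_group n lam \<Longrightarrow> col_sum n lam (x \<circ> q) = of_int (sign q) * col_sum n lam x"
  by (auto simp: col_sum_def col_group_closed sign_compose_perms[OF col_group_perm col_group_perm] mult.commute)

lemma star_row_sum: "star n (row_sum n lam) = row_sum n lam"
proof (rule supp_ext[OF supp_star supp_row_sum])
  fix x :: "nat \<Rightarrow> nat" assume x: "x permutes {..<n}"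
  have "inv x \<in> row_group n lam \<longleftrightarrow> x \<in> row_group n lam"
    using row_group_closed(1)[of x] row_group_closed(1)[of "inv x"] permutes_inv_inv[OF x] by auto
  then show "star n (row_sum n lam) x = row_sum n lam x"
    using x by (simp add: star_def row_sum_def)
qed

lemma star_col_sum: "star n (col_sum n lam) = col_sum n lam"
proof (rule supp_ext[OF supp_star supp_col_sum])
  fix x :: "nat \<Rightarrow> nat" assume x: "x permutes {..<n}"
  have "inv x \<in> col_group n lam \<longleftrightarrow> x \<in> col_group n lam"
    using col_group_closed(1)[of x] col_group_closed(1)[of "inv x"] permutes_inv_inv[OF x] by auto
  then show "star n (col_sum n lam) x = col_sum n lam x"
    using x by (simp add: star_def col_sum_def sign_inverse_perm)
qed

lemma conv_left_invariant:
  assumes p: "p permutes {..<n}" and f: "\<And>x. f (p \<circ> x) = k * f x"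
  shows "conv n f h (p \<circ> x) = k * conv n f h x"
proof -
  have "conv n f h (p \<circ> x) = (\<Sum>y | y permutes {..<n}. f (p \<circ> y) * h (inv (p \<circ> y) \<circ> (p \<circ> x)))"
    unfolding conv_def by (rule sum_perm_compose_left[OF p, symmetric])
  also have "\<dots> = (\<Sum>y | y permutes {..<n}. k * (f y * h (inv y \<circ> x)))"
    by (rule sum.cong) (auto simp: f permutes_inv_comp[OF p] o_assoc[symmetric] permutes_cancel[OF p])
  finally show ?thesis by (simp add: conv_def sum_distrib_left)
qed

lemma conv_right_invariant:
  assumes "\<And>x. h (x \<circ> q) = k * h x"
  shows "conv n f h (x \<circ> q) = k * conv n f h x"
  unfolding conv_def sum_distrib_left by (rule sum.cong) (simp_all add: assms o_assoc)

lemma young_symmetrizer_eq: "young_symmetrizer n lam = conv n (row_sum n lam) (col_sum n lam)"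
proof
  fix x
  let ?S = "{y. y permutes {..<n}}"
  have "conv n (row_sum n lam) (col_sum n lam) x = (\<Sum>p\<in>row_group n lam. col_sum n lam (inv p \<circ> x))"
    unfolding conv_def using row_group_perm
    by (intro sum.mono_neutral_cong_right) (auto simp: row_sum_def)
  also have "\<dots> = (\<Sum>p\<in>row_group n lam. \<Sum>q\<in>col_group n lam. if x = p \<circ> q then of_int (sign q) else 0)"
  proof (rule sum.cong[OF refl])
    fix p assume "p \<in> row_group n lam"
    then have p: "p permutes {..<n}" by (rule row_group_perm)
    have *: "x = p \<circ> q \<longleftrightarrow> q = inv p \<circ> x" for q
      using permutes_cancel(3,4)[OF p] by metis
    show "col_sum n lam (inv p \<circ> x) = (\<Sum>q\<in>col_group n lam. if x = p \<circ> q then of_int (sign q) else 0)"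
      unfolding * by (simp add: finite_col_group col_sum_def)
  qed
  finally show "young_symmetrizer n lam x = conv n (row_sum n lam) (col_sum n lam) x"
    by (simp add: young_symmetrizer_def)
qed

lemma conv_row_sum_row_sum: "conv n (row_sum n lam) (row_sum n lam) = cscale (of_nat (card (row_group n lam))) (row_sum n lam)"
proof
  fix x
  have "conv n (row_sum n lam) (row_sum n lam) x = (\<Sum>p\<in>row_group n lam. row_sum n lam (inv p \<circ> x))"
    unfolding conv_def using row_group_perm
    by (intro sum.mono_neutral_cong_right) (auto simp: row_sum_def)
  also have "\<dots> = (\<Sum>p\<in>row_group n lam. row_sum n lam x)"
    by (rule sum.cong) (auto simp: row_sum_left row_group_closed)
  finally show "conv n (row_sum n lam) (row_sum n lam) x = cscale (of_nat (card (row_group n lam))) (row_sum n lam) x"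
    by (simp add: cscale_apply)
qed

lemma conv_row_row_assoc: "conv n (row_sum n lam) (conv n (row_sum n lam) f) =
    cscale (of_nat (card (row_group n lam))) (conv n (row_sum n lam) f)"
  by (simp add: conv_assoc[symmetric] conv_row_sum_row_sum conv_scale_left)

context
  assumes partition: "partition_of n lam"
begin

interpretation tableau n lam "tab_row lam" "tab_col lam"
  by (rule tableau_tab[OF partition])

lemma row_col_trivial:
  assumes "p \<in> row_group n lam" "p \<in> col_group n lam"
  shows "p = id"
proof
  fix m
  have p: "p permutes {..<n}" using assms(1) by (rule row_group_perm)
  show "p m = id m"
  proof (cases "m < n")
    case True
    then have "p m < n" using permutes_in_image[OF p, of m] by simp
    then show ?thesis
      using True assms inj_cell[of "p m" m] by (simp add: row_group_def col_group_def)
  qed (use p in \<open>simp add: permutes_def\<close>)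
qed

lemma young_symmetrizer_id: "young_symmetrizer n lam id = 1"
proof -
  have "young_symmetrizer n lam id = (\<Sum>y | y permutes {..<n}. row_sum n lam y * col_sum n lam (inv y))"
    unfolding young_symmetrizer_eq conv_at_id ..
  also have "\<dots> = (\<Sum>y\<in>{id}. row_sum n lam y * col_sum n lam (inv y))"
  proof (rule sum.mono_neutral_right)
    show "\<forall>y\<in>{y. y permutes {..<n}} - {id}. row_sum n lam y * col_sum n lam (inv y) = 0"
    proof
      fix y assume y: "y \<in> {y. y permutes {..<n}} - {id}"
      show "row_sum n lam y * col_sum n lam (inv y) = 0"
      proof (rule ccontr)
        assume "row_sum n lam y * col_sum n lam (inv y) \<noteq> 0"
        then have "y \<in> row_group n lam" "inv y \<in> col_group n lam"
          by (auto simp: row_sum_def col_sum_def split: if_splits)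
        then have "y \<in> row_group n lam" "y \<in> col_group n lam"
          using col_group_closed(1)[of "inv y"] permutes_inv_inv[of y "{..<n}"] y by auto
        with row_col_trivial y show False by blast
      qed
    qed
  qed (auto simp: permutes_id)
  also have "\<dots> = 1" by (simp add: row_sum_def col_sum_def id_row_group id_col_group)
  finally show ?thesis .
qed

text \<open>
  von Neumann's lemma. Off the product of the row and the column group, a transposition shows that
  the value of the function equals its own negative.
\<close>

lemma scalar_young_symmetrizer:
  assumes y: "supp n y" and left: "\<And>p x. p \<in> row_group n lam \<Longrightarrow> y (p \<circ> x) = y x"
    and right: "\<And>q x. q \<in> col_group n lam \<Longrightarrow> y (x \<circ> q) = of_int (sign q) * y x"
  shows "y = cscale (y id) (young_symmetrizer n lam)"
proof -
  let ?c = "young_symmetrizer n lam"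
  have c: "supp n ?c" "\<And>p x. p \<in> row_group n lam \<Longrightarrow> ?c (p \<circ> x) = ?c x"
    "\<And>q x. q \<in> col_group n lam \<Longrightarrow> ?c (x \<circ> q) = of_int (sign q) * ?c x"
    unfolding young_symmetrizer_eq
    using supp_conv[OF supp_col_sum] conv_left_invariant[OF row_group_perm, of _ "row_sum n lam" 1]
      conv_right_invariant[of "col_sum n lam"] row_sum_left col_sum_right
    by simp_all
  define z where "z x = y x - y id * ?c x" for x
  have z: "supp n z" "\<And>p x. p \<in> row_group n lam \<Longrightarrow> z (p \<circ> x) = z x"
    "\<And>q x. q \<in> col_group n lam \<Longrightarrow> z (x \<circ> q) = of_int (sign q) * z x" "z id = 0"
    using y c(1) by (auto simp: z_def supp_def left right c(2,3) algebra_simps young_symmetrizer_id)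
  have "z x = 0" if x: "x permutes {..<n}" for x
  proof (cases "\<exists>m m'. m < n \<and> m' < n \<and> tab_row lam m = tab_row lam m' \<and> tab_col lam (inv x m) = tab_col lam (inv x m') \<and> m \<noteq> m'")
    case False
    then have ne: "m = m'" if "m < n" "m' < n" "tab_row lam m = tab_row lam m'"
      "tab_col lam (inv x m) = tab_col lam (inv x m')" for m m'
      using that by blast
    obtain p q where pq: "p \<in> row_group n lam" "q \<in> col_group n lam" and xpq: "x = p \<circ> q"
      by (rule row_column_factorization[OF x ne]) (auto simp: row_group_def col_group_def)
    then have "z x = of_int (sign q) * z id"
      using z(2)[of p q] z(3)[of q id] by simp
    then show ?thesis using z(4) by simp
  next
    case True
    then obtain m m' where m: "m < n" "m' < n" "tab_row lam m = tab_row lam m'"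
      "tab_col lam (inv x m) = tab_col lam (inv x m')" "m \<noteq> m'" by blast
    define t where "t = transpose m m'"
    define s where "s = transpose (inv x m) (inv x m')"
    have mn: "inv x m < n" "inv x m' < n" "inv x m \<noteq> inv x m'"
      using m permutes_in_image[OF permutes_inv[OF x]] permutes_inj[OF permutes_inv[OF x]] by (auto dest: injD)
    have t: "t \<in> row_group n lam"
      using m by (auto simp: t_def row_group_def transpose_def permutes_swap_id)
    have s: "s \<in> col_group n lam" "sign s = -1"
      using m mn by (auto simp: s_def col_group_def transpose_def permutes_swap_id sign_swap_id)
    have "t \<circ> x \<circ> s = x"
      by (auto simp: fun_eq_iff s_def t_def transpose_def permutes_inverses[OF x])
    then have "z x = - z x"
      using z(2)[OF t, of "x \<circ> s"] z(3)[OF s(1), of x] s(2) by (simp add: o_assoc)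
    then show ?thesis by simp
  qed
  then have zero: "z x = 0" for x using z(1) unfolding supp_def by blast
  show ?thesis
  proof
    fix x
    show "y x = cscale (y id) ?c x"
      unfolding cscale_apply by (rule eq_iff_diff_eq_0[THEN iffD2, OF zero[of x, unfolded z_def]])
  qed
qed

end

end


subsection \<open>Irreducible characters\<close>

text \<open>The square of the Young symmetrizer is a multiple of it by von Neumann's lemma, and the
  symmetrizer is 1 at \<open>id\<close>; so the value of the square at \<open>id\<close> is the
  scalar.\<close>

definition young_factor :: "nat \<Rightarrow> (nat \<Rightarrow> nat) \<Rightarrow> complex" where
  "young_factor n lam = conv n (young_symmetrizer n lam) (young_symmetrizer n lam) id"

definition young_idempotent :: "nat \<Rightarrow> (nat \<Rightarrow> nat) \<Rightarrow> (nat \<Rightarrow> nat) \<Rightarrow> complex" where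
  "young_idempotent n lam = cscale (1 / young_factor n lam) (young_symmetrizer n lam)"

definition irr_char :: "nat \<Rightarrow> (nat \<Rightarrow> nat) \<Rightarrow> (nat \<Rightarrow> nat) \<Rightarrow> complex" where
  "irr_char n lam = character n (young_idempotent n lam)"

context
  fixes n :: nat and lam :: "nat \<Rightarrow> nat"
  assumes partition: "partition_of n lam"
begin

private abbreviation "a \<equiv> row_sum n lam"
private abbreviation "b \<equiv> col_sum n lam"
private abbreviation "c \<equiv> young_symmetrizer n lam"
private abbreviation "kappa \<equiv> young_factor n lam"
private abbreviation "e \<equiv> young_idempotent n lam"

lemma row_sandwich: "conv n a (conv n y b) = cscale (conv n a (conv n y b) id) c"
proof (rule scalar_young_symmetrizer[OF partition])
  show "supp n (conv n a (conv n y b))" by (intro supp_conv supp_col_sum)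
  show "conv n a (conv n y b) (p \<circ> x) = conv n a (conv n y b) x" if "p \<in> row_group n lam" for p x
    using conv_left_invariant[OF row_group_perm[OF that], of a 1] row_sum_left[OF that] by simp
  show "conv n a (conv n y b) (x \<circ> q) = of_int (sign q) * conv n a (conv n y b) x" if "q \<in> col_group n lam" for q x
    by (intro conv_right_invariant col_sum_right that)
qed

lemma supp_young: "supp n c"
  unfolding young_symmetrizer_eq by (intro supp_conv supp_col_sum)

lemma young_sandwich: "conv n c (conv n y c) = cscale (conv n c (conv n y c) id) c"
proof -
  have "conv n c (conv n y c) = conv n a (conv n (conv n b (conv n y a)) b)"
    by (simp only: young_symmetrizer_eq conv_assoc)
  then show ?thesis using row_sandwich by metis
qed

lemma young_square: "conv n c c = cscale kappa c"
  using young_sandwich[of "basis_elt id"] unfolding conv_id_left young_factor_def .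

lemma cnj_young: "cnj (c x) = c x"
  by (simp add: young_symmetrizer_def if_distrib cong: if_cong)

lemma cnj_young_factor: "cnj kappa = kappa"
  unfolding young_factor_def conv_at_id by (simp add: cnj_young)

text \<open>Let a and b be the row and the signed column sum, c = a b, and h = a b a. Then h is
  self-adjoint and h h is the order of the row group times c c a, so c c = 0 would force h = 0. But
  h has at \<open>id\<close> the order of the row group as its value.\<close>

lemma young_factor_nonzero: "kappa \<noteq> 0"
proof
  assume k0: "kappa = 0"
  define h where "h = conv n a (conv n b a)"
  have cc: "conv n c c = 0" using young_square k0 by (simp add: fun_eq_iff cscale_apply)
  have "conv n h h = conv n (conv n a b) (conv n a (conv n a (conv n b a)))"
    unfolding h_def by (simp only: conv_assoc)
  also have "\<dots> = cscale (of_nat (card (row_group n lam))) (conv n (conv n c c) a)"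
    unfolding conv_row_row_assoc conv_scale_right young_symmetrizer_eq by (simp only: conv_assoc)
  also have "\<dots> = 0" by (simp add: cc)
  finally have hh: "conv n h h = 0" .
  have "star n h x = h x" if x: "x permutes {..<n}" for x
  proof -
    have "star n h x = conv n (star n (conv n b a)) a x"
      unfolding h_def star_conv[OF x] star_row_sum ..
    also have "\<dots> = conv n (conv n a b) a x"
      by (rule conv_cong[OF _ _ x]) (simp_all add: star_conv star_row_sum star_col_sum)
    finally show ?thesis by (simp add: h_def conv_assoc)
  qed
  then have "h = 0"
    using square_eq_0_imp_eq_0[OF _ _ hh] supp_conv[OF supp_conv[OF supp_row_sum]] by (auto simp: h_def)
  moreover have "h id = of_nat (card (row_group n lam))"
  proof -
    have "h id = conv n (conv n b a) a id"
      unfolding h_def by (rule conv_at_id_commute)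
    also have "\<dots> = conv n b (conv n a a) id" by (simp only: conv_assoc)
    also have "\<dots> = of_nat (card (row_group n lam)) * conv n b a id"
      by (simp add: conv_row_sum_row_sum conv_scale_right cscale_apply)
    also have "conv n b a id = 1"
      using young_symmetrizer_id[OF partition] conv_at_id_commute[of n a b] by (simp add: young_symmetrizer_eq)
    finally show ?thesis unfolding mult_1_right .
  qed
  ultimately show False
    using finite_row_group[of n lam] id_row_group[of n lam] by auto
qed

lemma young_idempotent_id: "e id = 1 / kappa"
  by (simp add: young_idempotent_def cscale_apply young_symmetrizer_id[OF partition])

lemma primitive_idempotent_young: "primitive_idempotent n e"
proof
  show "supp n e" using supp_young by (auto simp: supp_def young_idempotent_def cscale_apply)
  show "conv n e e = e"
    unfolding young_idempotent_def conv_scale_left conv_scale_right young_square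
    using young_factor_nonzero by (simp add: cscale_def)
  show "e \<noteq> 0"
  proof
    assume "e = 0"
    then have "e id = 0" by simp
    then show False using young_idempotent_id young_factor_nonzero by simp
  qed
  fix y
  have "conv n e (conv n y e) = cscale (1 / kappa) (cscale (1 / kappa) (conv n c (conv n y c)))"
    unfolding young_idempotent_def by (simp add: conv_scale_left conv_scale_right)
  also have "\<dots> = cscale (1 / kappa * conv n c (conv n y c) id) e"
    by (subst young_sandwich) (simp add: young_idempotent_def cscale_def mult_ac)
  finally show "\<exists>k. conv n e (conv n y e) = cscale k e" by blast
qed

interpretation primitive_idempotent n e by (rule primitive_idempotent_young)

lemma irrep_eq: "irrep n lam = left_ideal n e"
proof
  have e: "e = cscale (1 / kappa) c" by (simp add: young_idempotent_def)
  have c: "c = cscale kappa e" using young_factor_nonzero by (simp add: young_idempotent_def cscale_def)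
  have sub: "cfun.subspace (left_ideal n e)" using is_subrep_left_ideal by (simp add: is_subrep_def)
  have "left_mult g c \<in> left_ideal n e" if "g permutes {..<n}" for g
  proof -
    have "c \<in> left_ideal n e" unfolding c by (intro cfun.subspace_scale[OF sub] e_mem)
    then show ?thesis using conv_mem conv_basis_left[OF that] by metis
  qed
  then show "irrep n lam \<subseteq> left_ideal n e"
    unfolding irrep_def by (intro cfun.span_minimal sub) auto
  show "left_ideal n e \<subseteq> irrep n lam"
    unfolding left_ideal_def
  proof
    fix v assume "v \<in> range (\<lambda>f. conv n f e)"
    then obtain f where "v = (\<Sum>y | y permutes {..<n}. cscale (f y) (left_mult y e))"
      by (auto simp: conv_eq_sum)
    also have "\<dots> = (\<Sum>y | y permutes {..<n}. cscale (f y / kappa) (left_mult y c))"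
      by (simp add: e left_mult_def cscale_def)
    also have "\<dots> \<in> irrep n lam"
      unfolding irrep_def by (intro cfun.span_sum cfun.span_scale cfun.span_base) auto
    finally show "v \<in> irrep n lam" .
  qed
qed

lemma cnj_irr_char: "cnj (irr_char n lam g) = irr_char n lam g"
  by (simp add: irr_char_def character_def young_idempotent_def cscale_apply cnj_young cnj_young_factor)

text \<open>The symmetrizer is real, so inversion acts on it as \<open>star\<close> and turns a b
  into b a. By \<open>character_conv_commute\<close> the character does not notice the order of the
  factors.\<close>

lemma irr_char_inv:
  assumes g: "g permutes {..<n}"
  shows "irr_char n lam (inv g) = irr_char n lam g"
proof -
  have c_inv: "c (inv x) = conv n b a x" if x: "x permutes {..<n}" for x
  proof -
    have "c (inv x) = star n c x" using x cnj_young by (simp add: star_def)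
    also have "\<dots> = conv n b a x"
      unfolding young_symmetrizer_eq by (simp add: star_conv[OF x] star_row_sum star_col_sum)
    finally show ?thesis .
  qed
  have "irr_char n lam (inv g) = (\<Sum>x | x permutes {..<n}. 1 / kappa * conv n b a (inv x \<circ> g \<circ> x))"
    unfolding irr_char_def character_def young_idempotent_def cscale_apply
  proof (rule sum.cong[OF refl])
    fix x assume "x \<in> {x. x permutes {..<n}}"
    then have x: "x permutes {..<n}" by simp
    have xgx: "inv x \<circ> g \<circ> x permutes {..<n}" using g x by (intro permutes_compose permutes_inv)
    have "inv x \<circ> inv g \<circ> x = inv (inv x \<circ> g \<circ> x)"
      using g x by (simp add: permutes_inv_comp[OF permutes_compose[OF g permutes_inv[OF x]] x] permutes_inv_comp[OF permutes_inv[OF x] g] permutes_compose permutes_inv permutes_inv_comp permutes_inv_inv o_assoc)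
    then show "1 / kappa * c (inv x \<circ> inv g \<circ> x) = 1 / kappa * conv n b a (inv x \<circ> g \<circ> x)"
      using c_inv[OF xgx] by simp
  qed
  also have "\<dots> = 1 / kappa * character n (conv n b a) g"
    by (simp add: character_def sum_distrib_left)
  also have "character n (conv n b a) g = character n c g"
    unfolding young_symmetrizer_eq by (rule character_conv_commute[OF g])
  also have "1 / kappa * character n c g = irr_char n lam g"
    by (simp add: irr_char_def character_def sum_distrib_left young_idempotent_def cscale_apply)
  finally show ?thesis .
qed

lemma irr_char_conj:
  assumes "y permutes {..<n}"
  shows "irr_char n lam (inv y \<circ> g \<circ> y) = irr_char n lam g"
  unfolding irr_char_def using assms by (rule character_conj)

lemma young_idempotent_conv_basis:
  assumes x: "x permutes {..<n}"
  shows "conv n e (conv n (basis_elt x) e) = cscale (kappa * e (inv x)) e"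
proof -
  obtain k where k: "conv n e (conv n (basis_elt x) e) = cscale k e" using primitive by blast
  then have "k * e id = conv n (conv n e (basis_elt x)) e id"
    by (simp add: conv_assoc cscale_apply)
  also have "\<dots> = e (inv x)" by (simp add: convolution_at_id_shift[OF x] idem)
  finally have "k = kappa * e (inv x)"
    using young_factor_nonzero by (simp add: young_idempotent_id field_simps)
  then show ?thesis using k by simp
qed

text \<open>Replace one character by n! e and expand the other over its conjugators x. The inner sum
  is the value at \<open>id\<close> of e x e \<open>inv x\<close>, which by primitivity is kappa
  e(\<open>inv x\<close>) e(x). Summing over x gives kappa times the value of e e = e at
  \<open>id\<close>, that is 1.\<close>

lemma irr_char_norm:
  "(\<Sum>g | g permutes {..<n}. irr_char n lam g * irr_char n lam g) = fact n"
proof -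
  let ?S = "{g. g permutes {..<n}}"
  have "(\<Sum>g\<in>?S. irr_char n lam g * irr_char n lam g) = fact n * (\<Sum>g\<in>?S. e g * irr_char n lam g)"
    using sum_character_class_function[of n "irr_char n lam" e] irr_char_conj by (simp add: irr_char_def)
  also have "(\<Sum>g\<in>?S. e g * irr_char n lam g) = (\<Sum>g\<in>?S. e g * irr_char n lam (inv g))"
    by (rule sum.cong) (simp_all add: irr_char_inv)
  also have "\<dots> = (\<Sum>x\<in>?S. \<Sum>g\<in>?S. e g * e (inv x \<circ> inv g \<circ> x))"
    unfolding irr_char_def character_def sum_distrib_left by (rule sum.swap)
  also have "\<dots> = (\<Sum>x\<in>?S. kappa * (e (inv x) * e (inv (inv x))))"
  proof (rule sum.cong[OF refl])
    fix x assume "x \<in> ?S"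
    then have x: "x permutes {..<n}" by simp
    have "(\<Sum>g\<in>?S. e g * e (inv x \<circ> inv g \<circ> x)) =
        conv n e (conv n (basis_elt x) (conv n e (basis_elt (inv x)))) id"
      unfolding conv_at_id by (rule sum.cong) (simp_all add: conjugate_eq_conv[OF x] permutes_inv)
    also have "\<dots> = conv n (conv n e (conv n (basis_elt x) e)) (basis_elt (inv x)) id"
      by (simp only: conv_assoc)
    also have "\<dots> = kappa * e (inv x) * e x"
      using conv_basis_right[OF permutes_inv[OF x] permutes_id, of e]
      by (simp add: young_idempotent_conv_basis[OF x] conv_scale_left cscale_apply permutes_inv_inv[OF x])
    finally show "(\<Sum>g\<in>?S. e g * e (inv x \<circ> inv g \<circ> x)) = kappa * (e (inv x) * e (inv (inv x)))"
      by (simp add: permutes_inv_inv[OF x])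
  qed
  also have "\<dots> = kappa * (\<Sum>x\<in>?S. e x * e (inv x))"
    by (simp add: sum_distrib_left sum_perm_inverse[of "\<lambda>x. kappa * (e x * e (inv x))"])
  also have "(\<Sum>x\<in>?S. e x * e (inv x)) = e id"
    using idem by (simp flip: conv_at_id)
  also have "kappa * e id = 1"
    using young_factor_nonzero by (simp add: young_idempotent_id)
  finally show ?thesis by simp
qed

text \<open>The row sum acts on the irreducible representation with trace the order of the row group.\<close>

lemma irr_char_row_group:
  "(\<Sum>h\<in>row_group n lam. character n c h) = kappa * of_nat (card (row_group n lam))"
proof -
  let ?S = "{g. g permutes {..<n}}"
  have "(\<Sum>h\<in>row_group n lam. character n c h) = (\<Sum>h\<in>?S. a h * character n c h)"
    by (rule sum.mono_neutral_cong_left) (auto simp: row_sum_def row_group_perm)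
  also have "\<dots> = (\<Sum>h\<in>?S. a (inv h) * character n c (inv h))"
    by (rule sum_perm_inverse[symmetric])
  also have "\<dots> = (\<Sum>h\<in>?S. a h * character n c (inv h))"
  proof (rule sum.cong[OF refl])
    fix h assume "h \<in> ?S"
    then have h: "h permutes {..<n}" by simp
    have "a (inv h) = a h"
      using row_group_closed(1)[of h n lam] row_group_closed(1)[of "inv h" n lam] permutes_inv_inv[OF h]
      by (auto simp: row_sum_def)
    then show "a (inv h) * character n c (inv h) = a h * character n c (inv h)" by simp
  qed
  also have "\<dots> = (\<Sum>x\<in>?S. \<Sum>h\<in>?S. a h * c (inv x \<circ> inv h \<circ> x))"
    unfolding character_def sum_distrib_left by (rule sum.swap)
  also have "\<dots> = (\<Sum>x\<in>?S. conv n c a (inv x) * c (inv (inv x)))"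
  proof (rule sum.cong[OF refl])
    fix x assume "x \<in> ?S"
    then have x: "x permutes {..<n}" by simp
    have "(\<Sum>h\<in>?S. a h * c (inv x \<circ> inv h \<circ> x)) =
        conv n a (conv n (basis_elt x) (conv n c (basis_elt (inv x)))) id"
      unfolding conv_at_id by (rule sum.cong) (simp_all add: conjugate_eq_conv[OF x] permutes_inv)
    also have "\<dots> = conv n (conv n a (conv n (conv n (basis_elt x) a) b)) (basis_elt (inv x)) id"
      by (simp only: young_symmetrizer_eq conv_assoc)
    also have "\<dots> = conv n a (conv n (conv n (basis_elt x) a) b) id * c x"
      using conv_basis_right[OF permutes_inv[OF x] permutes_id, of c]
      by (subst row_sandwich) (simp add: conv_scale_left cscale_apply permutes_inv_inv[OF x])
    also have "conv n a (conv n (conv n (basis_elt x) a) b) = conv n (conv n a (basis_elt x)) c"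
      by (simp only: young_symmetrizer_eq conv_assoc)
    also have "conv n (conv n a (basis_elt x)) c id = conv n c a (inv x)"
      by (rule convolution_at_id_shift[OF x])
    finally show "(\<Sum>h\<in>?S. a h * c (inv x \<circ> inv h \<circ> x)) = conv n c a (inv x) * c (inv (inv x))"
      unfolding permutes_inv_inv[OF x] .
  qed
  also have "\<dots> = conv n (conv n c a) c id"
    unfolding conv_at_id by (rule sum_perm_inverse)
  also have "conv n (conv n c a) c = conv n (conv n a b) (conv n a (conv n a b))"
    by (simp only: young_symmetrizer_eq conv_assoc)
  also have "\<dots> = cscale (of_nat (card (row_group n lam))) (conv n c c)"
    unfolding conv_row_row_assoc conv_scale_right young_symmetrizer_eq ..
  also have "\<dots> id = kappa * of_nat (card (row_group n lam))"
    by (simp add: cscale_apply young_factor_def)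
  finally show ?thesis .
qed

end

theorem kronecker_eq_character_sum:
  assumes "partition_of n lam" "partition_of n mu" "partition_of n nu"
  shows "fact n * of_nat (kronecker n mu nu lam) =
    (\<Sum>g | g permutes {..<n}. irr_char n lam g * (irr_char n mu g * irr_char n nu g))"
proof -
  let ?S = "{g. g permutes {..<n}}"
  interpret m: primitive_idempotent n "young_idempotent n mu"
    by (rule primitive_idempotent_young[OF assms(2)])
  interpret n: primitive_idempotent n "young_idempotent n nu"
    by (rule primitive_idempotent_young[OF assms(3)])
  have "of_nat (kronecker n mu nu lam) =
      (\<Sum>g\<in>?S. young_idempotent n lam g * (irr_char n mu (inv g) * irr_char n nu (inv g)))"
    unfolding kronecker_def irrep_eq[OF assms(1)] irrep_eq[OF assms(2)] irrep_eq[OF assms(3)] irr_char_def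
    by (rule multiplicity_eq_character_sum[OF m.supp_e m.idem n.supp_e n.idem primitive_idempotent_young[OF assms(1)]])
  also have "\<dots> = (\<Sum>g\<in>?S. young_idempotent n lam g * (irr_char n mu g * irr_char n nu g))"
    by (rule sum.cong) (simp_all add: irr_char_inv assms(2,3))
  finally show ?thesis
    using sum_character_class_function[of n "\<lambda>g. irr_char n mu g * irr_char n nu g" "young_idempotent n lam"]
      irr_char_conj[OF assms(2)] irr_char_conj[OF assms(3)]
    by (simp add: irr_char_def[of n lam])
qed


subsection \<open>Permutation characters of Young subgroups\<close>

text \<open>Contents are integers, so that there are no labelings, and the character is \<open>0\<close>, if a content is negative.\<close>

definition labelings :: "nat \<Rightarrow> 'z set \<Rightarrow> ('z \<Rightarrow> int) \<Rightarrow> (nat \<Rightarrow> 'z) set" where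
  "labelings n Z t = {f \<in> {..<n} \<rightarrow>\<^sub>E Z. \<forall>z\<in>Z. int (card {m. m < n \<and> f m = z}) = t z}"

definition perm_char :: "nat \<Rightarrow> 'z set \<Rightarrow> ('z \<Rightarrow> int) \<Rightarrow> (nat \<Rightarrow> nat) \<Rightarrow> int" where
  "perm_char n Z t x = int (card {f \<in> labelings n Z t. f \<circ> x = f})"

lemma finite_labelings: "finite Z \<Longrightarrow> finite (labelings n Z t)"
  by (rule finite_subset[of _ "{..<n} \<rightarrow>\<^sub>E Z"]) (auto simp: labelings_def finite_PiE)

lemma perm_lt: "x permutes {..<n::nat} \<Longrightarrow> x m < n \<longleftrightarrow> m < n"
  using permutes_in_image[of x "{..<n}" m] by simp

lemma card_perm_vimage:
  assumes y: "y permutes {..<n::nat}"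
  shows "card {m. m < n \<and> P (y m)} = card {m. m < n \<and> P m}"
proof -
  have "bij_betw y {m. m < n \<and> P (y m)} {m. m < n \<and> P m}"
    by (rule bij_betw_byWitness[where f' = "inv y"])
      (auto simp: perm_lt[OF y] perm_lt[OF permutes_inv[OF y]] permutes_inverses[OF y])
  then show ?thesis by (rule bij_betw_same_card)
qed

lemma labelings_comp:
  assumes f: "f \<in> labelings n Z t" and y: "y permutes {..<n}"
  shows "f \<circ> y \<in> labelings n Z t"
  using f card_perm_vimage[OF y, of "\<lambda>m. f m = _"]
  by (auto simp: labelings_def PiE_iff extensional_def perm_lt[OF y])

lemma count_mset_eq_card_nth: "count (mset xs) z = card {i. i < length xs \<and> xs ! i = z}"
  unfolding count_mset count_list_eq_length_filter length_filter_conv_card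
  by (rule arg_cong[of _ _ card]) auto

lemma labelings_transitive:
  assumes f: "f \<in> labelings n Z t" and g: "g \<in> labelings n Z t"
  obtains y where "y permutes {..<n}" "f \<circ> y = g"
proof -
  have cnt: "count (mset (map h [0..<n])) z = card {m. m < n \<and> h m = z}" for h :: "nat \<Rightarrow> 'a" and z
    unfolding count_mset_eq_card_nth by (rule arg_cong[of _ _ card]) auto
  have "mset (map g [0..<n]) = mset (map f [0..<n])"
  proof (rule multiset_eqI)
    fix z
    show "count (mset (map g [0..<n])) z = count (mset (map f [0..<n])) z"
    proof (cases "z \<in> Z")
      case True
      then have "int (card {m. m < n \<and> f m = z}) = t z" "int (card {m. m < n \<and> g m = z}) = t z"
        using f g by (simp_all add: labelings_def)
      then show ?thesis unfolding cnt by simp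
    next
      case False
      then have "{m. m < n \<and> f m = z} = {}" "{m. m < n \<and> g m = z} = {}"
        using f g by (auto simp: labelings_def PiE_iff)
      then show ?thesis by (simp only: cnt)
    qed
  qed
  then obtain y where y: "y permutes {..<n}" "permute_list y (map f [0..<n]) = map g [0..<n]"
    by (metis diff_zero length_map length_upt mset_eq_permutation)
  have "f (y m) = g m" for m
  proof (cases "m < n")
    case True
    then have "permute_list y (map f [0..<n]) ! m = f (y m)"
      using y(1) by (simp add: permute_list_nth perm_lt)
    then show ?thesis using y(2) True by simp
  next
    case False
    then show ?thesis
      using f g y(1) by (simp add: labelings_def PiE_iff extensional_def permutes_def)
  qed
  then show thesis using that y(1) by (auto simp: fun_eq_iff)
qed

lemma labelings_nonempty:
  assumes Z: "finite Z" and t: "\<And>z. z \<in> Z \<Longrightarrow> 0 \<le> t z" and sum: "(\<Sum>z\<in>Z. t z) = int n"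
  shows "labelings n Z t \<noteq> {}"
proof -
  obtain xs where xs: "mset xs = (\<Sum>z\<in>Z. replicate_mset (nat (t z)) z)" using ex_mset by blast
  have "int (length xs) = int (size (\<Sum>z\<in>Z. replicate_mset (nat (t z)) z))"
    using xs by (metis size_mset)
  also have "\<dots> = int n" by (simp add: t sum)
  finally have len: "length xs = n" by simp
  have count: "count (mset xs) z = (if z \<in> Z then nat (t z) else 0)" for z
    unfolding xs count_sum by (simp add: Z)
  have "card {m. m < n \<and> xs ! m = z} = count (mset xs) z" for z
    unfolding count_mset_eq_card_nth len ..
  moreover have "set xs \<subseteq> Z"
    using count by (metis count_eq_zero_iff set_mset_mset subsetI)
  ultimately have "(\<lambda>m\<in>{..<n}. xs ! m) \<in> labelings n Z t"
    using count t len by (auto simp: labelings_def cong: conj_cong)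
  then show ?thesis by blast
qed

lemma perm_char_eq_sum:
  assumes "finite Z"
  shows "perm_char n Z t x = (\<Sum>f\<in>labelings n Z t. if f \<circ> x = f then 1 else 0)"
  using finite_labelings[OF assms, of n t] by (simp add: perm_char_def sum.If_cases Int_def)

lemma perm_char_conj:
  assumes y: "y permutes {..<n}"
  shows "perm_char n Z t (inv y \<circ> x \<circ> y) = perm_char n Z t x"
proof -
  have "bij_betw (\<lambda>f. f \<circ> y) {f \<in> labelings n Z t. f \<circ> x = f} {f \<in> labelings n Z t. f \<circ> (inv y \<circ> x \<circ> y) = f}"
  proof (rule bij_betw_byWitness[where f' = "\<lambda>f. f \<circ> inv y"])
    show "\<forall>f\<in>{f \<in> labelings n Z t. f \<circ> x = f}. f \<circ> y \<circ> inv y = f" "\<forall>f\<in>{f \<in> labelings n Z t. f \<circ> (inv y \<circ> x \<circ> y) = f}. f \<circ> inv y \<circ> y = f"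
      by (simp_all add: permutes_cancel[OF y])
    show "(\<lambda>f. f \<circ> y) ` {f \<in> labelings n Z t. f \<circ> x = f} \<subseteq> {f \<in> labelings n Z t. f \<circ> (inv y \<circ> x \<circ> y) = f}"
      by (auto simp: labelings_comp[OF _ y] o_assoc permutes_cancel[OF y])
    show "(\<lambda>f. f \<circ> inv y) ` {f \<in> labelings n Z t. f \<circ> (inv y \<circ> x \<circ> y) = f} \<subseteq> {f \<in> labelings n Z t. f \<circ> x = f}"
    proof (clarsimp simp: labelings_comp[OF _ permutes_inv[OF y]])
      fix f assume "f \<circ> (inv y \<circ> x \<circ> y) = f"
      then have "f \<circ> (inv y \<circ> x \<circ> y) \<circ> inv y = f \<circ> inv y" by simp
      then show "f \<circ> inv y \<circ> x = f \<circ> inv y" by (simp add: o_assoc permutes_cancel[OF y])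
    qed
  qed
  from bij_betw_same_card[OF this] show ?thesis unfolding perm_char_def by simp
qed

text \<open>The permutations carrying f to g form a coset of either stabilizer. The first form
  serves the count of fixed points, the second says that the cardinality is constant in g.\<close>

lemma card_transporter:
  assumes f: "f \<in> labelings n Z t" and g: "g \<in> labelings n Z t"
  shows "card {y. y permutes {..<n} \<and> f \<circ> y = g} = card {y. y permutes {..<n} \<and> g \<circ> y = g}"
    and "card {y. y permutes {..<n} \<and> f \<circ> y = g} = card {y. y permutes {..<n} \<and> f \<circ> y = f}"
proof -
  obtain y0 where y0: "y0 permutes {..<n}" "f \<circ> y0 = g" using labelings_transitive[OF f g] .
  have g0: "g \<circ> inv y0 = f" using y0 permutes_cancel(5)[OF y0(1)] by metis
  have comp: "f \<circ> (y0 \<circ> y) = g \<circ> y" "g \<circ> (inv y0 \<circ> y) = f \<circ> y" "f \<circ> (y \<circ> y0) = (f \<circ> y) \<circ> y0"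
    "f \<circ> (y \<circ> inv y0) = (f \<circ> y) \<circ> inv y0" for y
    using y0(2) g0 by (simp_all add: o_assoc)
  have "bij_betw (\<lambda>y. y0 \<circ> y) {y. y permutes {..<n} \<and> g \<circ> y = g} {y. y permutes {..<n} \<and> f \<circ> y = g}"
    by (rule bij_betw_byWitness[where f' = "\<lambda>y. inv y0 \<circ> y"])
      (simp_all add: image_subset_iff permutes_cancel[OF y0(1)] permutes_comp_iff[OF y0(1)] permutes_comp_iff[OF permutes_inv[OF y0(1)]] comp)
  then show "card {y. y permutes {..<n} \<and> f \<circ> y = g} = card {y. y permutes {..<n} \<and> g \<circ> y = g}"
    by (rule bij_betw_same_card[symmetric])
  have "bij_betw (\<lambda>y. y \<circ> y0) {y. y permutes {..<n} \<and> f \<circ> y = f} {y. y permutes {..<n} \<and> f \<circ> y = g}"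
    by (rule bij_betw_byWitness[where f' = "\<lambda>y. y \<circ> inv y0"])
      (simp_all add: image_subset_iff permutes_cancel[OF y0(1)] permutes_comp_iff[OF y0(1)] permutes_comp_iff[OF permutes_inv[OF y0(1)]] comp y0 g0)
  then show "card {y. y permutes {..<n} \<and> f \<circ> y = g} = card {y. y permutes {..<n} \<and> f \<circ> y = f}"
    by (rule bij_betw_same_card[symmetric])
qed

lemma sum_over_orbit:
  fixes F :: "_ \<Rightarrow> 'b::semiring_1"
  assumes Z: "finite Z" and f: "f \<in> labelings n Z t"
  shows "(\<Sum>y | y permutes {..<n}. F (f \<circ> y)) =
    (\<Sum>g\<in>labelings n Z t. of_nat (card {y. y permutes {..<n} \<and> f \<circ> y = g}) * F g)"
proof -
  have "(\<Sum>y | y permutes {..<n}. F (f \<circ> y)) =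
      (\<Sum>g\<in>labelings n Z t. \<Sum>y\<in>{y \<in> {y. y permutes {..<n}}. f \<circ> y = g}. F (f \<circ> y))"
    by (rule sum.group[symmetric]) (auto simp: finite_labelings[OF Z] labelings_comp[OF f])
  also have "\<dots> = (\<Sum>g\<in>labelings n Z t. of_nat (card {y. y permutes {..<n} \<and> f \<circ> y = g}) * F g)"
    by (rule sum.cong) simp_all
  finally show ?thesis .
qed

text \<open>Burnside's count for an action with a single orbit.\<close>

lemma sum_perm_char:
  assumes Z: "finite Z" and ne: "labelings n Z t \<noteq> {}"
  shows "(\<Sum>x | x permutes {..<n}. perm_char n Z t x) = fact n"
proof -
  obtain f where f: "f \<in> labelings n Z t" using ne by blast
  have "(\<Sum>x | x permutes {..<n}. perm_char n Z t x) =
      (\<Sum>g\<in>labelings n Z t. \<Sum>x | x permutes {..<n}. if g \<circ> x = g then 1 else 0)"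
    unfolding perm_char_eq_sum[OF Z] by (rule sum.swap)
  also have "\<dots> = (\<Sum>g\<in>labelings n Z t. int (card {y. y permutes {..<n} \<and> f \<circ> y = g}) * 1)"
    by (rule sum.cong) (simp_all add: card_transporter(1)[OF f] sum.If_cases Int_def)
  also have "\<dots> = (\<Sum>y | y permutes {..<n}. 1)"
    using sum_over_orbit[OF Z f, of "\<lambda>_. 1 :: int"] by simp
  also have "\<dots> = fact n" using card_permutations[of "{..<n}" n] by simp
  finally show ?thesis .
qed

text \<open>Permuting the contents merely renames the labels. This is the source of the antisymmetry
  of \<open>det_char\<close> in its vector.\<close>

lemma perm_char_relabel:
  assumes s: "s permutes Z" and x: "x permutes {..<n}"
  shows "perm_char n Z (\<lambda>z. t (s z)) x = perm_char n Z t x"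
proof -
  define ap where "ap p f = (\<lambda>m\<in>{..<n}. p (f m))" for p :: "'a \<Rightarrow> 'a" and f :: "nat \<Rightarrow> 'a"
  have memb: "ap p f \<in> labelings n Z u"
    if f: "f \<in> labelings n Z (\<lambda>z. u (p z))" and p: "p permutes Z" for f p u
    unfolding labelings_def
  proof (intro CollectI conjI ballI)
    show "ap p f \<in> {..<n} \<rightarrow>\<^sub>E Z"
      using f permutes_in_image[OF p] by (auto simp: ap_def labelings_def)
    fix z assume z: "z \<in> Z"
    have "p (f m) = z \<longleftrightarrow> f m = inv p z" for m
      using permutes_inverses[OF p] by metis
    then have "{m. m < n \<and> ap p f m = z} = {m. m < n \<and> f m = inv p z}"
      by (auto simp: ap_def)
    moreover have "inv p z \<in> Z" using z permutes_in_image[OF permutes_inv[OF p]] by simp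
    ultimately show "int (card {m. m < n \<and> ap p f m = z}) = u z"
      using f by (simp add: labelings_def permutes_inverses[OF p])
  qed
  have fixed: "ap p f \<circ> x = ap p f" if "f \<circ> x = f" for f p
  proof
    fix m
    have "f (x m) = f m" using fun_cong[OF that, of m] by simp
    then show "(ap p f \<circ> x) m = ap p f m" by (simp add: ap_def perm_lt[OF x])
  qed
  have cancel: "ap q (ap p f) = f" if "\<And>z. q (p z) = z" "f \<in> labelings n Z u" for p q f u
    using that by (auto simp: ap_def fun_eq_iff labelings_def PiE_iff extensional_def)
  have memb': "ap (inv s) f \<in> labelings n Z (\<lambda>z. t (s z))" if "f \<in> labelings n Z t" for f
    using that by (intro memb permutes_inv[OF s]) (simp add: permutes_inverses[OF s])
  have "bij_betw (ap s) {f \<in> labelings n Z (\<lambda>z. t (s z)). f \<circ> x = f} {f \<in> labelings n Z t. f \<circ> x = f}"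
  proof (rule bij_betw_byWitness[where f' = "ap (inv s)"])
    show "\<forall>f\<in>{f \<in> labelings n Z (\<lambda>z. t (s z)). f \<circ> x = f}. ap (inv s) (ap s f) = f"
      by (auto intro!: cancel simp: permutes_inverses[OF s])
    show "\<forall>f\<in>{f \<in> labelings n Z t. f \<circ> x = f}. ap s (ap (inv s) f) = f"
      by (auto intro!: cancel simp: permutes_inverses[OF s])
    show "ap s ` {f \<in> labelings n Z (\<lambda>z. t (s z)). f \<circ> x = f} \<subseteq> {f \<in> labelings n Z t. f \<circ> x = f}"
      using memb[OF _ s] fixed by blast
    show "ap (inv s) ` {f \<in> labelings n Z t. f \<circ> x = f} \<subseteq> {f \<in> labelings n Z (\<lambda>z. t (s z)). f \<circ> x = f}"
      using memb' fixed by blast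
  qed
  then show ?thesis unfolding perm_char_def by (simp add: bij_betw_same_card)
qed

section \<open>Contingency tables and products of permutation characters\<close>

definition tables :: "'a set \<Rightarrow> 'b set \<Rightarrow> ('a \<Rightarrow> int) \<Rightarrow> ('b \<Rightarrow> int) \<Rightarrow> ('a \<times> 'b \<Rightarrow> nat) set" where
  "tables A B a b = {T \<in> extensional (A \<times> B).
    (\<forall>i\<in>A. (\<Sum>j\<in>B. int (T (i, j))) = a i) \<and> (\<forall>j\<in>B. (\<Sum>i\<in>A. int (T (i, j))) = b j)}"

lemma finite_tables:
  assumes "finite A" "finite B"
  shows "finite (tables A B a b)"
proof (rule finite_subset)
  show "tables A B a b \<subseteq> (A \<times> B) \<rightarrow>\<^sub>E {..nat (\<Sum>i\<in>A. \<bar>a i\<bar>)}"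
  proof
    fix T assume T: "T \<in> tables A B a b"
    have "T (i, j) \<le> nat (\<Sum>i\<in>A. \<bar>a i\<bar>)" if ij: "i \<in> A" "j \<in> B" for i j
    proof -
      have "int (T (i, j)) \<le> (\<Sum>j\<in>B. int (T (i, j)))"
        using ij assms by (intro member_le_sum) auto
      also have "\<dots> = a i" using T ij by (simp add: tables_def)
      also have "\<dots> \<le> \<bar>a i\<bar>" by simp
      also have "\<dots> \<le> (\<Sum>i\<in>A. \<bar>a i\<bar>)"
        using ij assms by (intro member_le_sum) auto
      finally show ?thesis by simp
    qed
    then show "T \<in> (A \<times> B) \<rightarrow>\<^sub>E {..nat (\<Sum>i\<in>A. \<bar>a i\<bar>)}"
      using T by (auto simp: tables_def PiE_iff)
  qed
qed (use assms in \<open>simp add: finite_PiE\<close>)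

lemma card_fibres_pair:
  assumes "finite B" "\<And>m. m < n \<Longrightarrow> g m \<in> B"
  shows "(\<Sum>j\<in>B. int (card {m. m < (n::nat) \<and> f m = i \<and> g m = j})) = int (card {m. m < n \<and> f m = i})"
proof -
  have "(\<Sum>j\<in>B. \<Sum>m\<in>{m \<in> {m. m < n \<and> f m = i}. g m = j}. 1 :: int) = (\<Sum>m\<in>{m. m < n \<and> f m = i}. 1)"
    by (rule sum.group) (use assms in auto)
  then show ?thesis by (simp add: conj_assoc)
qed

lemma fixed_labelingI:
  assumes x: "x permutes {..<n::nat}" and "\<And>m. m < n \<Longrightarrow> h (x m) = h m" "h \<in> extensional {..<n}"
  shows "h \<circ> x = h"
proof
  fix m show "(h \<circ> x) m = h m"
    using assms(2,3) by (cases "m < n") (auto simp: extensional_def perm_lt[OF x])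
qed

text \<open>Two fixed labelings are the same as one fixed labeling by pairs of labels, and the
  contents of the pair labeling form a table with margins a and b.\<close>

lemma perm_char_mult:
  assumes A: "finite A" and B: "finite B" and x: "x permutes {..<n}"
  shows "perm_char n A a x * perm_char n B b x =
    (\<Sum>T\<in>tables A B a b. perm_char n (A \<times> B) (int \<circ> T) x)"
proof -
  define PA where "PA = {f \<in> labelings n A a. f \<circ> x = f}"
  define PB where "PB = {f \<in> labelings n B b. f \<circ> x = f}"
  define PT where "PT T = {f \<in> labelings n (A \<times> B) (int \<circ> T). f \<circ> x = f}" for T :: "'a \<times> 'b \<Rightarrow> nat"
  define content where "content h = (\<lambda>z\<in>A \<times> B. card {m. m < n \<and> h m = z})" for h :: "nat \<Rightarrow> 'a \<times> 'b"
  define pair where "pair f g = (\<lambda>m\<in>{..<n}. (f m, g m))" for f :: "nat \<Rightarrow> 'a" and g :: "nat \<Rightarrow> 'b"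
  have content_tables: "content h \<in> tables A B a b"
    if f: "(\<lambda>m\<in>{..<n}. fst (h m)) \<in> labelings n A a" and g: "(\<lambda>m\<in>{..<n}. snd (h m)) \<in> labelings n B b" for h
  proof -
    have h: "fst (h m) \<in> A" "snd (h m) \<in> B" if "m < n" for m
      using f g that by (auto simp: labelings_def PiE_iff)
    have "(\<Sum>j\<in>B. int (content h (i, j))) = a i" if "i \<in> A" for i
    proof -
      have "(\<Sum>j\<in>B. int (content h (i, j))) = (\<Sum>j\<in>B. int (card {m. m < n \<and> fst (h m) = i \<and> snd (h m) = j}))"
        using that by (intro sum.cong) (auto simp: content_def prod_eq_iff)
      also have "\<dots> = int (card {m. m < n \<and> fst (h m) = i})"
        using h by (intro card_fibres_pair B)
      also have "\<dots> = a i" using f that by (simp add: labelings_def cong: conj_cong)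
      finally show ?thesis .
    qed
    moreover have "(\<Sum>i\<in>A. int (content h (i, j))) = b j" if "j \<in> B" for j
    proof -
      have "(\<Sum>i\<in>A. int (content h (i, j))) = (\<Sum>i\<in>A. int (card {m. m < n \<and> snd (h m) = j \<and> fst (h m) = i}))"
        using that by (intro sum.cong) (auto simp: content_def prod_eq_iff conj_commute)
      also have "\<dots> = int (card {m. m < n \<and> snd (h m) = j})"
        using h by (intro card_fibres_pair A)
      also have "\<dots> = b j" using g that by (simp add: labelings_def cong: conj_cong)
      finally show ?thesis .
    qed
    ultimately show ?thesis by (simp add: tables_def content_def)
  qed
  have marginals: "(\<lambda>m\<in>{..<n}. fst (h m)) \<in> labelings n A a" "(\<lambda>m\<in>{..<n}. snd (h m)) \<in> labelings n B b"
    if h: "h \<in> labelings n (A \<times> B) (int \<circ> T)" and T: "T \<in> tables A B a b" for h T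
  proof -
    have hm: "fst (h m) \<in> A" "snd (h m) \<in> B" if "m < n" for m
      using h that by (auto simp: labelings_def PiE_iff mem_Times_iff)
    have Th: "int (T (i, j)) = int (card {m. m < n \<and> fst (h m) = i \<and> snd (h m) = j})" if "i \<in> A" "j \<in> B" for i j
      using h that by (simp add: labelings_def prod_eq_iff)
    have "int (card {m. m < n \<and> fst (h m) = i}) = a i" if "i \<in> A" for i
      using T that card_fibres_pair[OF B, of n "\<lambda>m. snd (h m)" "\<lambda>m. fst (h m)" i] hm
      by (simp add: tables_def Th)
    then show "(\<lambda>m\<in>{..<n}. fst (h m)) \<in> labelings n A a"
      using hm by (simp add: labelings_def cong: conj_cong)
    have "int (card {m. m < n \<and> snd (h m) = j}) = b j" if "j \<in> B" for j
    proof -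
      have "(\<Sum>i\<in>A. int (T (i, j))) = (\<Sum>i\<in>A. int (card {m. m < n \<and> snd (h m) = j \<and> fst (h m) = i}))"
        using that by (intro sum.cong) (auto simp: Th conj_commute)
      also have "\<dots> = int (card {m. m < n \<and> snd (h m) = j})"
        using hm by (intro card_fibres_pair A)
      finally show ?thesis using T that by (simp add: tables_def)
    qed
    then show "(\<lambda>m\<in>{..<n}. snd (h m)) \<in> labelings n B b"
      using hm by (simp add: labelings_def cong: conj_cong)
  qed
  have "bij_betw (\<lambda>(f, g). (content (pair f g), pair f g)) (PA \<times> PB) (SIGMA T:tables A B a b. PT T)"
  proof (rule bij_betw_byWitness[where f' = "\<lambda>(T, h). (\<lambda>m\<in>{..<n}. fst (h m), \<lambda>m\<in>{..<n}. snd (h m))"])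
    have unpair: "(\<lambda>m\<in>{..<n}. fst (pair f g m)) = f" "(\<lambda>m\<in>{..<n}. snd (pair f g m)) = g"
      if "f \<in> labelings n A a" "g \<in> labelings n B b" for f g
      using that by (auto simp: pair_def labelings_def PiE_iff extensional_def fun_eq_iff)
    show "\<forall>z\<in>PA \<times> PB. (case (case z of (f, g) \<Rightarrow> (content (pair f g), pair f g)) of
        (T, h) \<Rightarrow> (\<lambda>m\<in>{..<n}. fst (h m), \<lambda>m\<in>{..<n}. snd (h m))) = z"
      using unpair by (auto simp: PA_def PB_def)
    show "(\<lambda>(f, g). (content (pair f g), pair f g)) ` (PA \<times> PB) \<subseteq> (SIGMA T:tables A B a b. PT T)"
    proof (rule image_subsetI)
      fix z assume "z \<in> PA \<times> PB"
      then obtain f g where z: "z = (f, g)" and f: "f \<in> PA" and g: "g \<in> PB" by blast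
      have fl: "f \<in> labelings n A a" "g \<in> labelings n B b" using f g by (auto simp: PA_def PB_def)
      have "content (pair f g) \<in> tables A B a b"
        by (rule content_tables) (simp_all add: unpair fl)
      moreover have "pair f g \<in> labelings n (A \<times> B) (int \<circ> content (pair f g))"
        using fl by (auto simp: labelings_def content_def pair_def PiE_iff)
      moreover have "pair f g \<circ> x = pair f g"
      proof (rule fixed_labelingI[OF x])
        show "pair f g (x m) = pair f g m" if "m < n" for m
          using that f g by (simp add: fun_eq_iff pair_def PA_def PB_def perm_lt[OF x])
      qed (simp add: pair_def)
      ultimately show "(case z of (f, g) \<Rightarrow> (content (pair f g), pair f g)) \<in> (SIGMA T:tables A B a b. PT T)"
        by (simp add: z PT_def)
    qed
    show "\<forall>z\<in>(SIGMA T:tables A B a b. PT T). (case (case z of (T, h) \<Rightarrow>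
        (\<lambda>m\<in>{..<n}. fst (h m), \<lambda>m\<in>{..<n}. snd (h m))) of (f, g) \<Rightarrow> (content (pair f g), pair f g)) = z"
    proof (rule ballI)
      fix z assume "z \<in> (SIGMA T:tables A B a b. PT T)"
      then obtain T h where z: "z = (T, h)" and T: "T \<in> tables A B a b" and h: "h \<in> PT T" by blast
      have "pair (\<lambda>m\<in>{..<n}. fst (h m)) (\<lambda>m\<in>{..<n}. snd (h m)) = h"
        using h by (auto simp: pair_def PT_def labelings_def PiE_iff extensional_def fun_eq_iff)
      moreover have "content h = T"
        using h T by (auto simp: content_def PT_def labelings_def tables_def extensional_def fun_eq_iff)
      ultimately show "(case (case z of (T, h) \<Rightarrow>
        (\<lambda>m\<in>{..<n}. fst (h m), \<lambda>m\<in>{..<n}. snd (h m))) of (f, g) \<Rightarrow> (content (pair f g), pair f g)) = z"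
        by (simp add: z)
    qed
    show "(\<lambda>(T, h). (\<lambda>m\<in>{..<n}. fst (h m), \<lambda>m\<in>{..<n}. snd (h m))) ` (SIGMA T:tables A B a b. PT T) \<subseteq> PA \<times> PB"
    proof (rule image_subsetI)
      fix z assume "z \<in> (SIGMA T:tables A B a b. PT T)"
      then obtain T h where z: "z = (T, h)" and T: "T \<in> tables A B a b" and h: "h \<in> PT T" by blast
      have hx: "h (x m) = h m" for m using h by (simp add: PT_def fun_eq_iff)
      have "(\<lambda>m\<in>{..<n}. fst (h m)) \<circ> x = (\<lambda>m\<in>{..<n}. fst (h m))" "(\<lambda>m\<in>{..<n}. snd (h m)) \<circ> x = (\<lambda>m\<in>{..<n}. snd (h m))"
        by (auto simp: fun_eq_iff hx perm_lt[OF x])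
      then show "(case z of (T, h) \<Rightarrow> (\<lambda>m\<in>{..<n}. fst (h m), \<lambda>m\<in>{..<n}. snd (h m))) \<in> PA \<times> PB"
        using marginals[OF _ T, of h] h by (simp add: z PA_def PB_def PT_def)
    qed
  qed
  then have "card (PA \<times> PB) = card (SIGMA T:tables A B a b. PT T)" by (rule bij_betw_same_card)
  also have "\<dots> = (\<Sum>T\<in>tables A B a b. card (PT T))"
    by (rule card_SigmaI) (auto simp: finite_tables A B PT_def finite_labelings)
  finally have "int (card PA) * int (card PB) = (\<Sum>T\<in>tables A B a b. int (card (PT T)))"
    by (simp add: card_cartesian_product flip: of_nat_mult of_nat_sum)
  then show ?thesis by (simp add: perm_char_def PA_def PB_def PT_def)
qed

text \<open>Orbit counting: the orbits on pairs of labelings are the contingency tables.\<close>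

lemma perm_char_inner:
  assumes A: "finite A" and B: "finite B" and total: "(\<Sum>j\<in>B. b j) = int n"
  shows "(\<Sum>x | x permutes {..<n}. perm_char n A a x * perm_char n B b x) = fact n * int (card (tables A B a b))"
proof -
  have "(\<Sum>x | x permutes {..<n}. perm_char n A a x * perm_char n B b x) =
      (\<Sum>x | x permutes {..<n}. \<Sum>T\<in>tables A B a b. perm_char n (A \<times> B) (int \<circ> T) x)"
    by (rule sum.cong) (simp_all add: perm_char_mult[OF A B])
  also have "\<dots> = (\<Sum>T\<in>tables A B a b. \<Sum>x | x permutes {..<n}. perm_char n (A \<times> B) (int \<circ> T) x)"
    by (rule sum.swap)
  also have "\<dots> = (\<Sum>T\<in>tables A B a b. fact n)"
  proof (rule sum.cong[OF refl])
    fix T assume T: "T \<in> tables A B a b"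
    have "(\<Sum>z\<in>A \<times> B. (int \<circ> T) z) = (\<Sum>j\<in>B. \<Sum>i\<in>A. int (T (i, j)))"
      by (subst sum.swap) (simp add: sum.cartesian_product split_beta)
    also have "\<dots> = int n" using T total by (simp add: tables_def)
    finally have "labelings n (A \<times> B) (int \<circ> T) \<noteq> {}"
      using A B by (intro labelings_nonempty) auto
    then show "(\<Sum>x | x permutes {..<n}. perm_char n (A \<times> B) (int \<circ> T) x) = fact n"
      using A B by (intro sum_perm_char) auto
  qed
  finally show ?thesis by simp
qed


subsection \<open>Determinantal characters\<close>

text \<open>
  For \<open>b i = lam i - i\<close> this is the Jacobi--Trudi determinant, read as a combination of permutation
  characters.
\<close>

definition det_char :: "nat \<Rightarrow> nat \<Rightarrow> (nat \<Rightarrow> int) \<Rightarrow> (nat \<Rightarrow> nat) \<Rightarrow> int" where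
  "det_char n L b x = (\<Sum>w | w permutes {..<L}. sign w * perm_char n {..<L} (\<lambda>i. b i + int (w i)) x)"

text \<open>The exponent vectors of the monomials of the complete symmetric polynomial of degree k
  in L variables; there are none for negative k.\<close>

definition columns :: "nat \<Rightarrow> int \<Rightarrow> (nat \<Rightarrow> nat) set" where
  "columns L k = {c. (\<forall>i\<ge>L. c i = 0) \<and> (\<Sum>i<L. int (c i)) = k}"

text \<open>The exponent vector obtained by choosing the monomial \<open>T j\<close> in the factor j
  and the term w of the Vandermonde determinant in the inverse variables.\<close>

definition excess :: "'j set \<Rightarrow> ('j \<Rightarrow> nat \<Rightarrow> nat) \<Rightarrow> (nat \<Rightarrow> nat) \<Rightarrow> nat \<Rightarrow> int" where
  "excess J T w i = int (\<Sum>j\<in>J. T j i) - int (w i)"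

text \<open>
  Up to a shift of the exponents, \<open>alt_sum L J t G\<close> is the linear functional \<open>G\<close> applied to the
  coefficients of the product of the Vandermonde determinant in \<open>L\<close> variables with the complete
  symmetric polynomials \<open>h\<^bsub>t j\<^esub>\<close>.
\<close>

definition alt_sum :: "nat \<Rightarrow> 'j set \<Rightarrow> ('j \<Rightarrow> int) \<Rightarrow> ((nat \<Rightarrow> int) \<Rightarrow> int) \<Rightarrow> int" where
  "alt_sum L J t G = (\<Sum>T\<in>(\<Pi>\<^sub>E j\<in>J. columns L (t j)). \<Sum>w | w permutes {..<L}. sign w * G (excess J T w))"

text \<open>As an argument of \<open>alt_sum\<close> this extracts the coefficient at b.\<close>

definition agrees :: "nat \<Rightarrow> (nat \<Rightarrow> int) \<Rightarrow> (nat \<Rightarrow> int) \<Rightarrow> int" where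
  "agrees L b v = of_bool (\<forall>i<L. v i = b i)"

section \<open>Alternating coefficient functionals\<close>

lemma finite_columns: "finite (columns L k)"
proof (rule finite_subset)
  show "columns L k \<subseteq> {c. \<forall>i. (i \<in> {..<L} \<longrightarrow> c i \<in> {..nat k}) \<and> (i \<notin> {..<L} \<longrightarrow> c i = 0)}"
  proof
    fix c assume c: "c \<in> columns L k"
    have "c i \<le> nat k" if "i < L" for i
    proof -
      have "int (c i) \<le> (\<Sum>i<L. int (c i))" using that by (intro member_le_sum) auto
      then show ?thesis using c by (simp add: columns_def)
    qed
    then show "c \<in> {c. \<forall>i. (i \<in> {..<L} \<longrightarrow> c i \<in> {..nat k}) \<and> (i \<notin> {..<L} \<longrightarrow> c i = 0)}"
      using c by (auto simp: columns_def)
  qed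
  show "finite {c. \<forall>i. (i \<in> {..<L} \<longrightarrow> c i \<in> {..nat k}) \<and> (i \<notin> {..<L} \<longrightarrow> c i = (0::nat))}"
    by (rule finite_set_of_finite_funs) auto
qed

lemma card_tables_eq_columns:
  fixes J :: "'j set"
  assumes J: "finite J"
  shows "card (tables {..<L} J a t) =
    card {T \<in> (\<Pi>\<^sub>E j\<in>J. columns L (t j)). \<forall>i<L. int (\<Sum>j\<in>J. T j i) = a i}"
proof -
  have "bij_betw (\<lambda>U. \<lambda>j\<in>J. \<lambda>i. if i < L then U (i, j) else 0) (tables {..<L} J a t)
      {T \<in> (\<Pi>\<^sub>E j\<in>J. columns L (t j)). \<forall>i<L. int (\<Sum>j\<in>J. T j i) = a i}"
  proof (rule bij_betw_byWitness[where f' = "\<lambda>T. \<lambda>(i, j)\<in>{..<L} \<times> J. T j i"])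
    show "\<forall>U\<in>tables {..<L} J a t. (\<lambda>(i, j)\<in>{..<L} \<times> J. (\<lambda>j\<in>J. \<lambda>i. if i < L then U (i, j) else 0) j i) = U"
      by (auto simp: tables_def extensional_def fun_eq_iff)
    show "\<forall>T\<in>{T \<in> (\<Pi>\<^sub>E j\<in>J. columns L (t j)). \<forall>i<L. int (\<Sum>j\<in>J. T j i) = a i}.
        (\<lambda>j\<in>J. \<lambda>i. if i < L then (\<lambda>(i, j)\<in>{..<L} \<times> J. T j i) (i, j) else 0) = T"
    proof
      fix T assume T: "T \<in> {T \<in> (\<Pi>\<^sub>E j\<in>J. columns L (t j)). \<forall>i<L. int (\<Sum>j\<in>J. T j i) = a i}"
      show "(\<lambda>j\<in>J. \<lambda>i. if i < L then (\<lambda>(i, j)\<in>{..<L} \<times> J. T j i) (i, j) else 0) = T"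
      proof
        fix j
        show "(\<lambda>j\<in>J. \<lambda>i. if i < L then (\<lambda>(i, j)\<in>{..<L} \<times> J. T j i) (i, j) else 0) j = T j"
          using T by (cases "j \<in> J") (auto simp: columns_def PiE_iff extensional_def fun_eq_iff)
      qed
    qed
    show "(\<lambda>U. \<lambda>j\<in>J. \<lambda>i. if i < L then U (i, j) else 0) ` tables {..<L} J a t \<subseteq>
        {T \<in> (\<Pi>\<^sub>E j\<in>J. columns L (t j)). \<forall>i<L. int (\<Sum>j\<in>J. T j i) = a i}"
      by (auto simp: tables_def columns_def)
    show "(\<lambda>T. \<lambda>(i, j)\<in>{..<L} \<times> J. T j i) ` {T \<in> (\<Pi>\<^sub>E j\<in>J. columns L (t j)). \<forall>i<L. int (\<Sum>j\<in>J. T j i) = a i}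
        \<subseteq> tables {..<L} J a t"
      by (auto simp: tables_def columns_def PiE_iff)
  qed
  then show ?thesis by (rule bij_betw_same_card)
qed

lemma sum_perms_upto: "w permutes {..<L::nat} \<Longrightarrow> (\<Sum>i<L. int (w i)) = (\<Sum>i<L. int i)"
  using sum.permute[of w "{..<L}" int] by (simp add: o_def)

text \<open>Each term w of the determinant contributes a number of tables with row margins
  \<open>b i + int (w i)\<close>. Moving \<open>w i\<close> to the other side turns this into the
  condition that the excess equals b, so the signed sum is a coefficient: a Kostka number when b
  comes from a partition.\<close>

lemma det_char_inner:
  assumes J: "finite J" and total: "(\<Sum>j\<in>J. t j) = int n"
  shows "(\<Sum>x | x permutes {..<n}. det_char n L b x * perm_char n J t x) = fact n * alt_sum L J t (agrees L b)"
proof -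
  let ?S = "{x. x permutes {..<n}}" and ?W = "{w. w permutes {..<L}}" and ?T = "\<Pi>\<^sub>E j\<in>J. columns L (t j)"
  have fin: "finite ?T" using J finite_columns by (intro finite_PiE) auto
  have card: "int (card (tables {..<L} J (\<lambda>i. b i + int (w i)) t)) = (\<Sum>T\<in>?T. agrees L b (excess J T w))" for w
  proof -
    have "(\<Sum>T\<in>?T. agrees L b (excess J T w)) =
        (\<Sum>T\<in>?T. if \<forall>i<L. int (\<Sum>j\<in>J. T j i) = b i + int (w i) then 1 else 0)"
      by (rule sum.cong) (auto simp: agrees_def excess_def algebra_simps of_bool_def)
    also have "\<dots> = int (card {T \<in> ?T. \<forall>i<L. int (\<Sum>j\<in>J. T j i) = b i + int (w i)})"
      using fin by (simp add: sum.If_cases Int_def)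
    finally show ?thesis by (simp add: card_tables_eq_columns[OF J])
  qed
  have "(\<Sum>x\<in>?S. det_char n L b x * perm_char n J t x) =
      (\<Sum>w\<in>?W. \<Sum>x\<in>?S. sign w * (perm_char n {..<L} (\<lambda>i. b i + int (w i)) x * perm_char n J t x))"
    unfolding det_char_def sum_distrib_right by (subst sum.swap) (simp add: mult.assoc)
  also have "\<dots> = (\<Sum>w\<in>?W. sign w * (fact n * (\<Sum>T\<in>?T. agrees L b (excess J T w))))"
    by (simp add: perm_char_inner[OF _ J total] card flip: sum_distrib_left)
  also have "\<dots> = fact n * (\<Sum>w\<in>?W. \<Sum>T\<in>?T. sign w * agrees L b (excess J T w))"
    by (simp add: sum_distrib_left mult_ac)
  also have "\<dots> = fact n * alt_sum L J t (agrees L b)"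
    unfolding alt_sum_def by (subst sum.swap) simp
  finally show ?thesis .
qed

lemma excess_sum:
  assumes J: "finite J" and T: "T \<in> (\<Pi>\<^sub>E j\<in>J. columns L (t j))" and w: "w permutes {..<L}"
  shows "(\<Sum>i<L. excess J T w i + int i) = (\<Sum>j\<in>J. t j)"
proof -
  have "(\<Sum>i<L. int (\<Sum>j\<in>J. T j i)) = (\<Sum>j\<in>J. \<Sum>i<L. int (T j i))"
    by (simp add: sum.swap[of _ J])
  also have "\<dots> = (\<Sum>j\<in>J. t j)"
    using T by (intro sum.cong) (auto simp: columns_def PiE_iff)
  finally show ?thesis
    using sum_perms_upto[OF w] by (simp add: excess_def sum.distrib sum_subtractf)
qed

lemma excess_bounds:
  assumes J: "finite J" and T: "T \<in> (\<Pi>\<^sub>E j\<in>J. columns L (t j))" and w: "w permutes {..<L}" and i: "i < L"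
  shows "- int L < excess J T w i" "excess J T w i \<le> (\<Sum>j\<in>J. t j)"
proof -
  have "w i < L" using w i permutes_in_image[of w "{..<L}" i] by simp
  moreover have "0 \<le> (\<Sum>j\<in>J. int (T j i))" by (rule sum_nonneg) simp
  ultimately show "- int L < excess J T w i" by (simp add: excess_def)
  have "int (T j i) \<le> t j" if "j \<in> J" for j
  proof -
    have "int (T j i) \<le> (\<Sum>i<L. int (T j i))" using i by (intro member_le_sum) auto
    then show ?thesis using T that by (auto simp: columns_def PiE_iff)
  qed
  then have "int (\<Sum>j\<in>J. T j i) \<le> (\<Sum>j\<in>J. t j)" by (simp add: sum_mono)
  then show "excess J T w i \<le> (\<Sum>j\<in>J. t j)" by (simp add: excess_def)
qed

lemma alt_sum_cong:
  assumes "finite J"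
    and "\<And>v. (\<Sum>i<L. v i + int i) = (\<Sum>j\<in>J. t j) \<Longrightarrow> (\<And>i. i < L \<Longrightarrow> - int L < v i) \<Longrightarrow>
      (\<And>i. i < L \<Longrightarrow> v i \<le> (\<Sum>j\<in>J. t j)) \<Longrightarrow> G v = H v"
  shows "alt_sum L J t G = alt_sum L J t H"
  unfolding alt_sum_def
  by (intro sum.cong refl arg_cong[where f = "(*) _"] assms(2)) (use excess_sum excess_bounds assms(1) in auto)

lemma alt_sum_nonzero_witness:
  assumes J: "finite J" and "alt_sum L J t (agrees L b) \<noteq> 0"
  shows "(\<Sum>i<L. b i + int i) = (\<Sum>j\<in>J. t j)" "i < L \<Longrightarrow> - int L < b i"
proof -
  have "\<exists>T\<in>(\<Pi>\<^sub>E j\<in>J. columns L (t j)). \<exists>w\<in>{w. w permutes {..<L}}. agrees L b (excess J T w) \<noteq> 0"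
  proof (rule ccontr)
    assume "\<not> ?thesis"
    then have "alt_sum L J t (agrees L b) = 0" unfolding alt_sum_def by (intro sum.neutral ballI) auto
    with assms show False by simp
  qed
  then obtain T w where T: "T \<in> (\<Pi>\<^sub>E j\<in>J. columns L (t j))" and w: "w permutes {..<L}"
    and "agrees L b (excess J T w) \<noteq> 0" by auto
  then have eq: "excess J T w i = b i" if "i < L" for i using that by (auto simp: agrees_def)
  show "(\<Sum>i<L. b i + int i) = (\<Sum>j\<in>J. t j)"
    using excess_sum[OF J T w] eq by simp
  show "- int L < b i" if "i < L" using excess_bounds(1)[OF J T w that] eq[OF that] by simp
qed

lemma alt_sum_sum: "alt_sum L J t (\<lambda>v. \<Sum>i\<in>I. G i v) = (\<Sum>i\<in>I. alt_sum L J t (G i))"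
proof -
  have "alt_sum L J t (\<lambda>v. \<Sum>i\<in>I. G i v) =
      (\<Sum>T\<in>(\<Pi>\<^sub>E j\<in>J. columns L (t j)). \<Sum>i\<in>I. \<Sum>w | w permutes {..<L}. sign w * G i (excess J T w))"
    unfolding alt_sum_def by (simp add: sum_distrib_left sum.swap[of _ I])
  also have "\<dots> = (\<Sum>i\<in>I. alt_sum L J t (G i))"
    unfolding alt_sum_def by (rule sum.swap)
  finally show ?thesis .
qed

lemma alt_sum_diff: "alt_sum L J t (\<lambda>v. G v - H v) = alt_sum L J t G - alt_sum L J t H"
  unfolding alt_sum_def by (simp add: algebra_simps sum_subtractf)

lemma alt_sum_mult: "alt_sum L J t (\<lambda>v. k * G v) = k * alt_sum L J t G"
  unfolding alt_sum_def by (simp add: sum_distrib_left mult_ac)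

text \<open>Exchanging two variables fixes the complete symmetric polynomials and negates the
  Vandermonde determinant.\<close>

lemma alt_sum_swap:
  assumes ab: "a < L" "b < L" "a \<noteq> b"
  shows "alt_sum L J t (\<lambda>v. G (v \<circ> transpose a b)) = - alt_sum L J t G"
proof -
  let ?T = "\<Pi>\<^sub>E j\<in>J. columns L (t j)" and ?W = "{w. w permutes {..<L}}" and ?s = "transpose a b"
  have s: "?s permutes {..<L}" using ab by (intro permutes_swap_id) auto
  have ss: "?s (?s i) = i" for i by (simp add: transpose_involutory)
  define P where "P T = (\<lambda>j\<in>J. T j \<circ> ?s)" for T :: "'a \<Rightarrow> nat \<Rightarrow> nat"
  have P_mem: "P T \<in> ?T" if "T \<in> ?T" for T
  proof -
    have "T j \<circ> ?s \<in> columns L (t j)" if j: "j \<in> J" for j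
    proof -
      have "T j \<in> columns L (t j)" using \<open>T \<in> ?T\<close> j by auto
      moreover have "?s i = i" if "i \<ge> L" for i using s that by (simp add: permutes_def)
      moreover have "(\<Sum>i<L. int (T j (?s i))) = (\<Sum>i<L. int (T j i))"
        using sum.permute[OF s, of "\<lambda>i. int (T j i)"] by (simp add: o_def)
      ultimately show ?thesis by (simp add: columns_def)
    qed
    then show ?thesis by (simp add: P_def)
  qed
  have PP: "P (P T) = T" if "T \<in> ?T" for T
    using that by (auto simp: P_def fun_eq_iff ss PiE_iff extensional_def)
  have ex: "excess J T (w \<circ> ?s) \<circ> ?s = excess J (P T) w" for T w
    by (auto simp: excess_def P_def fun_eq_iff ss)
  have "alt_sum L J t (\<lambda>v. G (v \<circ> ?s)) =
      (\<Sum>T\<in>?T. \<Sum>w\<in>?W. sign (w \<circ> ?s) * G (excess J T (w \<circ> ?s) \<circ> ?s))"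
    unfolding alt_sum_def by (rule sum.cong[OF refl], rule sum_perm_compose_right[OF s, symmetric])
  also have "\<dots> = (\<Sum>T\<in>?T. \<Sum>w\<in>?W. - (sign w * G (excess J (P T) w)))"
    by (intro sum.cong refl) (use ab in \<open>simp add: ex sign_compose_perms[OF _ s] sign_swap_id\<close>)
  also have "\<dots> = - (\<Sum>T\<in>?T. \<Sum>w\<in>?W. sign w * G (excess J (P T) w))"
    by (simp add: sum_negf)
  also have "(\<Sum>T\<in>?T. \<Sum>w\<in>?W. sign w * G (excess J (P T) w)) = alt_sum L J t G"
    unfolding alt_sum_def
    by (rule sum.reindex_bij_witness[where i = P and j = P]) (use P_mem PP in auto)
  finally show ?thesis .
qed

lemma alt_sum_symmetric_eq_0:
  assumes "a < L" "b < L" "a \<noteq> b" "\<And>v. G (v \<circ> transpose a b) = G v"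
  shows "alt_sum L J t G = 0"
  using alt_sum_swap[OF assms(1-3), of J t G] assms(4) by simp

text \<open>Multiplication by \<open>h\<^sub>k\<close> replaces the extraction of one coefficient by a sum over smaller exponents.\<close>

lemma alt_sum_insert:
  assumes J: "finite J" "j0 \<notin> J" and deg: "(\<Sum>i<L. b i + int i) = (\<Sum>j\<in>insert j0 J. t j)"
  shows "alt_sum L (insert j0 J) t (agrees L b) = alt_sum L J t (\<lambda>v. of_bool (\<forall>i<L. v i \<le> b i))"
proof -
  let ?T = "\<Pi>\<^sub>E j\<in>J. columns L (t j)" and ?W = "{w. w permutes {..<L}}"
  have upd: "excess (insert j0 J) (T(j0 := c)) w = (\<lambda>i. int (c i) + excess J T w i)" for T c w
  proof
    fix i
    have "(\<Sum>j\<in>J. (T(j0 := c)) j i) = (\<Sum>j\<in>J. T j i)"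
      by (rule sum.cong) (use J(2) in auto)
    then show "excess (insert j0 J) (T(j0 := c)) w i = int (c i) + excess J T w i"
      using J by (simp add: excess_def)
  qed
  have one: "(\<Sum>c\<in>columns L (t j0). agrees L b (\<lambda>i. int (c i) + excess J T w i)) = of_bool (\<forall>i<L. excess J T w i \<le> b i)"
    if T: "T \<in> ?T" and w: "w permutes {..<L}" for T w
  proof (cases "\<forall>i<L. excess J T w i \<le> b i")
    case True
    \<comment> \<open>The only monomial that completes the exponent to b. Pointwise it exists by the
      upper bounds, and the degree hypothesis makes its degree \<open>t j0\<close>.\<close>
    define c0 where "c0 i = (if i < L then nat (b i - excess J T w i) else 0)" for i
    have c0: "int (c0 i) = b i - excess J T w i" if "i < L" for i
      using that True by (simp add: c0_def)
    have "(\<Sum>i<L. int (c0 i)) = (\<Sum>i<L. b i + int i) - (\<Sum>i<L. excess J T w i + int i)"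
      by (simp add: c0 sum.distrib sum_subtractf)
    also have "\<dots> = t j0" using deg J by (simp add: excess_sum[OF J(1) T w])
    finally have c0_mem: "c0 \<in> columns L (t j0)" by (simp add: columns_def c0_def)
    have "agrees L b (\<lambda>i. int (c i) + excess J T w i) = of_bool (c = c0)" if "c \<in> columns L (t j0)" for c
    proof -
      have "(\<forall>i<L. int (c i) + excess J T w i = b i) \<longleftrightarrow> (\<forall>i<L. c i = c0 i)"
        using c0 by (metis add_diff_cancel_right' diff_add_cancel of_nat_eq_iff)
      also have "\<dots> \<longleftrightarrow> c = c0"
        using that by (auto simp: fun_eq_iff columns_def c0_def)
      finally show ?thesis by (simp add: agrees_def)
    qed
    then have "(\<Sum>c\<in>columns L (t j0). agrees L b (\<lambda>i. int (c i) + excess J T w i)) =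
        (\<Sum>c\<in>columns L (t j0). if c = c0 then 1 else 0)"
      by (intro sum.cong) auto
    then show ?thesis using c0_mem True finite_columns by (simp add: sum.delta)
  next
    case False
    then have "agrees L b (\<lambda>i. int (c i) + excess J T w i) = 0" for c
      by (auto simp: agrees_def)
    then show ?thesis using False by auto
  qed
  have "alt_sum L (insert j0 J) t (agrees L b) =
      (\<Sum>(c, T)\<in>columns L (t j0) \<times> ?T. \<Sum>w\<in>?W. sign w * agrees L b (excess (insert j0 J) (T(j0 := c)) w))"
    unfolding alt_sum_def PiE_insert_eq
    by (subst sum.reindex[OF inj_combinator[OF J(2)]]) (simp add: split_beta)
  also have "\<dots> = (\<Sum>c\<in>columns L (t j0). \<Sum>T\<in>?T. \<Sum>w\<in>?W. sign w * agrees L b (\<lambda>i. int (c i) + excess J T w i))"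
    unfolding upd by (rule sum.cartesian_product[symmetric])
  also have "\<dots> = (\<Sum>T\<in>?T. \<Sum>c\<in>columns L (t j0). \<Sum>w\<in>?W. sign w * agrees L b (\<lambda>i. int (c i) + excess J T w i))"
    by (rule sum.swap)
  also have "\<dots> = (\<Sum>T\<in>?T. \<Sum>w\<in>?W. \<Sum>c\<in>columns L (t j0). sign w * agrees L b (\<lambda>i. int (c i) + excess J T w i))"
    by (intro sum.cong refl sum.swap)
  also have "\<dots> = (\<Sum>T\<in>?T. \<Sum>w\<in>?W. sign w * of_bool (\<forall>i<L. excess J T w i \<le> b i))"
    by (intro sum.cong refl) (use one in \<open>simp flip: sum_distrib_left\<close>)
  finally show ?thesis by (simp add: alt_sum_def)
qed


text \<open>
  Expand \<open>\<Prod>i. (1 - of_bool (v i \<le> b i))\<close>: for degree reasons it vanishes on all exponents that occur,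
  and factors missing at two positions are killed by antisymmetry.
\<close>

lemma alt_sum_bounded_eq_sum:
  assumes J: "finite J" and deg: "(\<Sum>j\<in>J. t j) < (\<Sum>i<L. b i + int i) + int L"
  shows "alt_sum L J t (\<lambda>v. of_bool (\<forall>i<L. v i \<le> b i)) =
    (\<Sum>i<L. alt_sum L J t (\<lambda>v. of_bool (\<forall>j<L. j \<noteq> i \<longrightarrow> v j \<le> b j)))"
proof -
  define q where "q X v = (\<Prod>i\<in>X. - of_bool (v i \<le> b i) :: int)" for X :: "nat set" and v
  have "alt_sum L J t (\<lambda>v. \<Sum>X\<in>Pow {..<L}. q X v) = alt_sum L J t (\<lambda>v. 0)"
  proof (rule alt_sum_cong[OF J])
    fix v assume v: "(\<Sum>i<L. v i + int i) = (\<Sum>j\<in>J. t j)"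
    \<comment> \<open>If every v i exceeded b i, each of the L places would add at least 1, and the
      degree would be at least that of b plus L.\<close>
    have "\<exists>i<L. v i \<le> b i"
    proof (rule ccontr)
      assume "\<not> (\<exists>i<L. v i \<le> b i)"
      then have "(\<Sum>i<L. b i + int i + 1) \<le> (\<Sum>i<L. v i + int i)"
        by (intro sum_mono) force
      then show False using v deg by (simp add: sum.distrib)
    qed
    then have "(\<Prod>i<L. - of_bool (v i \<le> b i) + (1 :: int)) = 0"
      by (intro prod_zero) auto
    moreover have "(\<Sum>X\<in>Pow {..<L}. q X v) = (\<Prod>i<L. - of_bool (v i \<le> b i) + 1)"
      unfolding q_def by (subst prod_add) simp_all
    ultimately show "(\<Sum>X\<in>Pow {..<L}. q X v) = 0" by simp
  qed
  also have "\<dots> = 0" by (simp add: alt_sum_def)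
  finally have zero: "(\<Sum>X\<in>Pow {..<L}. alt_sum L J t (q X)) = 0"
    by (simp add: alt_sum_sum)
  define co where "co i = {..<L} - {i}" for i
  have two: "alt_sum L J t (q X) = 0"
    if X: "X \<in> Pow {..<L} - ({{..<L}} \<union> co ` {..<L})" for X
  proof -
    obtain a where a: "a < L" "a \<notin> X" using X by blast
    have "X \<noteq> co a" using X a by auto
    then obtain c where c: "c < L" "c \<notin> X" "c \<noteq> a" using X a by (auto simp: co_def)
    show ?thesis
    proof (rule alt_sum_symmetric_eq_0[OF a(1) c(1)])
      fix v :: "nat \<Rightarrow> int"
      have "transpose a c i = i" if "i \<in> X" for i using that a c by (auto simp: transpose_def)
      then show "q X (v \<circ> transpose a c) = q X v" by (simp add: q_def)
    qed (use c in simp)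
  qed
  have inj: "inj_on co {..<L}" by (auto simp: inj_on_def co_def)
  have "(\<Sum>X\<in>Pow {..<L}. alt_sum L J t (q X)) = (\<Sum>X\<in>{{..<L}} \<union> co ` {..<L}. alt_sum L J t (q X))"
    by (rule sum.mono_neutral_right) (use two in \<open>auto simp: co_def\<close>)
  also have "\<dots> = alt_sum L J t (q {..<L}) + (\<Sum>i<L. alt_sum L J t (q (co i)))"
  proof -
    have "{..<L} \<notin> co ` {..<L}" by (auto simp: co_def)
    then show ?thesis by (simp add: sum.reindex[OF inj])
  qed
  finally have split: "alt_sum L J t (q {..<L}) + (\<Sum>i<L. alt_sum L J t (q (co i))) = 0"
    using zero by simp
  have q_eq: "q X v = (-1) ^ card X * of_bool (\<forall>i\<in>X. v i \<le> b i)" if "finite X" for X v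
    using that by (induction X) (auto simp: q_def)
  have "alt_sum L J t (q {..<L}) = (-1) ^ L * alt_sum L J t (\<lambda>v. of_bool (\<forall>i<L. v i \<le> b i))"
  proof -
    have "q {..<L} = (\<lambda>v. (-1) ^ L * of_bool (\<forall>i<L. v i \<le> b i))"
      by (simp add: fun_eq_iff q_eq Ball_def)
    then show ?thesis by (simp add: alt_sum_mult)
  qed
  moreover have "alt_sum L J t (q (co i)) = (-1) ^ (L - 1) * alt_sum L J t (\<lambda>v. of_bool (\<forall>j<L. j \<noteq> i \<longrightarrow> v j \<le> b j))"
    if "i < L" for i
  proof -
    have "card (co i) = L - 1" using that by (simp add: co_def)
    moreover have "(\<forall>j\<in>co i. v j \<le> b j) \<longleftrightarrow> (\<forall>j<L. j \<noteq> i \<longrightarrow> v j \<le> b j)" for v by (auto simp: co_def)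
    ultimately have "q (co i) = (\<lambda>v. (-1) ^ (L - 1) * of_bool (\<forall>j<L. j \<noteq> i \<longrightarrow> v j \<le> b j))"
      by (auto simp: fun_eq_iff q_eq co_def)
    then show ?thesis by (simp add: alt_sum_mult)
  qed
  ultimately have eq: "(-1) ^ L * alt_sum L J t (\<lambda>v. of_bool (\<forall>i<L. v i \<le> b i)) +
      (-1) ^ (L - 1) * (\<Sum>i<L. alt_sum L J t (\<lambda>v. of_bool (\<forall>j<L. j \<noteq> i \<longrightarrow> v j \<le> b j))) = 0"
    using split by (simp add: sum_distrib_left)
  show ?thesis
  proof (cases L)
    case 0
    then show ?thesis using eq by simp
  next
    case (Suc l)
    then have "(-1) ^ l * (- alt_sum L J t (\<lambda>v. of_bool (\<forall>i<L. v i \<le> b i)) +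
      (\<Sum>i<L. alt_sum L J t (\<lambda>v. of_bool (\<forall>j<L. j \<noteq> i \<longrightarrow> v j \<le> b j)))) = 0"
      using eq by (simp add: algebra_simps)
    then show ?thesis by simp
  qed
qed

section \<open>Pieri's rule and triangularity\<close>

definition strict_dec :: "nat \<Rightarrow> (nat \<Rightarrow> int) \<Rightarrow> bool" where
  "strict_dec L b \<longleftrightarrow> (\<forall>i. Suc i < L \<longrightarrow> b (Suc i) < b i)"

text \<open>For partitions shifted by subtracting i from the i-th part, this is the condition that
  the skew shape between v and b is a horizontal strip; the strict inequality on the left is the
  effect of the shift.\<close>

definition interlaces :: "nat \<Rightarrow> (nat \<Rightarrow> int) \<Rightarrow> (nat \<Rightarrow> int) \<Rightarrow> bool" where
  "interlaces L v b \<longleftrightarrow> (\<forall>i<L. v i \<le> b i) \<and> (\<forall>i. Suc i < L \<longrightarrow> b (Suc i) < v i)"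

text \<open>The exponents that violate a lower bound cancel in pairs under an adjacent transposition.\<close>

lemma alt_sum_pieri:
  assumes b: "strict_dec L b"
  shows "alt_sum L J t (\<lambda>v. of_bool (\<forall>i<L. v i \<le> b i)) = alt_sum L J t (\<lambda>v. of_bool (interlaces L v b))"
proof -
  define g where "g k v = (of_bool ((\<forall>i<L. v i \<le> b i) \<and> (\<forall>i<k. Suc i < L \<longrightarrow> b (Suc i) < v i)) :: int)" for k v
  have "alt_sum L J t (g k) = alt_sum L J t (g 0)" for k
  proof (induction k)
    case (Suc k)
    have "alt_sum L J t (g (Suc k)) = alt_sum L J t (g k)"
    proof (cases "Suc k < L")
      case False
      then have "g (Suc k) = g k" by (auto simp: g_def fun_eq_iff less_Suc_eq)
      then show ?thesis by simp
    next
      case True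
      define d where "d v = (of_bool ((\<forall>i<L. v i \<le> b i) \<and> (\<forall>i<k. Suc i < L \<longrightarrow> b (Suc i) < v i) \<and> v k \<le> b (Suc k)) :: int)" for v
      have "g (Suc k) v = g k v - d v" for v
        using True by (auto simp: g_def d_def less_Suc_eq)
      then have "alt_sum L J t (g (Suc k)) = alt_sum L J t (\<lambda>v. g k v - d v)" by presburger
      also have "\<dots> = alt_sum L J t (g k) - alt_sum L J t d" by (rule alt_sum_diff)
      also have "alt_sum L J t d = 0"
      proof (rule alt_sum_symmetric_eq_0)
        fix v :: "nat \<Rightarrow> int"
        have bk: "b (Suc k) < b k" using b True by (simp add: strict_dec_def)
        \<comment> \<open>When the lower bound at k fails, v k is at most \<open>b (Suc k)\<close>,
          which is less than \<open>b k\<close>. The upper bounds at k and \<open>Suc k\<close> thus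
          become one common bound, symmetric under exchanging the two positions; the lower bounds
          kept so far do not involve these positions.\<close>
        define P where "P v \<longleftrightarrow> (\<forall>i<L. i \<noteq> k \<longrightarrow> i \<noteq> Suc k \<longrightarrow> v i \<le> b i) \<and> v k \<le> b (Suc k) \<and> v (Suc k) \<le> b (Suc k)
          \<and> (\<forall>i<k. Suc i < L \<longrightarrow> b (Suc i) < v i)" for v :: "nat \<Rightarrow> int"
        have dP: "d v = of_bool (P v)" for v
        proof -
          have "(\<forall>i<L. v i \<le> b i) \<and> v k \<le> b (Suc k) \<longleftrightarrow>
              (\<forall>i<L. i \<noteq> k \<longrightarrow> i \<noteq> Suc k \<longrightarrow> v i \<le> b i) \<and> v k \<le> b (Suc k) \<and> v (Suc k) \<le> b (Suc k)"
            using True bk by (metis Suc_lessD dual_order.trans order_less_imp_le)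
          then show ?thesis unfolding d_def P_def by (intro arg_cong[of _ _ of_bool]) blast
        qed
        have "P (v \<circ> transpose k (Suc k)) \<longleftrightarrow> P v" by (auto simp: P_def transpose_def)
        then show "d (v \<circ> transpose k (Suc k)) = d v" by (simp add: dP)
      qed (use True in auto)
      finally show ?thesis by simp
    qed
    then show ?case using Suc.IH by simp
  qed simp
  from this[of L] have "alt_sum L J t (g L) = alt_sum L J t (g 0)" .
  moreover have "g L = (\<lambda>v. of_bool (interlaces L v b))"
    by (auto simp: g_def interlaces_def fun_eq_iff)
  moreover have "g 0 = (\<lambda>v. of_bool (\<forall>i<L. v i \<le> b i))"
    by (auto simp: g_def fun_eq_iff)
  ultimately show ?thesis by simp
qed

text \<open>Grouping the terms by exponent writes \<open>alt_sum L J t G\<close> as the sum over v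
  of G v times the coefficient at v, so some v has both factors nonzero.\<close>

lemma alt_sum_coefficient:
  assumes J: "finite J" and "alt_sum L J t G \<noteq> 0"
  obtains v where "G v \<noteq> 0" "alt_sum L J t (agrees L v) \<noteq> 0"
proof (rule ccontr)
  assume "\<not> thesis"
  then have none: "G v = 0 \<or> alt_sum L J t (agrees L v) = 0" for v using that by blast
  let ?D = "(\<Pi>\<^sub>E j\<in>J. columns L (t j)) \<times> {w. w permutes {..<L}}"
  define ex where "ex z = excess J (fst z) (snd z)" for z :: "('a \<Rightarrow> nat \<Rightarrow> nat) \<times> (nat \<Rightarrow> nat)"
  have fin: "finite ?D" using J finite_columns by (intro finite_cartesian_product finite_PiE) auto
  \<comment> \<open>Beyond L all exponent functions coincide, so agreement below L is equality of
    functions and the terms can be grouped by the function itself.\<close>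
  have outside: "ex z i = - int i" if "z \<in> ?D" "\<not> i < L" for z i
    using that by (auto simp: ex_def excess_def columns_def PiE_iff permutes_def)
  have agr: "agrees L v (ex z) = of_bool (ex z = v)" if "v \<in> ex ` ?D" "z \<in> ?D" for v z
  proof -
    obtain z' where z': "z' \<in> ?D" "v = ex z'" using \<open>v \<in> ex ` ?D\<close> by (rule imageE) simp
    have "ex z i = v i" if "\<not> i < L" for i
      unfolding z'(2) outside[OF \<open>z \<in> ?D\<close> that] outside[OF z'(1) that] ..
    then have "(\<forall>i<L. ex z i = v i) \<longleftrightarrow> ex z = v" by (metis ext)
    then show ?thesis by (simp add: agrees_def)
  qed
  have "alt_sum L J t G = (\<Sum>z\<in>?D. sign (snd z) * G (ex z))"
    unfolding alt_sum_def sum.cartesian_product by (simp add: split_beta ex_def)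
  also have "\<dots> = (\<Sum>v\<in>ex ` ?D. \<Sum>z\<in>{z \<in> ?D. ex z = v}. sign (snd z) * G (ex z))"
    by (rule sum.group[symmetric]) (use fin in auto)
  also have "\<dots> = (\<Sum>v\<in>ex ` ?D. G v * alt_sum L J t (agrees L v))"
  proof (rule sum.cong[OF refl])
    fix v assume v: "v \<in> ex ` ?D"
    have "alt_sum L J t (agrees L v) = (\<Sum>z\<in>?D. sign (snd z) * agrees L v (ex z))"
      unfolding alt_sum_def sum.cartesian_product by (simp add: split_beta ex_def)
    also have "\<dots> = (\<Sum>z\<in>?D. if ex z = v then sign (snd z) else 0)"
      using v by (intro sum.cong refl) (simp add: agr)
    also have "\<dots> = (\<Sum>z\<in>{z \<in> ?D. ex z = v}. sign (snd z))"
      using fin by (simp add: sum.inter_filter)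
    finally show "(\<Sum>z\<in>{z \<in> ?D. ex z = v}. sign (snd z) * G (ex z)) = G v * alt_sum L J t (agrees L v)"
      by (simp add: sum_distrib_left mult.commute)
  qed
  also have "\<dots> = 0" using none by (intro sum.neutral) auto
  finally show False using assms by simp
qed

lemma strict_dec_lower_bound:
  assumes b: "strict_dec L b" and low: "\<And>i. i < L \<Longrightarrow> - int L < b i" and i: "i < L"
  shows "- int i \<le> b i"
proof -
  have "- int i \<le> b i" if "i + d + 1 = L" for d i
    using that
  proof (induction d arbitrary: i)
    case 0
    then show ?case using low[of i] by simp
  next
    case (Suc d)
    have "b (Suc i) < b i" using b Suc.prems by (simp add: strict_dec_def)
    moreover have "- int (Suc i) \<le> b (Suc i)" using Suc.IH[of "Suc i"] Suc.prems by simp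
    ultimately show ?case by simp
  qed
  from this[of i "L - i - 1"] i show ?thesis by simp
qed

text \<open>Triangularity of the inverse Kostka matrix, by iterated Pieri.\<close>

lemma alt_sum_dominance:
  assumes "s \<le> L" "strict_dec L b" "alt_sum L {..<s} t (agrees L b) \<noteq> 0"
  shows "(\<forall>i<L. s \<le> i \<longrightarrow> b i = - int i) \<and> (\<forall>r\<le>s. (\<Sum>i<r. t i) \<le> (\<Sum>i<r. b i + int i))"
  using assms
proof (induction s arbitrary: b)
  case 0
  have low: "- int i \<le> b i" if "i < L" for i
    using strict_dec_lower_bound[OF 0(2) alt_sum_nonzero_witness(2)[OF _ 0(3)] that] by simp
  have "(\<Sum>i<L. b i + int i) = 0"
    using alt_sum_nonzero_witness(1)[OF _ 0(3)] by simp
  then have "\<forall>i\<in>{..<L}. b i + int i = 0"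
    using low by (subst (asm) sum_nonneg_eq_0_iff) (force+)
  then show ?case by (auto simp: eq_neg_iff_add_eq_0)
next
  case (Suc s)
  have fin: "finite {..<Suc s}" "finite {..<s}" by auto
  have low: "- int i \<le> b i" if "i < L" for i
    using strict_dec_lower_bound[OF Suc.prems(2) alt_sum_nonzero_witness(2)[OF fin(1) Suc.prems(3)] that] by simp
  have deg: "(\<Sum>i<L. b i + int i) = (\<Sum>j<Suc s. t j)"
    by (rule alt_sum_nonzero_witness(1)[OF fin(1) Suc.prems(3)])
  have "alt_sum L {..<Suc s} t (agrees L b) = alt_sum L {..<s} t (\<lambda>v. of_bool (interlaces L v b))"
    using alt_sum_insert[of "{..<s}" s b L t] deg alt_sum_pieri[OF Suc.prems(2)] by (simp add: lessThan_Suc)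
  then obtain v where v: "interlaces L v b" "alt_sum L {..<s} t (agrees L v) \<noteq> 0"
    using alt_sum_coefficient[OF fin(2), of L t "\<lambda>v. of_bool (interlaces L v b)"] Suc.prems(3) by auto
  have "strict_dec L v"
    using v(1) by (force simp: strict_dec_def interlaces_def)
  then have IH: "\<forall>i<L. s \<le> i \<longrightarrow> v i = - int i" "\<forall>r\<le>s. (\<Sum>i<r. t i) \<le> (\<Sum>i<r. v i + int i)"
    using Suc.IH[of v] v(2) Suc.prems(1) by auto
  have tail: "b i = - int i" if i: "i < L" "Suc s \<le> i" for i
  proof -
    obtain k where k: "i = Suc k" using i by (cases i) auto
    \<comment> \<open>With v k = -k and i = k + 1 this strict inequality gives b i <= -i; the
      opposite inequality is \<open>low\<close>.\<close>
    have "b i < v k" using v(1) i k by (simp add: interlaces_def)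
    then show ?thesis using IH(1) i k low[of i] by simp
  qed
  have "(\<Sum>i<r. t i) \<le> (\<Sum>i<r. b i + int i)" if r: "r \<le> Suc s" for r
  proof (cases "r \<le> s")
    case True
    have "(\<Sum>i<r. v i + int i) \<le> (\<Sum>i<r. b i + int i)"
      using v(1) True Suc.prems(1) by (intro sum_mono) (auto simp: interlaces_def)
    then show ?thesis using IH(2) True by force
  next
    case False
    then have "r = Suc s" using r by simp
    moreover have "(\<Sum>i<L. b i + int i) = (\<Sum>i<Suc s. b i + int i)"
      using Suc.prems(1) tail by (intro sum.mono_neutral_right) auto
    ultimately show ?thesis using deg by simp
  qed
  then show ?case using tail by auto
qed

text \<open>The diagonal Kostka number is 1. Pieri's rule removes the last factor; among the
  interlacing v, \<open>alt_sum_dominance\<close> forces the entries from s on to be trivial, so a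
  contributing v lies below the truncated vector. Having the same degree, it equals it.\<close>

lemma alt_sum_diagonal:
  assumes lam: "antimono lam"
  shows "s \<le> L \<Longrightarrow> alt_sum L {..<s} (\<lambda>i. int (lam i)) (agrees L (\<lambda>i. (if i < s then int (lam i) else 0) - int i)) = 1"
proof (induction s)
  case 0
  have "(\<Sum>w | w permutes {..<L}. sign w * agrees L (\<lambda>i. - int i) (\<lambda>i. - int (w i))) =
      (\<Sum>w\<in>{id}. sign w * agrees L (\<lambda>i. - int i) (\<lambda>i. - int (w i)))"
  proof (rule sum.mono_neutral_right)
    show "\<forall>w\<in>{w. w permutes {..<L}} - {id}. sign w * agrees L (\<lambda>i. - int i) (\<lambda>i. - int (w i)) = 0"
    proof
      fix w assume w: "w \<in> {w. w permutes {..<L}} - {id}"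
      then obtain i where i: "w i \<noteq> i" by (auto simp: fun_eq_iff)
      with w have "i < L" by (auto simp: permutes_def)
      with i show "sign w * agrees L (\<lambda>i. - int i) (\<lambda>i. - int (w i)) = 0" by (auto simp: agrees_def)
    qed
  qed (auto simp: permutes_id)
  then show ?case by (simp add: alt_sum_def excess_def agrees_def)
next
  case (Suc s)
  define b where "b r i = (if i < r then int (lam i) else 0) - int i" for r i
  define G where "G v = of_bool (interlaces L v (b (Suc s))) - agrees L (b s) v" for v
  have lam_Suc: "lam (Suc i) \<le> lam i" for i using lam by (simp add: antimonoD)
  have sd: "strict_dec L (b r)" for r
    unfolding strict_dec_def
  proof (intro allI impI)
    show "b r (Suc i) < b r i" for i using lam_Suc[of i] by (simp add: b_def)
  qed
  have sum_b: "(\<Sum>i<L. b r i + int i) = (\<Sum>i<r. int (lam i))" if "r \<le> L" for r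
  proof -
    have "(\<Sum>i<L. b r i + int i) = (\<Sum>i<r. b r i + int i)"
      using that by (intro sum.mono_neutral_right) (auto simp: b_def)
    then show ?thesis by (simp add: b_def)
  qed
  have "alt_sum L {..<Suc s} (\<lambda>i. int (lam i)) (agrees L (b (Suc s))) =
      alt_sum L {..<s} (\<lambda>i. int (lam i)) (\<lambda>v. of_bool (interlaces L v (b (Suc s))))"
    using alt_sum_insert[of "{..<s}" s "b (Suc s)" L "\<lambda>i. int (lam i)"] sum_b[OF Suc.prems] alt_sum_pieri[OF sd]
    by (simp add: lessThan_Suc)
  moreover have "alt_sum L {..<s} (\<lambda>i. int (lam i)) G = 0"
  proof (rule ccontr)
    assume "alt_sum L {..<s} (\<lambda>i. int (lam i)) G \<noteq> 0"
    then obtain v where v: "G v \<noteq> 0" "alt_sum L {..<s} (\<lambda>i. int (lam i)) (agrees L v) \<noteq> 0"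
      using alt_sum_coefficient[of "{..<s}"] by blast
    have b_inter: "interlaces L (b s) (b (Suc s))"
      unfolding interlaces_def
    proof (intro conjI allI impI)
      show "b (Suc s) (Suc i) < b s i" for i using lam_Suc[of i] by (simp add: b_def)
    qed (simp add: b_def)
    show False
    proof (cases "\<forall>i<L. v i = b s i")
      case True
      then have "interlaces L v (b (Suc s))" using b_inter by (simp add: interlaces_def)
      with True v(1) show False by (simp add: G_def agrees_def)
    next
      case False
      then have "agrees L (b s) v = 0" by (simp add: agrees_def)
      then have inter: "interlaces L v (b (Suc s))"
        using v(1) by (simp add: G_def)
      then have "strict_dec L v" by (force simp: strict_dec_def interlaces_def)
      then have tail: "\<forall>i<L. s \<le> i \<longrightarrow> v i = - int i"
        using alt_sum_dominance[OF _ _ v(2)] Suc.prems by auto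
      have le: "v i \<le> b s i" if "i < L" for i
        using inter tail that by (cases "i < s") (auto simp: interlaces_def b_def)
      obtain i where i: "i < L" "v i \<noteq> b s i" using False by blast
      have "(\<Sum>i<L. v i + int i) < (\<Sum>i<L. b s i + int i)"
        using le i by (intro sum_strict_mono_ex1) (auto intro!: bexI[of _ i] simp: order.strict_iff_order)
      moreover have "(\<Sum>i<L. v i + int i) = (\<Sum>i<s. int (lam i))"
        using alt_sum_nonzero_witness(1)[OF _ v(2)] by simp
      ultimately show False using sum_b[of s] Suc.prems by simp
    qed
  qed
  then have "alt_sum L {..<s} (\<lambda>i. int (lam i)) (\<lambda>v. of_bool (interlaces L v (b (Suc s)))) =
      alt_sum L {..<s} (\<lambda>i. int (lam i)) (agrees L (b s))"
    unfolding G_def alt_sum_diff by simp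
  moreover have "alt_sum L {..<s} (\<lambda>i. int (lam i)) (agrees L (b s)) = 1"
    using Suc by (simp add: b_def[abs_def])
  ultimately show ?case by (simp add: b_def[abs_def])
qed

text \<open>This converts dominance into \<open>w = id\<close>: in both norm computations only the
  diagonal term of the determinant survives.\<close>

lemma permutation_eq_id_if_prefix_sums_le:
  assumes w: "w permutes {..<L}" and le: "\<And>r. r \<le> L \<Longrightarrow> (\<Sum>i<r. int (w i)) \<le> (\<Sum>i<r. int i)"
  shows "w = id"
proof -
  have "w i = i" if "i < L" for i
    using that
  proof (induction i rule: less_induct)
    case (less i)
    have "(\<Sum>j<i. int (w j)) = (\<Sum>j<i. int j)" using less by (intro sum.cong) auto
    then have "w i \<le> i" using le[of "Suc i"] less.prems by simp
    moreover have "\<not> w i < i"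
    proof
      assume "w i < i"
      then have "w (w i) = w i" using less by simp
      from injD[OF permutes_inj[OF w] this] \<open>w i < i\<close> show False by simp
    qed
    ultimately show ?case by simp
  qed
  moreover have "w i = i" if "\<not> i < L" for i using w that by (simp add: permutes_def)
  ultimately show ?thesis by (auto simp: fun_eq_iff)
qed

text \<open>One factor is expanded as a determinant. By \<open>alt_sum_dominance\<close> the inner
  product with the term w is nonzero only for the identity, where \<open>alt_sum_diagonal\<close>
  evaluates it.\<close>

lemma det_char_norm:
  assumes lam: "antimono lam" and total: "(\<Sum>i<L. int (lam i)) = int n"
  shows "(\<Sum>x | x permutes {..<n}. det_char n L (\<lambda>i. int (lam i) - int i) x * det_char n L (\<lambda>i. int (lam i) - int i) x) = fact n"
proof -
  define b where "b i = int (lam i) - int i" for i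
  have sd: "strict_dec L b"
    unfolding strict_dec_def
  proof (intro allI impI)
    fix i
    have "lam (Suc i) \<le> lam i" using lam by (simp add: antimonoD)
    then show "b (Suc i) < b i" by (simp add: b_def)
  qed
  have total_w: "(\<Sum>i<L. b i + int (w i)) = int n" if "w permutes {..<L}" for w
    using total sum_perms_upto[OF that] by (simp add: b_def sum.distrib sum_subtractf)
  have alt: "alt_sum L {..<L} (\<lambda>i. b i + int (w i)) (agrees L b) = of_bool (w = id)" if w: "w permutes {..<L}" for w
  proof (cases "w = id")
    case True
    have "alt_sum L {..<L} (\<lambda>i. int (lam i)) (agrees L (\<lambda>i. (if i < L then int (lam i) else 0) - int i)) = 1"
      by (rule alt_sum_diagonal[OF lam order_refl])
    moreover have "agrees L (\<lambda>i. (if i < L then int (lam i) else 0) - int i) = agrees L b"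
      by (auto simp: agrees_def fun_eq_iff b_def)
    ultimately show ?thesis using True by (simp add: b_def)
  next
    case False
    show ?thesis
    proof (rule ccontr)
      assume "alt_sum L {..<L} (\<lambda>i. b i + int (w i)) (agrees L b) \<noteq> of_bool (w = id)"
      then have "\<forall>r\<le>L. (\<Sum>i<r. b i + int (w i)) \<le> (\<Sum>i<r. b i + int i)"
        using alt_sum_dominance[OF order_refl sd] False by simp
      then have "w = id"
        by (intro permutation_eq_id_if_prefix_sums_le[OF w]) (simp add: sum.distrib)
      with False show False ..
    qed
  qed
  let ?S = "{x. x permutes {..<n}}" and ?W = "{w. w permutes {..<L}}"
  have "(\<Sum>x\<in>?S. det_char n L b x * det_char n L b x) =
      (\<Sum>x\<in>?S. \<Sum>w\<in>?W. sign w * (det_char n L b x * perm_char n {..<L} (\<lambda>i. b i + int (w i)) x))"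
    by (subst (2) det_char_def) (simp add: sum_distrib_left mult_ac)
  also have "\<dots> = (\<Sum>w\<in>?W. sign w * (\<Sum>x\<in>?S. det_char n L b x * perm_char n {..<L} (\<lambda>i. b i + int (w i)) x))"
    by (subst sum.swap) (simp add: sum_distrib_left)
  also have "\<dots> = (\<Sum>w\<in>?W. if w = id then fact n else 0)"
    by (rule sum.cong) (auto simp: det_char_inner total_w alt)
  also have "\<dots> = fact n" by (simp add: permutes_id)
  finally show ?thesis by (simp add: b_def[abs_def])
qed


subsection \<open>Irreducible characters are determinantal\<close>

context
  fixes n :: nat and lam :: "nat \<Rightarrow> nat"
  assumes partition: "partition_of n lam"
begin

private abbreviation "young \<equiv> young_symmetrizer n lam"
private abbreviation "unit \<equiv> young_idempotent n lam"
private abbreviation "factor \<equiv> young_factor n lam"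

interpretation tableau n lam "tab_row lam" "tab_col lam"
  by (rule tableau_tab[OF partition])

text \<open>The Young symmetrizer paired with the stabilizer of the labeling f. Summed over all
  labelings of a given content it is, up to a scalar, the inner product of the irreducible with the
  permutation character.\<close>

definition fixing_weight :: "(nat \<Rightarrow> 'z) \<Rightarrow> complex" where
  "fixing_weight f = (\<Sum>g | g permutes {..<n}. young g * of_bool (f \<circ> g = f))"

text \<open>The transposition of m and m' stabilizes f and lies in the column group, so right
  multiplication by it permutes the terms and negates the symmetrizer.\<close>

lemma fixing_weight_eq_0:
  assumes m: "m < n" "m' < n" "m \<noteq> m'" "tab_col lam m = tab_col lam m'" "f m = f m'"
  shows "fixing_weight f = 0"
proof -
  define t where "t = transpose m m'"
  have t: "t permutes {..<n}" using m by (simp add: t_def permutes_swap_id)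
  have t_col: "t \<in> col_group n lam"
    using m by (auto simp: t_def col_group_def transpose_def permutes_swap_id)
  have sgn: "sign t = -1" using m by (simp add: t_def sign_swap_id)
  have young: "young (g \<circ> t) = - young g" for g
    unfolding young_symmetrizer_eq
    using conv_right_invariant[of "col_sum n lam" t "of_int (sign t)" n "row_sum n lam" g] col_sum_right[OF t_col] sgn
    by simp
  have ft: "f \<circ> t = f" using m by (auto simp: t_def fun_eq_iff transpose_def)
  have tt: "t \<circ> t = id" by (simp add: t_def)
  have inv: "f \<circ> (g \<circ> t) = f \<longleftrightarrow> f \<circ> g = f" for g
  proof
    assume "f \<circ> (g \<circ> t) = f"
    then have "f \<circ> g \<circ> (t \<circ> t) = f \<circ> t" by (simp add: o_assoc)
    then show "f \<circ> g = f" by (simp add: tt ft)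
  next
    assume "f \<circ> g = f"
    then show "f \<circ> (g \<circ> t) = f" by (simp add: o_assoc ft)
  qed
  have "fixing_weight f = (\<Sum>g | g permutes {..<n}. young (g \<circ> t) * of_bool (f \<circ> (g \<circ> t) = f))"
    unfolding fixing_weight_def by (rule sum_perm_compose_right[OF t, symmetric])
  also have "\<dots> = - fixing_weight f"
    by (simp add: young inv fixing_weight_def sum_negf)
  finally show ?thesis by simp
qed

lemma irr_char_perm_char_inner:
  assumes Z: "finite Z"
  shows "(\<Sum>g | g permutes {..<n}. irr_char n lam g * of_int (perm_char n Z t g)) =
    fact n / factor * (\<Sum>f\<in>labelings n Z t. fixing_weight f)"
proof -
  have "(\<Sum>g | g permutes {..<n}. irr_char n lam g * of_int (perm_char n Z t g)) =
      fact n * (\<Sum>g | g permutes {..<n}. unit g * of_int (perm_char n Z t g))"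
    unfolding irr_char_def by (rule sum_character_class_function) (simp add: perm_char_conj)
  also have "(\<Sum>g | g permutes {..<n}. unit g * of_int (perm_char n Z t g)) =
      (\<Sum>g | g permutes {..<n}. \<Sum>f\<in>labelings n Z t. unit g * of_bool (f \<circ> g = f))"
    by (simp add: perm_char_eq_sum[OF Z] sum_distrib_left of_bool_def if_distrib cong: if_cong)
  also have "\<dots> = (\<Sum>f\<in>labelings n Z t. \<Sum>g | g permutes {..<n}. unit g * of_bool (f \<circ> g = f))"
    by (rule sum.swap)
  also have "\<dots> = 1 / factor * (\<Sum>f\<in>labelings n Z t. fixing_weight f)"
    by (simp only: fixing_weight_def young_idempotent_def cscale_apply sum_distrib_left mult.assoc)
  finally show ?thesis by simp
qed

lemma irr_char_inner_few_labels:
  assumes Z: "finite Z" "card Z < part_length lam"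
  shows "(\<Sum>g | g permutes {..<n}. irr_char n lam g * of_int (perm_char n Z t g)) = 0"
proof -
  have "fixing_weight f = 0" if f: "f \<in> labelings n Z t" for f
  proof -
    have "f ` {..<n} \<subseteq> Z" using f by (auto simp: labelings_def)
    then obtain m m' where "m < n" "m' < n" "m \<noteq> m'" "tab_col lam m = tab_col lam m'" "f m = f m'"
      using first_column_collision[OF Z(1)] Z(2) unfolding part_length_def by metis
    then show ?thesis by (rule fixing_weight_eq_0)
  qed
  then show ?thesis unfolding irr_char_perm_char_inner[OF Z(1)] by simp
qed

lemma card_le_eq_sum_card:
  "card {m. m < (n::nat) \<and> (f m :: nat) \<le> k} = (\<Sum>i<Suc k. card {m. m < n \<and> f m = i})"
proof -
  have "(\<Sum>i<Suc k. \<Sum>m\<in>{m \<in> {m. m < n \<and> f m \<le> k}. f m = i}. 1 :: nat) = (\<Sum>m\<in>{m. m < n \<and> f m \<le> k}. 1)"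
    by (rule sum.group) auto
  moreover have "{m \<in> {m. m < n \<and> f m \<le> k}. f m = i} = {m. m < n \<and> f m = i}" if "i < Suc k" for i
    using that by auto
  ultimately show ?thesis by simp
qed

text \<open>A nonzero inner product exhibits a labeling of nonzero weight, whose labels are distinct
  within every column; \<open>dominance_if_inj_on_columns\<close> applies to it.\<close>

lemma irr_char_inner_dominance:
  assumes ne: "(\<Sum>g | g permutes {..<n}. irr_char n lam g * of_int (perm_char n {..<L} t g)) \<noteq> 0" and r: "r \<le> L"
  shows "(\<Sum>i<r. t i) \<le> (\<Sum>i<r. int (lam i))"
proof -
  obtain f where f: "f \<in> labelings n {..<L} t" "fixing_weight f \<noteq> 0"
    using ne unfolding irr_char_perm_char_inner[OF finite_lessThan] by (metis mult_zero_right sum.neutral)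
  have inj: "m = m'" if "m < n" "m' < n" "tab_col lam m = tab_col lam m'" "f m = f m'" for m m'
    using fixing_weight_eq_0 f(2) that by blast
  show ?thesis
  proof (cases r)
    case (Suc k)
    have "(\<Sum>i<r. t i) = (\<Sum>i<Suc k. int (card {m. m < n \<and> f m = i}))"
      unfolding Suc using f(1) r Suc by (intro sum.cong) (auto simp: labelings_def)
    also have "\<dots> = int (card {m. m < n \<and> f m \<le> k})" by (simp only: card_le_eq_sum_card of_nat_sum)
    also have "\<dots> \<le> int (card {m. m < n \<and> tab_row lam m \<le> k})"
      unfolding of_nat_le_iff by (rule dominance_if_inj_on_columns) (rule inj)
    also have "\<dots> = (\<Sum>i<r. int (lam i))"
      by (simp only: card_le_eq_sum_card card_row Suc of_nat_sum)
    finally show ?thesis .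
  qed simp
qed

text \<open>The labelings form the orbit of the labeling by rows, whose stabilizer is the row group.
  Summing the weights along the orbit averages the symmetrizer over conjugates, which leaves its
  character summed over the row group, as evaluated in \<open>irr_char_row_group\<close>.\<close>

lemma irr_char_inner_diagonal:
  assumes L: "part_length lam \<le> L"
  shows "(\<Sum>g | g permutes {..<n}. irr_char n lam g * of_int (perm_char n {..<L} (\<lambda>i. int (lam i)) g)) = fact n"
proof -
  let ?S = "{g. g permutes {..<n}}" and ?A = "row_group n lam"
  let ?lab = "labelings n {..<L} (\<lambda>i. int (lam i))"
  define f where "f = restrict (tab_row lam) {..<n}"
  have row_L: "tab_row lam m < L" if "m < n" for m
    using col_less[OF that] partition_vanishes[of lam "tab_row lam m"] partition L
    by (force simp: partition_of_def not_le[symmetric])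
  have f: "f \<in> ?lab"
    using row_L card_row by (auto simp: labelings_def f_def cong: conj_cong)
  have stab: "f \<circ> y = f \<longleftrightarrow> y \<in> ?A" if y: "y permutes {..<n}" for y
  proof
    assume "f \<circ> y = f"
    then have "f (y m) = f m" for m by (simp add: fun_eq_iff)
    then have "tab_row lam (y m) = tab_row lam m" if "m < n" for m
      using that perm_lt[OF y, of m] by (simp add: f_def) (metis lessThan_iff restrict_apply')
    then show "y \<in> ?A" using y by (simp add: row_group_def)
  next
    assume "y \<in> ?A"
    then show "f \<circ> y = f"
      by (auto simp: row_group_def f_def fun_eq_iff perm_lt[OF y])
  qed
  have "{y. y permutes {..<n} \<and> f \<circ> y = f} = ?A"
    using stab row_group_perm by blast
  then have transporter: "card {y. y permutes {..<n} \<and> f \<circ> y = g} = card ?A" if "g \<in> ?lab" for g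
    using card_transporter(2)[OF f that] by simp
  have "of_nat (card ?A) * (\<Sum>g\<in>?lab. fixing_weight g) = (\<Sum>y\<in>?S. fixing_weight (f \<circ> y))"
    using sum_over_orbit[OF finite_lessThan f, of fixing_weight] transporter
    by (simp add: sum_distrib_left)
  also have "\<dots> = (\<Sum>y\<in>?S. \<Sum>h\<in>?S. young (inv y \<circ> h \<circ> y) * of_bool (h \<in> ?A))"
  proof (rule sum.cong[OF refl])
    fix y assume "y \<in> ?S"
    then have y: "y permutes {..<n}" by simp
    have "fixing_weight (f \<circ> y) = (\<Sum>h\<in>?S. young (inv y \<circ> h \<circ> y) * of_bool (f \<circ> y \<circ> (inv y \<circ> h \<circ> y) = f \<circ> y))"
      unfolding fixing_weight_def by (rule sum_perm_conj[OF y, symmetric])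
    also have "\<dots> = (\<Sum>h\<in>?S. young (inv y \<circ> h \<circ> y) * of_bool (h \<in> ?A))"
    proof (rule sum.cong[OF refl])
      fix h assume "h \<in> ?S"
      then have h: "h permutes {..<n}" by simp
      have "f \<circ> y \<circ> (inv y \<circ> h \<circ> y) = f \<circ> h \<circ> y"
        by (simp add: o_assoc permutes_cancel[OF y])
      moreover have "f \<circ> h \<circ> y = f \<circ> y \<longleftrightarrow> f \<circ> h = f"
        using permutes_cancel(5)[OF y] by metis
      ultimately show "young (inv y \<circ> h \<circ> y) * of_bool (f \<circ> y \<circ> (inv y \<circ> h \<circ> y) = f \<circ> y) =
          young (inv y \<circ> h \<circ> y) * of_bool (h \<in> ?A)"
        by (simp only: stab[OF h])
    qed
    finally show "fixing_weight (f \<circ> y) = (\<Sum>h\<in>?S. young (inv y \<circ> h \<circ> y) * of_bool (h \<in> ?A))" .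
  qed
  also have "\<dots> = (\<Sum>h\<in>?S. character n young h * of_bool (h \<in> ?A))"
    by (subst sum.swap) (simp only: character_def sum_distrib_right)
  also have "\<dots> = (\<Sum>h\<in>?A. character n young h)"
    by (rule sum.mono_neutral_cong_right) (auto simp: row_group_perm)
  also have "\<dots> = factor * of_nat (card ?A)" by (rule irr_char_row_group[OF partition])
  finally have "(\<Sum>g\<in>?lab. fixing_weight g) = factor"
    using finite_row_group[of n lam] id_row_group[of n lam] by (auto simp: card_eq_0_iff)
  then show ?thesis
    unfolding irr_char_perm_char_inner[OF finite_lessThan] using young_factor_nonzero[OF partition] by simp
qed

theorem irr_char_eq_det_char:
  assumes L: "part_length lam \<le> L" and g: "g permutes {..<n}"
  shows "irr_char n lam g = of_int (det_char n L (\<lambda>i. int (lam i) - int i) g)"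
proof -
  let ?S = "{g. g permutes {..<n}}" and ?W = "{w. w permutes {..<L}}"
  let ?chi = "irr_char n lam"
  define psi where "psi g = (of_int (det_char n L (\<lambda>i. int (lam i) - int i) g) :: complex)" for g
  have part: "is_partition lam" "weight lam = n" using partition by (auto simp: partition_of_def)
  have total: "(\<Sum>i<L. int (lam i)) = int n"
    using weight_eq_sum[OF part(1) L] part(2) by simp
  have "(\<Sum>g\<in>?S. psi g * psi g) =
      of_int (\<Sum>g\<in>?S. det_char n L (\<lambda>i. int (lam i) - int i) g * det_char n L (\<lambda>i. int (lam i) - int i) g)"
    by (simp add: psi_def)
  also have "\<dots> = fact n" by (simp only: det_char_norm[OF anti total] of_int_fact)
  finally have psi_psi: "(\<Sum>g\<in>?S. psi g * psi g) = fact n" .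
  have inner: "(\<Sum>g\<in>?S. ?chi g * of_int (perm_char n {..<L} (\<lambda>i. int (lam i) - int i + int (w i)) g)) =
      (if w = id then fact n else 0)" if w: "w permutes {..<L}" for w
  proof (cases "w = id")
    case True
    then show ?thesis using irr_char_inner_diagonal[OF L] by simp
  next
    case False
    have "(\<Sum>g\<in>?S. ?chi g * of_int (perm_char n {..<L} (\<lambda>i. int (lam i) - int i + int (w i)) g)) = 0"
    proof (rule ccontr)
      assume "\<not> ?thesis"
      then have "(\<Sum>i<r. int (lam i) - int i + int (w i)) \<le> (\<Sum>i<r. int (lam i))" if "r \<le> L" for r
        using irr_char_inner_dominance that by blast
      then have "w = id"
        by (intro permutation_eq_id_if_prefix_sums_le[OF w]) (simp add: sum.distrib sum_subtractf)
      with False show False ..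
    qed
    then show ?thesis using False by simp
  qed
  have "(\<Sum>g\<in>?S. ?chi g * psi g) = (\<Sum>g\<in>?S. \<Sum>w\<in>?W. of_int (sign w) *
      (?chi g * of_int (perm_char n {..<L} (\<lambda>i. int (lam i) - int i + int (w i)) g)))"
    by (simp add: psi_def det_char_def sum_distrib_left mult_ac)
  also have "\<dots> = (\<Sum>w\<in>?W. of_int (sign w) *
      (\<Sum>g\<in>?S. ?chi g * of_int (perm_char n {..<L} (\<lambda>i. int (lam i) - int i + int (w i)) g)))"
    by (subst sum.swap) (simp add: sum_distrib_left)
  also have "\<dots> = (\<Sum>w\<in>?W. if w = id then fact n else 0)"
    by (rule sum.cong) (auto simp: inner)
  also have "\<dots> = fact n" by (simp add: permutes_id)
  finally have chi_psi: "(\<Sum>g\<in>?S. ?chi g * psi g) = fact n" .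
  have "(\<Sum>g\<in>?S. (?chi g - psi g) * (?chi g - psi g)) =
      (\<Sum>g\<in>?S. ?chi g * ?chi g) - 2 * (\<Sum>g\<in>?S. ?chi g * psi g) + (\<Sum>g\<in>?S. psi g * psi g)"
    by (simp add: algebra_simps sum.distrib sum_subtractf sum_distrib_left)
  also have "\<dots> = 0" by (simp add: irr_char_norm[OF partition] chi_psi psi_psi)
  finally have "(\<Sum>g\<in>?S. (?chi g - psi g) * (?chi g - psi g)) = 0" .
  \<comment> \<open>Both functions are real-valued, so a vanishing sum of squares makes every term
    vanish.\<close>
  moreover have "(?chi g - psi g) * (?chi g - psi g) = of_real ((cmod (?chi g - psi g))\<^sup>2)" for g
  proof -
    have "cnj (?chi g - psi g) = ?chi g - psi g" by (simp add: cnj_irr_char[OF partition] psi_def)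
    then show ?thesis using complex_norm_square[of "?chi g - psi g"] by simp
  qed
  ultimately have "complex_of_real (\<Sum>g\<in>?S. (cmod (?chi g - psi g))\<^sup>2) = 0" by simp
  then have "(\<Sum>g\<in>?S. (cmod (?chi g - psi g))\<^sup>2) = 0" by (simp only: of_real_eq_0_iff)
  then have "?chi g = psi g"
    using g by (subst (asm) sum_nonneg_eq_0_iff) auto
  then show ?thesis by (simp add: psi_def)
qed

end

lemma kronecker_eq_det_char_sum:
  assumes "partition_of n lam" "partition_of n mu" "partition_of n nu"
    and "part_length lam \<le> L" "part_length mu \<le> L" "part_length nu \<le> L"
  shows "fact n * int (kronecker n mu nu lam) =
    (\<Sum>g | g permutes {..<n}. det_char n L (\<lambda>i. int (lam i) - int i) g *
      (det_char n L (\<lambda>i. int (mu i) - int i) g * det_char n L (\<lambda>i. int (nu i) - int i) g))"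
proof -
  have "(of_int (fact n * int (kronecker n mu nu lam)) :: complex) =
      (\<Sum>g | g permutes {..<n}. irr_char n lam g * (irr_char n mu g * irr_char n nu g))"
    using kronecker_eq_character_sum[OF assms(1-3)] by simp
  also have "\<dots> = of_int (\<Sum>g | g permutes {..<n}. det_char n L (\<lambda>i. int (lam i) - int i) g *
      (det_char n L (\<lambda>i. int (mu i) - int i) g * det_char n L (\<lambda>i. int (nu i) - int i) g))"
    using assms by (simp add: irr_char_eq_det_char[of n _ L])
  finally show ?thesis by (simp only: of_int_eq_iff)
qed

text \<open>The characters of mu and nu are expanded with exactly as many labels as they have parts.
  A product of two terms is then a sum of permutation characters on
  \<open>part_length mu * part_length nu\<close> labels, too few for lam.\<close>

lemma kronecker_eq_0_if_long:
  assumes "partition_of n lam" "partition_of n mu" "partition_of n nu"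
    and long: "part_length mu * part_length nu < part_length lam"
  shows "kronecker n mu nu lam = 0"
proof -
  let ?S = "{g. g permutes {..<n}}"
  let ?k = "part_length mu" and ?l = "part_length nu"
  let ?b = "\<lambda>w i. int (mu i) - int i + int (w i)" and ?d = "\<lambda>w i. int (nu i) - int i + int (w i)"
  have zero: "(\<Sum>g\<in>?S. irr_char n lam g * (of_int (perm_char n {..<?k} a g) * of_int (perm_char n {..<?l} b g))) = 0" for a b
  proof -
    have "(\<Sum>g\<in>?S. irr_char n lam g * (of_int (perm_char n {..<?k} a g) * of_int (perm_char n {..<?l} b g))) =
        (\<Sum>g\<in>?S. irr_char n lam g * of_int (perm_char n {..<?k} a g * perm_char n {..<?l} b g))" by simp
    also have "\<dots> = (\<Sum>g\<in>?S. \<Sum>T\<in>tables {..<?k} {..<?l} a b. irr_char n lam g * of_int (perm_char n ({..<?k} \<times> {..<?l}) (int \<circ> T) g))"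
      by (rule sum.cong[OF refl]) (simp add: perm_char_mult sum_distrib_left del: of_int_mult)
    also have "\<dots> = (\<Sum>T\<in>tables {..<?k} {..<?l} a b. \<Sum>g\<in>?S. irr_char n lam g * of_int (perm_char n ({..<?k} \<times> {..<?l}) (int \<circ> T) g))"
      by (rule sum.swap)
    also have "\<dots> = 0"
      using long by (intro sum.neutral ballI irr_char_inner_few_labels[OF assms(1)]) auto
    finally show ?thesis .
  qed
  have "fact n * of_nat (kronecker n mu nu lam) = (\<Sum>g\<in>?S. irr_char n lam g * (irr_char n mu g * irr_char n nu g))"
    by (rule kronecker_eq_character_sum[OF assms(1-3)])
  also have "\<dots> = (\<Sum>g\<in>?S. \<Sum>w | w permutes {..<?k}. \<Sum>u | u permutes {..<?l}. of_int (sign w) * of_int (sign u) *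
      (irr_char n lam g * (of_int (perm_char n {..<?k} (?b w) g) * of_int (perm_char n {..<?l} (?d u) g))))"
  proof (rule sum.cong[OF refl])
    fix g assume "g \<in> ?S"
    then have "irr_char n mu g * irr_char n nu g = (\<Sum>w | w permutes {..<?k}. \<Sum>u | u permutes {..<?l}.
        (of_int (sign w) * of_int (perm_char n {..<?k} (?b w) g)) * (of_int (sign u) * of_int (perm_char n {..<?l} (?d u) g)))"
      by (simp add: irr_char_eq_det_char[OF assms(2) order_refl] irr_char_eq_det_char[OF assms(3) order_refl]
          det_char_def sum_product)
    then show "irr_char n lam g * (irr_char n mu g * irr_char n nu g) =
        (\<Sum>w | w permutes {..<?k}. \<Sum>u | u permutes {..<?l}. of_int (sign w) * of_int (sign u) *
          (irr_char n lam g * (of_int (perm_char n {..<?k} (?b w) g) * of_int (perm_char n {..<?l} (?d u) g))))"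
      by (simp only: sum_distrib_left mult_ac)
  qed
  also have "\<dots> = (\<Sum>w | w permutes {..<?k}. \<Sum>g\<in>?S. \<Sum>u | u permutes {..<?l}. of_int (sign w) * of_int (sign u) *
      (irr_char n lam g * (of_int (perm_char n {..<?k} (?b w) g) * of_int (perm_char n {..<?l} (?d u) g))))"
    by (rule sum.swap)
  also have "\<dots> = (\<Sum>w | w permutes {..<?k}. \<Sum>u | u permutes {..<?l}. \<Sum>g\<in>?S. of_int (sign w) * of_int (sign u) *
      (irr_char n lam g * (of_int (perm_char n {..<?k} (?b w) g) * of_int (perm_char n {..<?l} (?d u) g))))"
    by (intro sum.cong refl sum.swap)
  also have "\<dots> = 0"
    by (simp add: zero flip: sum_distrib_left)
  finally have "(of_nat (kronecker n mu nu lam) :: complex) = 0" by simp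
  then show ?thesis by (simp only: of_nat_eq_0_iff)
qed


subsection \<open>Stable expansion\<close>

text \<open>Tables whose margins are prescribed except in row and column \<open>0\<close>, without their corner entry.\<close>

definition corner_free :: "nat \<Rightarrow> (nat \<times> nat) set" where
  "corner_free L = {..<L} \<times> {..<L} - {(0, 0)}"

definition partial_tables :: "nat \<Rightarrow> (nat \<Rightarrow> int) \<Rightarrow> (nat \<Rightarrow> int) \<Rightarrow> (nat \<times> nat \<Rightarrow> nat) set" where
  "partial_tables L a c = {T \<in> extensional (corner_free L).
    (\<forall>i<L. i \<noteq> 0 \<longrightarrow> (\<Sum>j<L. int (T (i, j))) = a i) \<and> (\<forall>j<L. j \<noteq> 0 \<longrightarrow> (\<Sum>i<L. int (T (i, j))) = c j)}"

lemma sum_lessThan_split_0: "0 < L \<Longrightarrow> (\<Sum>i<L. f i) = f 0 + (\<Sum>i\<in>{..<L} - {0::nat}. f i)"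
  by (simp add: sum.remove)

lemma sum_corner_free:
  fixes f :: "nat \<times> nat \<Rightarrow> int"
  assumes "0 < L"
  shows "(\<Sum>z\<in>corner_free L. f z) = (\<Sum>j\<in>{..<L} - {0}. f (0, j)) + (\<Sum>i\<in>{..<L} - {0}. \<Sum>j<L. f (i, j))"
    and "(\<Sum>z\<in>corner_free L. f z) = (\<Sum>i\<in>{..<L} - {0}. f (i, 0)) + (\<Sum>j\<in>{..<L} - {0}. \<Sum>i<L. f (i, j))"
proof -
  have "(\<Sum>z\<in>{..<L} \<times> {..<L}. f z) = f (0, 0) + (\<Sum>z\<in>corner_free L. f z)"
    unfolding corner_free_def by (rule sum.remove) (use assms in auto)
  moreover have "(\<Sum>z\<in>{..<L} \<times> {..<L}. f z) = (\<Sum>i<L. \<Sum>j<L. f (i, j))"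
    by (simp add: sum.cartesian_product split_beta)
  moreover have "(\<Sum>i<L. \<Sum>j<L. f (i, j)) = (\<Sum>j<L. \<Sum>i<L. f (i, j))" by (rule sum.swap)
  ultimately show "(\<Sum>z\<in>corner_free L. f z) = (\<Sum>j\<in>{..<L} - {0}. f (0, j)) + (\<Sum>i\<in>{..<L} - {0}. \<Sum>j<L. f (i, j))"
    "(\<Sum>z\<in>corner_free L. f z) = (\<Sum>i\<in>{..<L} - {0}. f (i, 0)) + (\<Sum>j\<in>{..<L} - {0}. \<Sum>i<L. f (i, j))"
    using assms sum_lessThan_split_0[OF assms, of "\<lambda>i. \<Sum>j<L. f (i, j)"] sum_lessThan_split_0[OF assms, of "\<lambda>j. f (0, j)"]
      sum_lessThan_split_0[OF assms, of "\<lambda>j. \<Sum>i<L. f (i, j)"] sum_lessThan_split_0[OF assms, of "\<lambda>i. f (i, 0)"]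
    by simp_all
qed

text \<open>Row 0 has no prescribed margin; its entries outside the corner are bounded by the
  margins of their columns.\<close>

lemma partial_tables_total:
  assumes L: "0 < L" and T: "T \<in> partial_tables L a c"
  shows "(\<Sum>z\<in>corner_free L. int (T z)) \<le> (\<Sum>i\<in>{..<L} - {0}. a i) + (\<Sum>j\<in>{..<L} - {0}. c j)"
proof -
  have "(\<Sum>j\<in>{..<L} - {0}. int (T (0, j))) \<le> (\<Sum>j\<in>{..<L} - {0}. \<Sum>i<L. int (T (i, j)))"
    using L by (intro sum_mono member_le_sum) auto
  also have "\<dots> = (\<Sum>j\<in>{..<L} - {0}. c j)"
    using T by (intro sum.cong) (auto simp: partial_tables_def)
  finally have "(\<Sum>j\<in>{..<L} - {0}. int (T (0, j))) \<le> (\<Sum>j\<in>{..<L} - {0}. c j)" .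
  moreover have "(\<Sum>i\<in>{..<L} - {0}. \<Sum>j<L. int (T (i, j))) = (\<Sum>i\<in>{..<L} - {0}. a i)"
    using T by (intro sum.cong) (auto simp: partial_tables_def)
  ultimately show ?thesis unfolding sum_corner_free(1)[OF L] by simp
qed

lemma finite_partial_tables:
  assumes L: "0 < L"
  shows "finite (partial_tables L a c)"
proof (rule finite_subset)
  let ?B = "nat ((\<Sum>i\<in>{..<L} - {0}. a i) + (\<Sum>j\<in>{..<L} - {0}. c j))"
  show "partial_tables L a c \<subseteq> corner_free L \<rightarrow>\<^sub>E {..?B}"
  proof
    fix T assume T: "T \<in> partial_tables L a c"
    have "T z \<le> ?B" if "z \<in> corner_free L" for z
    proof -
      have "int (T z) \<le> (\<Sum>z\<in>corner_free L. int (T z))"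
        using that by (intro member_le_sum) (auto simp: corner_free_def)
      then show ?thesis using partial_tables_total[OF L T] by simp
    qed
    then show "T \<in> corner_free L \<rightarrow>\<^sub>E {..?B}" using T by (auto simp: partial_tables_def PiE_iff)
  qed
  show "finite (corner_free L \<rightarrow>\<^sub>E {..?B})" by (auto intro!: finite_PiE simp: corner_free_def)
qed

text \<open>The corner is recovered as k minus the total of the other entries, which is a natural
  number exactly when that total is at most k. The margins of row 0 and column 0 then follow from
  the others, since both margin vectors sum to k.\<close>

lemma tables_corner_bij:
  assumes L: "0 < L" and a: "(\<Sum>i<L. a i) = k" and c: "(\<Sum>j<L. c j) = k"
  shows "bij_betw (\<lambda>T. restrict T (corner_free L)) (tables {..<L} {..<L} a c)
    {T \<in> partial_tables L a c. (\<Sum>z\<in>corner_free L. int (T z)) \<le> k}"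
proof -
  let ?J = "corner_free L"
  have sq: "{..<L} \<times> {..<L} = insert (0, 0) ?J" "(0, 0) \<notin> ?J" "finite ?J"
    using L by (auto simp: corner_free_def)
  have mem: "(i, j) \<in> ?J \<longleftrightarrow> i < L \<and> j < L \<and> (i \<noteq> 0 \<or> j \<noteq> 0)" for i j
    by (auto simp: corner_free_def)
  have total: "int (T (0, 0)) + (\<Sum>z\<in>?J. int (T z)) = k" if T: "T \<in> tables {..<L} {..<L} a c" for T
  proof -
    have "int (T (0, 0)) + (\<Sum>z\<in>?J. int (T z)) = (\<Sum>z\<in>{..<L} \<times> {..<L}. int (T z))"
      using sq by simp
    also have "\<dots> = (\<Sum>i<L. \<Sum>j<L. int (T (i, j)))" by (simp add: sum.cartesian_product split_beta)
    also have "\<dots> = (\<Sum>i<L. a i)" using T by (intro sum.cong) (auto simp: tables_def)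
    finally show ?thesis using a by simp
  qed
  define ext where "ext T = T((0, 0) := nat (k - (\<Sum>z\<in>?J. int (T z))))" for T :: "nat \<times> nat \<Rightarrow> nat"
  have ext_other: "ext T z = T z" if "z \<noteq> (0, 0)" for T z using that by (simp add: ext_def)
  show ?thesis
  proof (rule bij_betw_byWitness[where f' = ext])
    show "\<forall>T\<in>tables {..<L} {..<L} a c. ext (restrict T ?J) = T"
    proof
      fix T assume T: "T \<in> tables {..<L} {..<L} a c"
      have "ext (restrict T ?J) z = T z" for z
      proof (cases "z = (0, 0)")
        case True
        have "(\<Sum>z\<in>?J. int (restrict T ?J z)) = (\<Sum>z\<in>?J. int (T z))" by (rule sum.cong) auto
        then show ?thesis using total[OF T] True by (simp add: ext_def)
      next
        case False
        have "T \<in> extensional (insert (0, 0) ?J)" using T unfolding sq(1)[symmetric] by (simp add: tables_def)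
        from extensional_arb[OF this, of z] have "z \<notin> ?J \<Longrightarrow> T z = undefined" using False by blast
        then show ?thesis unfolding ext_other[OF False] by (simp add: restrict_def)
      qed
      then show "ext (restrict T ?J) = T" by (rule ext)
    qed
    show "\<forall>T\<in>{T \<in> partial_tables L a c. (\<Sum>z\<in>?J. int (T z)) \<le> k}. restrict (ext T) ?J = T"
      using sq(2) by (auto simp: partial_tables_def extensional_def restrict_def ext_def fun_eq_iff)
    show "(\<lambda>T. restrict T ?J) ` tables {..<L} {..<L} a c \<subseteq> {T \<in> partial_tables L a c. (\<Sum>z\<in>?J. int (T z)) \<le> k}"
    proof (rule image_subsetI)
      fix T assume T: "T \<in> tables {..<L} {..<L} a c"
      have "(\<Sum>z\<in>?J. int (restrict T ?J z)) = (\<Sum>z\<in>?J. int (T z))" by (rule sum.cong) auto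
      then have "(\<Sum>z\<in>?J. int (restrict T ?J z)) \<le> k" using total[OF T] by simp
      moreover have "(\<Sum>j<L. int (restrict T ?J (i, j))) = a i" if "i < L" "i \<noteq> 0" for i
      proof -
        have "(\<Sum>j<L. int (restrict T ?J (i, j))) = (\<Sum>j<L. int (T (i, j)))"
          using that by (intro sum.cong) (auto simp: mem)
        then show ?thesis using T that by (simp add: tables_def)
      qed
      moreover have "(\<Sum>i<L. int (restrict T ?J (i, j))) = c j" if "j < L" "j \<noteq> 0" for j
      proof -
        have "(\<Sum>i<L. int (restrict T ?J (i, j))) = (\<Sum>i<L. int (T (i, j)))"
          using that by (intro sum.cong) (auto simp: mem)
        then show ?thesis using T that by (simp add: tables_def)
      qed
      ultimately show "restrict T ?J \<in> {T \<in> partial_tables L a c. (\<Sum>z\<in>?J. int (T z)) \<le> k}"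
        by (simp add: partial_tables_def)
    qed
    show "ext ` {T \<in> partial_tables L a c. (\<Sum>z\<in>?J. int (T z)) \<le> k} \<subseteq> tables {..<L} {..<L} a c"
    proof (rule image_subsetI)
      fix T assume "T \<in> {T \<in> partial_tables L a c. (\<Sum>z\<in>?J. int (T z)) \<le> k}"
      then have T: "T \<in> partial_tables L a c" and le: "(\<Sum>z\<in>?J. int (T z)) \<le> k" by auto
      have corner: "int (ext T (0, 0)) = k - (\<Sum>z\<in>?J. int (T z))" using le by (simp add: ext_def)
      have rows: "(\<Sum>i\<in>{..<L} - {0}. \<Sum>j<L. int (T (i, j))) = (\<Sum>i\<in>{..<L} - {0}. a i)"
        using T by (intro sum.cong) (auto simp: partial_tables_def)
      have cols: "(\<Sum>j\<in>{..<L} - {0}. \<Sum>i<L. int (T (i, j))) = (\<Sum>j\<in>{..<L} - {0}. c j)"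
        using T by (intro sum.cong) (auto simp: partial_tables_def)
      have "(\<Sum>j<L. int (ext T (i, j))) = a i" if "i < L" for i
      proof (cases "i = 0")
        case True
        then show ?thesis
          using corner sum_corner_free(1)[OF L, of "\<lambda>z. int (T z)"] rows a
          by (simp add: sum_lessThan_split_0[OF L] ext_other)
      next
        case False
        then show ?thesis using T that by (simp add: ext_other partial_tables_def)
      qed
      moreover have "(\<Sum>i<L. int (ext T (i, j))) = c j" if "j < L" for j
      proof (cases "j = 0")
        case True
        then show ?thesis
          using corner sum_corner_free(2)[OF L, of "\<lambda>z. int (T z)"] cols c
          by (simp add: sum_lessThan_split_0[OF L] ext_other)
      next
        case False
        then show ?thesis using T that by (simp add: ext_other partial_tables_def)
      qed
      moreover have "ext T \<in> extensional ({..<L} \<times> {..<L})"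
        using T L unfolding sq(1) by (auto simp: extensional_def ext_def partial_tables_def)
      ultimately show "ext T \<in> tables {..<L} {..<L} a c" by (simp add: tables_def)
    qed
  qed
qed

lemma alt_sum_labels_cong:
  assumes "\<And>j. j \<in> J \<Longrightarrow> t j = t' j"
  shows "alt_sum L J t G = alt_sum L J t' G"
proof -
  have "(\<Pi>\<^sub>E j\<in>J. columns L (t j)) = (\<Pi>\<^sub>E j\<in>J. columns L (t' j))"
    by (rule PiE_cong) (simp add: assms)
  then show ?thesis by (simp add: alt_sum_def)
qed

text \<open>
  The right-hand side depends on the first parts of \<open>a\<close> and \<open>c\<close> only through the degree of \<open>b\<close>; the
  additional partial tables, which do not extend to tables, contribute \<open>0\<close>.
\<close>

lemma det_char_perm_char_inner_stable:
  assumes L: "0 < L" and a: "(\<Sum>i<L. a i) = int N" and c: "(\<Sum>j<L. c j) = int N"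
    and b: "(\<Sum>i<L. b i + int i) = int N"
  shows "(\<Sum>x | x permutes {..<N}. det_char N L b x * (perm_char N {..<L} a x * perm_char N {..<L} c x)) =
    fact N * (\<Sum>T\<in>partial_tables L a c. alt_sum L (corner_free L) (int \<circ> T) (\<lambda>v. of_bool (\<forall>i<L. v i \<le> b i)))"
proof -
  let ?J = "corner_free L" and ?S = "{x. x permutes {..<N}}"
  let ?h = "\<lambda>T. alt_sum L ?J (int \<circ> T) (\<lambda>v. of_bool (\<forall>i<L. v i \<le> b i))"
  have sq: "{..<L} \<times> {..<L} = insert (0, 0) ?J" "(0, 0) \<notin> ?J" "finite ?J"
    using L by (auto simp: corner_free_def)
  have "(\<Sum>x\<in>?S. det_char N L b x * (perm_char N {..<L} a x * perm_char N {..<L} c x)) =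
      (\<Sum>x\<in>?S. \<Sum>T\<in>tables {..<L} {..<L} a c. det_char N L b x * perm_char N ({..<L} \<times> {..<L}) (int \<circ> T) x)"
    by (rule sum.cong[OF refl]) (simp add: perm_char_mult sum_distrib_left)
  also have "\<dots> = (\<Sum>T\<in>tables {..<L} {..<L} a c. \<Sum>x\<in>?S. det_char N L b x * perm_char N ({..<L} \<times> {..<L}) (int \<circ> T) x)"
    by (rule sum.swap)
  also have "\<dots> = (\<Sum>T\<in>tables {..<L} {..<L} a c. fact N * ?h (restrict T ?J))"
  proof (rule sum.cong[OF refl])
    fix T assume T: "T \<in> tables {..<L} {..<L} a c"
    have "(\<Sum>z\<in>{..<L} \<times> {..<L}. (int \<circ> T) z) = (\<Sum>i<L. \<Sum>j<L. int (T (i, j)))"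
      by (simp add: sum.cartesian_product split_beta)
    also have "\<dots> = (\<Sum>i<L. a i)" using T by (intro sum.cong) (auto simp: tables_def)
    finally have total: "(\<Sum>z\<in>{..<L} \<times> {..<L}. (int \<circ> T) z) = int N" using a by simp
    have "(\<Sum>x\<in>?S. det_char N L b x * perm_char N ({..<L} \<times> {..<L}) (int \<circ> T) x) =
        fact N * alt_sum L ({..<L} \<times> {..<L}) (int \<circ> T) (agrees L b)"
      by (rule det_char_inner[OF _ total]) simp
    also have "alt_sum L ({..<L} \<times> {..<L}) (int \<circ> T) (agrees L b) = ?h T"
      unfolding sq(1) by (rule alt_sum_insert[OF sq(3,2)]) (simp only: b total[unfolded sq(1)])
    also have "?h T = ?h (restrict T ?J)"
      by (rule alt_sum_labels_cong) simp
    finally show "(\<Sum>x\<in>?S. det_char N L b x * perm_char N ({..<L} \<times> {..<L}) (int \<circ> T) x) = fact N * ?h (restrict T ?J)" .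
  qed
  also have "\<dots> = (\<Sum>T\<in>{T \<in> partial_tables L a c. (\<Sum>z\<in>?J. int (T z)) \<le> int N}. fact N * ?h T)"
    by (rule sum.reindex_bij_betw[OF tables_corner_bij[OF L a c]])
  also have "\<dots> = (\<Sum>T\<in>partial_tables L a c. fact N * ?h T)"
  proof (rule sum.mono_neutral_left[OF finite_partial_tables[OF L]])
    show "\<forall>T\<in>partial_tables L a c - {T \<in> partial_tables L a c. (\<Sum>z\<in>?J. int (T z)) \<le> int N}. fact N * ?h T = 0"
    proof
      fix T assume "T \<in> partial_tables L a c - {T \<in> partial_tables L a c. (\<Sum>z\<in>?J. int (T z)) \<le> int N}"
      then have gt: "int N < (\<Sum>z\<in>?J. int (T z))" by auto
      \<comment> \<open>Every exponent that occurs has degree greater than N, the degree of b, and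
        so cannot lie below b.\<close>
      have "?h T = alt_sum L ?J (int \<circ> T) (\<lambda>v. 0)"
      proof (rule alt_sum_cong[OF sq(3)])
        fix v assume v: "(\<Sum>i<L. v i + int i) = (\<Sum>z\<in>?J. (int \<circ> T) z)"
        have "\<not> (\<forall>i<L. v i \<le> b i)"
        proof
          assume "\<forall>i<L. v i \<le> b i"
          then have "(\<Sum>i<L. v i + int i) \<le> (\<Sum>i<L. b i + int i)" by (intro sum_mono) auto
          then show False using v gt b by simp
        qed
        then show "of_bool (\<forall>i<L. v i \<le> b i) = (0 :: int)" by simp
      qed
      then show "fact N * ?h T = 0" by (simp add: alt_sum_def)
    qed
  qed auto
  finally show ?thesis by (simp add: sum_distrib_left)
qed

definition shift_first :: "int \<Rightarrow> (nat \<Rightarrow> int) \<Rightarrow> nat \<Rightarrow> int" where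
  "shift_first m a = a(0 := a 0 + m)"

text \<open>
  The functional whose value at the indicator of \<open>v \<le> b\<close> is the Kronecker coefficient, extended to
  integer vectors, for all partitions that differ from \<open>(p, q)\<close> in their first parts.
\<close>

definition stable_functional :: "nat \<Rightarrow> (nat \<Rightarrow> int) \<Rightarrow> (nat \<Rightarrow> int) \<Rightarrow> ((nat \<Rightarrow> int) \<Rightarrow> int) \<Rightarrow> int" where
  "stable_functional L p q G = (\<Sum>w | w permutes {..<L}. \<Sum>u | u permutes {..<L}. sign w * sign u *
    (\<Sum>T\<in>partial_tables L (\<lambda>i. p i + int (w i)) (\<lambda>i. q i + int (u i)). alt_sum L (corner_free L) (int \<circ> T) G))"

text \<open>Partial tables ignore the margins at index 0. This is where m drops out of mu and
  nu.\<close>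

lemma partial_tables_shift_first:
  "partial_tables L (\<lambda>i. shift_first m p i + f i) (\<lambda>i. shift_first m q i + g i) =
    partial_tables L (\<lambda>i. p i + f i) (\<lambda>i. q i + g i)"
  by (auto simp: partial_tables_def shift_first_def)

lemma det_char_inner_stable:
  assumes L: "0 < L" and p: "(\<Sum>i<L. p i + int i) = int n" and q: "(\<Sum>i<L. q i + int i) = int n"
    and b: "(\<Sum>i<L. b i + int i) = int (n + m)"
  shows "(\<Sum>x | x permutes {..<n + m}. det_char (n + m) L b x *
      (det_char (n + m) L (shift_first (int m) p) x * det_char (n + m) L (shift_first (int m) q) x)) =
    fact (n + m) * stable_functional L p q (\<lambda>v. of_bool (\<forall>i<L. v i \<le> b i))"
proof -
  let ?S = "{x. x permutes {..<n + m}}" and ?W = "{w. w permutes {..<L}}"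
  let ?p = "\<lambda>w i. shift_first (int m) p i + int (w i)" and ?q = "\<lambda>u i. shift_first (int m) q i + int (u i)"
  have total: "(\<Sum>i<L. shift_first (int m) r i + int (w i)) = int (n + m)"
    if r: "(\<Sum>i<L. r i + int i) = int n" and w: "w permutes {..<L}" for r w
  proof -
    have "(\<Sum>i<L. shift_first (int m) r i) = (\<Sum>i<L. r i) + int m"
      using L by (simp add: sum_lessThan_split_0 shift_first_def)
    then show ?thesis using r sum_perms_upto[OF w] by (simp add: sum.distrib)
  qed
  let ?F = "\<lambda>w u x. sign w * sign u * (det_char (n + m) L b x *
      (perm_char (n + m) {..<L} (?p w) x * perm_char (n + m) {..<L} (?q u) x))"
  have "(\<Sum>x\<in>?S. det_char (n + m) L b x *
      (det_char (n + m) L (shift_first (int m) p) x * det_char (n + m) L (shift_first (int m) q) x)) =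
      (\<Sum>x\<in>?S. \<Sum>w\<in>?W. \<Sum>u\<in>?W. ?F w u x)"
  proof (rule sum.cong[OF refl])
    fix x
    have "det_char (n + m) L (shift_first (int m) p) x * det_char (n + m) L (shift_first (int m) q) x =
      (\<Sum>w\<in>?W. \<Sum>u\<in>?W. (sign w * perm_char (n + m) {..<L} (?p w) x) * (sign u * perm_char (n + m) {..<L} (?q u) x))"
      by (simp add: det_char_def sum_product)
    then show "det_char (n + m) L b x *
      (det_char (n + m) L (shift_first (int m) p) x * det_char (n + m) L (shift_first (int m) q) x) =
      (\<Sum>w\<in>?W. \<Sum>u\<in>?W. ?F w u x)"
      by (simp only: sum_distrib_left mult_ac)
  qed
  also have "\<dots> = (\<Sum>w\<in>?W. \<Sum>x\<in>?S. \<Sum>u\<in>?W. ?F w u x)" by (rule sum.swap)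
  also have "\<dots> = (\<Sum>w\<in>?W. \<Sum>u\<in>?W. \<Sum>x\<in>?S. ?F w u x)" by (intro sum.cong refl sum.swap)
  also have "\<dots> = (\<Sum>w\<in>?W. \<Sum>u\<in>?W. fact (n + m) * (sign w * sign u *
    (\<Sum>T\<in>partial_tables L (\<lambda>i. p i + int (w i)) (\<lambda>i. q i + int (u i)).
      alt_sum L (corner_free L) (int \<circ> T) (\<lambda>v. of_bool (\<forall>i<L. v i \<le> b i)))))"
  proof (intro sum.cong refl)
    fix w u assume "w \<in> ?W" "u \<in> ?W"
    then have w: "w permutes {..<L}" and u: "u permutes {..<L}" by auto
    show "(\<Sum>x\<in>?S. ?F w u x) = fact (n + m) * (sign w * sign u *
      (\<Sum>T\<in>partial_tables L (\<lambda>i. p i + int (w i)) (\<lambda>i. q i + int (u i)).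
        alt_sum L (corner_free L) (int \<circ> T) (\<lambda>v. of_bool (\<forall>i<L. v i \<le> b i))))"
      using det_char_perm_char_inner_stable[OF L total[OF p w] total[OF q u] b]
      by (simp add: partial_tables_shift_first mult_ac flip: sum_distrib_left)
  qed
  finally show ?thesis by (simp only: stable_functional_def sum_distrib_left)
qed

section \<open>Degree bounds for the stable functional\<close>

context
  fixes L n :: nat and p q :: "nat \<Rightarrow> int"
  assumes L: "n < L" and p: "(\<Sum>i<L. p i + int i) = int n" "0 \<le> p 0"
    and q: "(\<Sum>i<L. q i + int i) = int n" "0 \<le> q 0"
begin

text \<open>Each margin vector sums to n. Its entry at index 0 is nonnegative, because p 0 and q 0
  are, so the margins at the other indices sum to at most n.\<close>

lemma stable_total_le:
  assumes "T \<in> partial_tables L (\<lambda>i. p i + int (w i)) (\<lambda>i. q i + int (u i))"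
    and w: "w permutes {..<L}" and u: "u permutes {..<L}"
  shows "(\<Sum>z\<in>corner_free L. (int \<circ> T) z) \<le> 2 * int n"
proof -
  have L0: "0 < L" using L by simp
  have "(\<Sum>i\<in>{..<L} - {0}. r i + int (w i)) \<le> int n"
    if r: "(\<Sum>i<L. r i + int i) = int n" "0 \<le> r 0" and w: "w permutes {..<L}" for r w
  proof -
    have "(\<Sum>i<L. r i + int (w i)) = int n"
      using r(1) sum_perms_upto[OF w] by (simp add: sum.distrib)
    then show ?thesis using r(2) by (simp add: sum_lessThan_split_0[OF L0])
  qed
  from this[OF p w] this[OF q u] show ?thesis
    using partial_tables_total[OF L0 assms(1)] by simp
qed

lemma stable_functional_cong:
  assumes "\<And>v. (\<And>i. i < L \<Longrightarrow> v i \<le> 2 * int n) \<Longrightarrow> G v = H v"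
  shows "stable_functional L p q G = stable_functional L p q H"
  unfolding stable_functional_def
proof (intro sum.cong refl arg_cong[where f = "(*) _"])
  fix w u T assume "w \<in> {w. w permutes {..<L}}" "u \<in> {w. w permutes {..<L}}"
    and T: "T \<in> partial_tables L (\<lambda>i. p i + int (w i)) (\<lambda>i. q i + int (u i))"
  then have le: "(\<Sum>z\<in>corner_free L. (int \<circ> T) z) \<le> 2 * int n"
    using stable_total_le by blast
  show "alt_sum L (corner_free L) (int \<circ> T) G = alt_sum L (corner_free L) (int \<circ> T) H"
  proof (rule alt_sum_cong)
    show "finite (corner_free L)" by (simp add: corner_free_def)
    fix v assume "\<And>i. i < L \<Longrightarrow> v i \<le> (\<Sum>z\<in>corner_free L. (int \<circ> T) z)"
    then show "G v = H v" using le by (intro assms) force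
  qed
qed

lemma stable_functional_bounded_eq_sum:
  assumes b: "(\<Sum>i<L. b i + int i) = int n"
  shows "stable_functional L p q (\<lambda>v. of_bool (\<forall>i<L. v i \<le> b i)) =
    (\<Sum>k<L. stable_functional L p q (\<lambda>v. of_bool (\<forall>j<L. j \<noteq> k \<longrightarrow> v j \<le> b j)))"
proof -
  let ?W = "{w. w permutes {..<L}}"
  let ?R = "\<lambda>w u. partial_tables L (\<lambda>i. p i + int (w i)) (\<lambda>i. q i + int (u i))"
  let ?G = "\<lambda>k v. of_bool (\<forall>j<L. j \<noteq> k \<longrightarrow> v j \<le> b j) :: int"
  have "stable_functional L p q (\<lambda>v. of_bool (\<forall>i<L. v i \<le> b i)) =
      (\<Sum>w\<in>?W. \<Sum>u\<in>?W. sign w * sign u * (\<Sum>T\<in>?R w u. \<Sum>k<L. alt_sum L (corner_free L) (int \<circ> T) (?G k)))"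
    unfolding stable_functional_def
  proof (intro sum.cong refl arg_cong[where f = "(*) _"])
    fix w u T assume "w \<in> ?W" "u \<in> ?W" and T: "T \<in> ?R w u"
    \<comment> \<open>The left side is at most 2 n and the right side is n + L; \<open>n < L\<close>
      separates them.\<close>
    then have "(\<Sum>z\<in>corner_free L. (int \<circ> T) z) < (\<Sum>i<L. b i + int i) + int L"
      using stable_total_le[OF T] b L by simp
    then show "alt_sum L (corner_free L) (int \<circ> T) (\<lambda>v. of_bool (\<forall>i<L. v i \<le> b i)) =
        (\<Sum>k<L. alt_sum L (corner_free L) (int \<circ> T) (?G k))"
      by (rule alt_sum_bounded_eq_sum[rotated]) (simp add: corner_free_def)
  qed
  also have "\<dots> = (\<Sum>w\<in>?W. \<Sum>u\<in>?W. \<Sum>k<L. sign w * sign u * (\<Sum>T\<in>?R w u. alt_sum L (corner_free L) (int \<circ> T) (?G k)))"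
    by (intro sum.cong refl) (subst sum.swap, simp only: sum_distrib_left)
  also have "\<dots> = (\<Sum>w\<in>?W. \<Sum>k<L. \<Sum>u\<in>?W. sign w * sign u * (\<Sum>T\<in>?R w u. alt_sum L (corner_free L) (int \<circ> T) (?G k)))"
    by (intro sum.cong refl sum.swap)
  also have "\<dots> = (\<Sum>k<L. stable_functional L p q (?G k))"
    unfolding stable_functional_def by (rule sum.swap)
  finally show ?thesis .
qed

end

section \<open>Straightening of determinantal characters\<close>

lemma det_char_permute:
  assumes s: "s permutes {..<L}" and x: "x permutes {..<n}"
  shows "det_char n L (\<lambda>i. b (s i)) x = sign s * det_char n L b x"
proof -
  have "det_char n L (\<lambda>i. b (s i)) x =
      (\<Sum>w | w permutes {..<L}. sign (w \<circ> s) * perm_char n {..<L} (\<lambda>i. b (s i) + int ((w \<circ> s) i)) x)"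
    unfolding det_char_def by (rule sum_perm_compose_right[OF s, symmetric])
  also have "\<dots> = (\<Sum>w | w permutes {..<L}. sign s * (sign w * perm_char n {..<L} (\<lambda>i. b i + int (w i)) x))"
    by (rule sum.cong[OF refl])
      (simp add: sign_compose_perms[OF _ s] perm_char_relabel[OF s x, of "\<lambda>i. b i + int (_ i)"])
  finally show ?thesis by (simp add: det_char_def sum_distrib_left)
qed

text \<open>The cycle 0 to i, i to i - 1, and so on down to 0. As an index map it brings the entry
  at i to the front and moves the earlier ones back by one. Its sign is the origin of the signs in
  the theorem.\<close>

definition to_front :: "nat \<Rightarrow> nat \<Rightarrow> nat" where
  "to_front i j = (if j = 0 then i else if j \<le> i then j - 1 else j)"

lemma to_front_permutes_sign:
  "i < L \<Longrightarrow> to_front i permutes {..<L} \<and> sign (to_front i) = (-1) ^ i"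
proof (induction i)
  case 0
  have "to_front 0 = id" by (auto simp: to_front_def fun_eq_iff)
  then show ?case by (simp only: permutes_id sign_id power_0 simp_thms)
next
  case (Suc i)
  have eq: "to_front (Suc i) = transpose i (Suc i) \<circ> to_front i"
    by (auto simp: to_front_def fun_eq_iff transpose_def)
  have t: "transpose i (Suc i) permutes {..<L}" using Suc.prems by (intro permutes_swap_id) auto
  have IH: "to_front i permutes {..<L}" "sign (to_front i) = (-1) ^ i" using Suc by auto
  have "sign (to_front (Suc i)) = (-1) ^ Suc i"
    unfolding eq sign_compose_perms[OF t IH(1)] IH(2) by (simp add: sign_swap_id)
  then show ?case
    unfolding eq using permutes_compose[OF IH(1) t] by blast
qed


section \<open>Partitions with an enlarged first part\<close>

lemma support_subset_lessThan:
  fixes lam :: "nat \<Rightarrow> nat"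
  assumes "\<And>j. k \<le> j \<Longrightarrow> lam j = 0"
  shows "{j. lam j \<noteq> 0} \<subseteq> {..<k}"
proof
  fix j assume "j \<in> {j. lam j \<noteq> 0}"
  then have "\<not> k \<le> j" using assms[of j] by auto
  then show "j \<in> {..<k}" by simp
qed

lemma weight_eq_sum_lessThan:
  assumes "\<And>j. k \<le> j \<Longrightarrow> lam j = 0"
  shows "weight lam = (\<Sum>j<k. lam j)"
  unfolding weight_def by (rule sum.mono_neutral_left) (use support_subset_lessThan[of k lam] assms in auto)

lemma part_length_le:
  assumes "\<And>j. k \<le> j \<Longrightarrow> lam j = 0"
  shows "part_length lam \<le> k"
  unfolding part_length_def using card_mono[OF _ support_subset_lessThan[of k lam]] assms by fastforce

lemma is_partitionI:
  assumes "\<And>j. lam (Suc j) \<le> lam j" "\<And>j. k \<le> j \<Longrightarrow> lam j = 0"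
  shows "is_partition lam"
  unfolding is_partition_def
proof
  show "antimono lam" using assms(1) by (rule decseq_SucI)
  show "finite {j. lam j \<noteq> 0}"
    using support_subset_lessThan[of k lam] assms(2) by (auto intro: finite_subset)
qed

lemma pad_remove_first:
  assumes mu: "partition_of n mu"
  shows "pad (n + m) (remove_first mu) = mu(0 := mu 0 + m)"
proof -
  have part: "is_partition mu" "weight mu = n" using mu by (auto simp: partition_of_def)
  have zero: "part_length mu \<le> j \<Longrightarrow> mu j = 0" for j by (rule partition_vanishes[OF part(1)])
  have "weight (remove_first mu) = (\<Sum>j<part_length mu. mu (Suc j))"
    using weight_eq_sum_lessThan[of "part_length mu" "remove_first mu"] zero by (simp add: remove_first_def)
  moreover have "n = (\<Sum>j<Suc (part_length mu). mu j)"
    using weight_eq_sum[OF part(1), of "Suc (part_length mu)"] part(2) by simp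
  ultimately have "n = mu 0 + weight (remove_first mu)"
    by (simp add: sum.lessThan_Suc_shift del: sum.lessThan_Suc)
  then show ?thesis by (auto simp: pad_def remove_first_def fun_eq_iff split: nat.split)
qed

lemma pad_remove_first_partition:
  assumes mu: "partition_of n mu" and len: "part_length mu \<le> l" "1 \<le> l"
  shows "partition_of (n + m) (mu(0 := mu 0 + m))" "part_length (mu(0 := mu 0 + m)) \<le> l"
proof -
  have part: "is_partition mu" "weight mu = n" using mu by (auto simp: partition_of_def)
  have zero: "(mu(0 := mu 0 + m)) j = 0" if "l \<le> j" for j
    using that len partition_vanishes[OF part(1), of j] by auto
  show "part_length (mu(0 := mu 0 + m)) \<le> l" using zero by (rule part_length_le)
  have "mu (Suc j) \<le> mu j" for j using part(1) by (simp add: is_partition_def antimonoD)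
  then have "(mu(0 := mu 0 + m)) (Suc j) \<le> (mu(0 := mu 0 + m)) j" for j by (simp add: trans_le_add1)
  then have "is_partition (mu(0 := mu 0 + m))" using zero by (rule is_partitionI)
  moreover have "weight (mu(0 := mu 0 + m)) = n + m"
  proof -
    obtain k where k: "l = Suc k" using len(2) by (cases l) auto
    have "weight (mu(0 := mu 0 + m)) = (\<Sum>j<l. (mu(0 := mu 0 + m)) j)"
      using zero by (rule weight_eq_sum_lessThan)
    also have "\<dots> = (\<Sum>j<l. mu j) + m"
      unfolding k by (simp add: sum.lessThan_Suc_shift del: sum.lessThan_Suc)
    also have "(\<Sum>j<l. mu j) = n" using weight_eq_sum[OF part(1) len(1)] part(2) by simp
    finally show ?thesis .
  qed
  ultimately show "partition_of (n + m) (mu(0 := mu 0 + m))" by (simp add: partition_of_def)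
qed

context
  fixes n L i m :: nat and lam :: "nat \<Rightarrow> nat"
  assumes lam: "partition_of n lam" and len: "part_length lam \<le> L" and i: "i < L" and m: "n + L < m"
begin

lemma dagger_zero: "L - 1 \<le> j \<Longrightarrow> dagger (Suc i) lam j = 0"
  using partition_vanishes[of lam "Suc j"] lam len i by (auto simp: dagger_def partition_of_def)

lemma weight_dagger: "weight (dagger (Suc i) lam) + lam i = n + i"
proof -
  obtain l where l: "L = Suc l" using i by (cases L) auto
  have part: "is_partition lam" "weight lam = n" using lam by (auto simp: partition_of_def)
  have "weight (dagger (Suc i) lam) = (\<Sum>j<l. dagger (Suc i) lam j)"
    using dagger_zero by (intro weight_eq_sum_lessThan) (simp add: l)
  also have "\<dots> = (\<Sum>j<i. 1 + lam j) + (\<Sum>j\<in>{i..<l}. lam (Suc j))"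
  proof -
    have "{..<l} = {..<i} \<union> {i..<l}" using i l by auto
    then show ?thesis by (simp add: sum.union_disjoint ivl_disj_int dagger_def)
  qed
  also have "\<dots> = i + ((\<Sum>j<i. lam j) + (\<Sum>j\<in>{Suc i..<L}. lam j))"
    unfolding l sum.shift_bounds_Suc_ivl by (simp add: sum_Suc)
  finally have "weight (dagger (Suc i) lam) + lam i = i + ((\<Sum>j<i. lam j) + (lam i + (\<Sum>j\<in>{Suc i..<L}. lam j)))"
    by simp
  also have "lam i + (\<Sum>j\<in>{Suc i..<L}. lam j) = (\<Sum>j\<in>{i..<L}. lam j)"
    using i by (simp add: sum.atLeast_Suc_lessThan)
  also have "(\<Sum>j<i. lam j) + (\<Sum>j\<in>{i..<L}. lam j) = (\<Sum>j<L. lam j)"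
  proof -
    have "{..<L} = {..<i} \<union> {i..<L}" using i by auto
    then show ?thesis by (simp add: sum.union_disjoint ivl_disj_int)
  qed
  also have "\<dots> = n" using weight_eq_sum[OF part(1) len] part(2) by simp
  finally show ?thesis by simp
qed

lemma pad_dagger_0: "pad (n + m) (dagger (Suc i) lam) 0 = m + lam i - i"
  using weight_dagger m i by (simp add: pad_def)

lemma pad_dagger_Suc: "pad (n + m) (dagger (Suc i) lam) (Suc j) = (if j < i then 1 + lam j else lam (Suc j))"
  by (simp add: pad_def dagger_def)

lemma pad_dagger_zero: "L \<le> j \<Longrightarrow> pad (n + m) (dagger (Suc i) lam) j = 0"
  using dagger_zero[of "j - 1"] i by (cases j) (auto simp: pad_def)

lemma pad_dagger_length: "part_length (pad (n + m) (dagger (Suc i) lam)) \<le> L"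
  using pad_dagger_zero by (rule part_length_le)

text \<open>The large first part and the i incremented parts are all positive. For i at least
  \<open>l1 * l2\<close> the padded partition is therefore too long for a nonzero Kronecker
  coefficient.\<close>

lemma pad_dagger_length_gt: "i < part_length (pad (n + m) (dagger (Suc i) lam))"
proof -
  have "{..i} \<subseteq> {j. pad (n + m) (dagger (Suc i) lam) j \<noteq> 0}"
  proof
    fix j assume "j \<in> {..i}"
    then show "j \<in> {j. pad (n + m) (dagger (Suc i) lam) j \<noteq> 0}"
      using pad_dagger_0 pad_dagger_Suc m i by (cases j) auto
  qed
  moreover have "finite {j. pad (n + m) (dagger (Suc i) lam) j \<noteq> 0}"
    by (rule finite_subset[OF support_subset_lessThan[OF pad_dagger_zero]]) auto
  ultimately have "card {..i} \<le> part_length (pad (n + m) (dagger (Suc i) lam))"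
    unfolding part_length_def by (rule card_mono[rotated])
  then show ?thesis by simp
qed

lemma pad_dagger_partition: "partition_of (n + m) (pad (n + m) (dagger (Suc i) lam))"
proof -
  let ?k = "pad (n + m) (dagger (Suc i) lam)"
  have part: "is_partition lam" "weight lam = n" using lam by (auto simp: partition_of_def)
  have dec: "lam (Suc j) \<le> lam j" for j using part(1) by (simp add: is_partition_def antimonoD)
  have "lam j \<le> n" for j
  proof (cases "j < L")
    case True
    then have "lam j \<le> (\<Sum>j<L. lam j)" by (intro member_le_sum) auto
    then show ?thesis using weight_eq_sum[OF part(1) len] part(2) by simp
  next
    case False
    then show ?thesis using partition_vanishes[OF part(1), of j] len by simp
  qed
  then have le: "lam j \<le> n" for j .
  have "?k (Suc j) \<le> ?k j" for j
  proof (cases j)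
    case 0
    \<comment> \<open>By \<open>n + L < m\<close> and \<open>i < L\<close> the new first part
      exceeds n + 1, which bounds both possible values of the second part.\<close>
    then show ?thesis using le[of 0] le[of 1] m i by (auto simp: pad_dagger_0 pad_dagger_Suc)
  next
    case (Suc l)
    then show ?thesis using dec[of l] dec[of "Suc l"] by (auto simp: pad_dagger_Suc)
  qed
  then have "is_partition ?k" using pad_dagger_zero by (rule is_partitionI)
  moreover have "weight ?k = n + m"
  proof -
    have "weight ?k = (\<Sum>j<Suc L. ?k j)"
      using pad_dagger_zero by (intro weight_eq_sum_lessThan) auto
    also have "\<dots> = ?k 0 + (\<Sum>j<L. dagger (Suc i) lam j)"
      by (simp only: sum.lessThan_Suc_shift) (simp add: pad_def)
    also have "(\<Sum>j<L. dagger (Suc i) lam j) = weight (dagger (Suc i) lam)"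
      using dagger_zero by (intro weight_eq_sum_lessThan[symmetric]) auto
    also have "?k 0 + weight (dagger (Suc i) lam) = n + m"
      using weight_dagger pad_dagger_0 m i by simp
    finally show ?thesis .
  qed
  ultimately show ?thesis by (simp add: partition_of_def)
qed

text \<open>Straightening: \<open>(N - |lam\<^sup>\<dagger>|, lam\<^sup>\<dagger>)\<close> and \<open>lam\<close> with \<open>m\<close> added to its \<open>i\<close>-th part differ by a cyclic shift of \<open>lam - \<delta>\<close>.\<close>

lemma det_char_pad_dagger:
  assumes x: "x permutes {..<n + m}"
  shows "det_char (n + m) L (\<lambda>j. int (pad (n + m) (dagger (Suc i) lam) j) - int j) x =
    (-1) ^ i * det_char (n + m) L ((\<lambda>j. int (lam j) - int j)(i := int (lam i) - int i + int m)) x"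
proof -
  let ?b = "(\<lambda>j. int (lam j) - int j)(i := int (lam i) - int i + int m)"
  have "(\<lambda>j. int (pad (n + m) (dagger (Suc i) lam) j) - int j) = (\<lambda>j. ?b (to_front i j))"
  proof
    fix j
    show "int (pad (n + m) (dagger (Suc i) lam) j) - int j = ?b (to_front i j)"
      using m i by (cases j) (auto simp: pad_dagger_0 pad_dagger_Suc to_front_def of_nat_diff)
  qed
  then show ?thesis
    using det_char_permute[OF _ x, of "to_front i" L ?b] to_front_permutes_sign[OF i] by simp
qed

end

theorem theorem3:
  fixes l1 l2 n :: nat and lam mu nu :: "nat \<Rightarrow> nat"
  assumes "l1 \<ge> 1" and "l2 \<ge> 1" and "n \<ge> 1"
    and "partition_of n lam" and "partition_of n mu" and "partition_of n nu"
    and "part_length mu \<le> l1" and "part_length nu \<le> l2"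
    and "part_length lam \<le> l1 * l2"
  shows "int (kronecker n mu nu lam) =
    (\<Sum>i = 1..l1 * l2. (-1) ^ (i + 1) *
       int (reduced_kronecker (remove_first mu) (remove_first nu) (dagger i lam)))"
proof -
  \<comment> \<open>L > n serves the degree argument, and L >= l1 * l2 accommodates the three
    lengths and all indices of the sum.\<close>
  define L where "L = n + l1 * l2 + 1"
  have L: "n < L" "0 < L" "part_length lam \<le> L" "l1 \<le> L" "l2 \<le> L" "l1 * l2 \<le> L"
    using assms(1,2,9) by (auto simp: L_def intro: order_trans[of _ "l1 * l2"])
  have len: "part_length mu \<le> L" "part_length nu \<le> L" using assms(7,8) L by auto
  define vec where "vec k j = int (k j) - int j" for k :: "nat \<Rightarrow> nat" and j
  have vec_total: "(\<Sum>j<L. vec k j + int j) = int N" if "partition_of N k" "part_length k \<le> L" for k N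
    using that weight_eq_sum[of k L] by (auto simp: partition_of_def vec_def)
  have vec_0: "0 \<le> vec k 0" for k by (simp add: vec_def)
  note ctx = L(1) vec_total[OF assms(5) len(1)] vec_0[of mu] vec_total[OF assms(6) len(2)] vec_0[of nu]
  let ?K = "stable_functional L (vec mu) (vec nu)"
  have mu_m: "vec (mu(0 := mu 0 + m)) = shift_first (int m) (vec mu)" and
    nu_m: "vec (nu(0 := nu 0 + m)) = shift_first (int m) (vec nu)" for m
    by (auto simp: vec_def shift_first_def fun_eq_iff)
  have mu_part: "partition_of (n + m) (mu(0 := mu 0 + m))" "part_length (mu(0 := mu 0 + m)) \<le> l1" for m
    using pad_remove_first_partition[OF assms(5,7,1)] by auto
  have nu_part: "partition_of (n + m) (nu(0 := nu 0 + m))" "part_length (nu(0 := nu 0 + m)) \<le> l2" for m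
    using pad_remove_first_partition[OF assms(6,8,2)] by auto
  \<comment> \<open>The scalar s allows one evaluation for two uses: m = 0 and s = 1 give the
    coefficient on the left of the theorem, large m and s = (-1)^i the padded coefficients after
    straightening.\<close>
  have kron: "int (kronecker (n + m) (mu(0 := mu 0 + m)) (nu(0 := nu 0 + m)) k) = s * ?K (\<lambda>v. of_bool (\<forall>j<L. v j \<le> b j))"
    if k: "partition_of (n + m) k" "part_length k \<le> L"
      and b: "(\<Sum>j<L. b j + int j) = int (n + m)"
      and s: "\<And>x. x permutes {..<n + m} \<Longrightarrow> det_char (n + m) L (vec k) x = s * det_char (n + m) L b x"
    for m k s b
  proof -
    have "fact (n + m) * int (kronecker (n + m) (mu(0 := mu 0 + m)) (nu(0 := nu 0 + m)) k) =
        (\<Sum>x | x permutes {..<n + m}. det_char (n + m) L (vec k) x *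
          (det_char (n + m) L (shift_first (int m) (vec mu)) x * det_char (n + m) L (shift_first (int m) (vec nu)) x))"
      unfolding mu_m[symmetric] nu_m[symmetric] vec_def
      using L mu_part(2)[of m] nu_part(2)[of m]
      by (intro kronecker_eq_det_char_sum k mu_part(1) nu_part(1)) auto
    also have "\<dots> = s * (\<Sum>x | x permutes {..<n + m}. det_char (n + m) L b x *
          (det_char (n + m) L (shift_first (int m) (vec mu)) x * det_char (n + m) L (shift_first (int m) (vec nu)) x))"
      by (simp add: s sum_distrib_left mult.assoc)
    also have "\<dots> = fact (n + m) * (s * ?K (\<lambda>v. of_bool (\<forall>j<L. v j \<le> b j)))"
      using det_char_inner_stable[OF L(2) ctx(2,4) b] by simp
    finally show ?thesis by simp
  qed
  let ?Ki = "\<lambda>i. ?K (\<lambda>v. of_bool (\<forall>j<L. j \<noteq> i \<longrightarrow> v j \<le> vec lam j))"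
  have kron_dagger: "int (kronecker (n + m) (mu(0 := mu 0 + m)) (nu(0 := nu 0 + m)) (pad (n + m) (dagger (Suc i) lam))) = (-1) ^ i * ?Ki i"
    if i: "i < L" and m: "2 * n + L < m" for i m
  proof -
    have m': "n + L < m" using m by simp
    let ?b = "(vec lam)(i := vec lam i + int m)"
    have "(\<Sum>j<L. ?b j + int j) = (\<Sum>j<L. vec lam j + int j) + int m"
      using i by (simp add: sum.remove[of "{..<L}" i])
    then have total: "(\<Sum>j<L. ?b j + int j) = int (n + m)"
      using vec_total[OF assms(4) L(3)] by simp
    have b: "?b = (\<lambda>j. int (lam j) - int j)(i := int (lam i) - int i + int m)"
      by (auto simp: vec_def fun_eq_iff)
    have "int (kronecker (n + m) (mu(0 := mu 0 + m)) (nu(0 := nu 0 + m)) (pad (n + m) (dagger (Suc i) lam))) =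
        (-1) ^ i * ?K (\<lambda>v. of_bool (\<forall>j<L. v j \<le> ?b j))"
    proof (intro kron pad_dagger_partition[OF assms(4) L(3) i m'] pad_dagger_length[OF assms(4) L(3) i m'] total)
      show "det_char (n + m) L (vec (pad (n + m) (dagger (Suc i) lam))) x = (-1) ^ i * det_char (n + m) L ?b x"
        if "x permutes {..<n + m}" for x
        using det_char_pad_dagger[OF assms(4) L(3) i m' that] unfolding b by (simp only: vec_def[abs_def])
    qed
    also have "?K (\<lambda>v. of_bool (\<forall>j<L. v j \<le> ?b j)) = ?Ki i"
    proof (rule stable_functional_cong[OF ctx])
      fix v :: "nat \<Rightarrow> int" assume v: "\<And>j. j < L \<Longrightarrow> v j \<le> 2 * int n"
      \<comment> \<open>\<open>vec lam i\<close> is greater than -L and v i is at most 2 n, so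
        \<open>2 * n + L < m\<close> makes the i-th bound vacuous.\<close>
      have "v i \<le> vec lam i + int m" using v[OF i] m i by (simp add: vec_def)
      then show "of_bool (\<forall>j<L. v j \<le> ?b j) = (of_bool (\<forall>j<L. j \<noteq> i \<longrightarrow> v j \<le> vec lam j) :: int)"
        by (intro arg_cong[of _ _ of_bool]) auto
    qed
    finally show ?thesis .
  qed
  have reduced: "int (reduced_kronecker (remove_first mu) (remove_first nu) (dagger (Suc i) lam)) = (-1) ^ i * ?Ki i"
    if i: "i < L" for i
  proof -
    define r where "r N = kronecker N (pad N (remove_first mu)) (pad N (remove_first nu)) (pad N (dagger (Suc i) lam))" for N
    \<comment> \<open>With N = n + m the bound \<open>2 * n + L < m\<close> becomes this
      one.\<close>
    have r: "int (r N) = (-1) ^ i * ?Ki i" if N: "3 * n + L < N" for N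
    proof -
      obtain m where m: "N = n + m" "2 * n + L < m" using N by (auto intro: that[of "N - n"])
      show ?thesis
        using kron_dagger[OF i m(2)] unfolding r_def m(1) pad_remove_first[OF assms(5)] pad_remove_first[OF assms(6)] .
    qed
    have "r N = r (3 * n + L + 1)" if "3 * n + L + 1 \<le> N" for N
      using r[of N] r[of "3 * n + L + 1"] that by simp
    then have "eventually (\<lambda>N. r N = r (3 * n + L + 1)) sequentially"
      unfolding eventually_sequentially by blast
    then have "lim r = r (3 * n + L + 1)"
      by (intro limI tendsto_eventually)
    then show ?thesis
      using r[of "3 * n + L + 1"] by (simp add: reduced_kronecker_def r_def[abs_def])
  qed
  \<comment> \<open>\<open>?Ki i\<close> does not involve m, so it is enough that the padded
    coefficient vanishes for a single sufficiently large m.\<close>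
  have vanish: "?Ki i = 0" if i: "i < L" "l1 * l2 \<le> i" for i
  proof -
    define m where "m = 2 * n + L + 1"
    have m: "2 * n + L < m" "n + L < m" by (auto simp: m_def)
    have "part_length (mu(0 := mu 0 + m)) * part_length (nu(0 := nu 0 + m)) \<le> l1 * l2"
      using mu_part(2) nu_part(2) by (intro mult_le_mono)
    also have "\<dots> < part_length (pad (n + m) (dagger (Suc i) lam))"
      using pad_dagger_length_gt[OF assms(4) L(3) i(1) m(2)] i(2) by simp
    finally have "kronecker (n + m) (mu(0 := mu 0 + m)) (nu(0 := nu 0 + m)) (pad (n + m) (dagger (Suc i) lam)) = 0"
      by (intro kronecker_eq_0_if_long pad_dagger_partition[OF assms(4) L(3) i(1) m(2)] mu_part(1) nu_part(1))
    then show ?thesis using kron_dagger[OF i(1) m(1)] by simp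
  qed
  have "int (kronecker n mu nu lam) = ?K (\<lambda>v. of_bool (\<forall>j<L. v j \<le> vec lam j))"
    using kron[of 0 lam "vec lam" 1] assms(4) L(3) vec_total[OF assms(4) L(3)] by simp
  also have "\<dots> = (\<Sum>i<L. ?Ki i)"
    by (rule stable_functional_bounded_eq_sum[OF ctx vec_total[OF assms(4) L(3)]])
  also have "\<dots> = (\<Sum>i<l1 * l2. ?Ki i)"
    using L(6) vanish by (intro sum.mono_neutral_right) auto
  \<comment> \<open>The exponent \<open>Suc i + 1\<close> has the parity of i, so the sign cancels
    the factor (-1)^i in \<open>reduced\<close>.\<close>
  also have "\<dots> = (\<Sum>i<l1 * l2. (-1) ^ (Suc i + 1) *
      int (reduced_kronecker (remove_first mu) (remove_first nu) (dagger (Suc i) lam)))"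
    using L(6) by (intro sum.cong refl) (simp add: reduced power_mult_distrib[symmetric] flip: power_add)
  also have "\<dots> = (\<Sum>i = 1..l1 * l2. (-1) ^ (i + 1) *
      int (reduced_kronecker (remove_first mu) (remove_first nu) (dagger i lam)))"
    by (rule sum.reindex_bij_witness[where i = "\<lambda>i. i - 1" and j = Suc]) auto
  finally show ?thesis .
qed

end
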